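(* Consider the $K$-armed Bayesian bandit with horizon $n$ in which, in environment $\boldsymbol\nu=(\nu_1,\dots,\nu_K)\in\mathbb R^K$, the rewards of the $k$-th arm are distributed as $\mathcal N(\nu_k,\sigma^2(n))$, and the prior is the product of $\nu_k\sim\mathcal N(\alpha_k(n),\beta_k(n)^2)$, $1\le k\le K$. Let $w^i(\mathbf s,\mathbf q)$ be its optimal expected cumulative reward from round $i$ (defined in the context). Let $f(n)>0$ be a scaling factor such that there exist real numbers $\hat\alpha_k,\hat\beta_k$ ($1\le k\le K$) and $\hat\sigma$ with $$\lim_{n\to\infty}\frac{\sigma^2(n)\alpha_k(n)}{f(n)\beta_k^2(n)}=\hat\alpha_k,\qquad \lim_{n\to\infty}\frac{\sigma^2(n)}{\beta_k^2(n)\,n}=\hat\beta_k,\qquad \lim_{n\to\infty}\frac{\sqrt n}{f(n)}\sigma(n)=\hat\sigma .$$ Then, as $n\to\infty$, the rescaled Bayesian bandit problem with scaling factor $f(n)$ converges (in the sense defined in the context) to the HJB equation $$\partial_t v+\max_{\hat{\boldsymbol\pi}\in\Delta^K}\sum_{k=1}^K\Big(\partial_{\hat q_k}v+\hat\mu(\hat s_k,\hat q_k,\hat\alpha_k,\hat\beta_k)\,\partial_{\hat s_k}v+\tfrac12\hat\sigma^2\,\partial_{\hat s_k}^2v+\hat\mu(\hat s_k,\hat q_k,\hat\alpha_k,\hat\beta_k)\Big)\hat\pi_k=0,\qquad v(1,\hat{\mathbf s},\hat{\mathbf q})=0,$$ where $$\hat\mu(s,q,\hat\alpha_k,\hat\beta_k)=\frac{\hat\alpha_k+s}{\hat\beta_k+q}$$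 and the diffusion coefficient is the constant $\hat\sigma$.
   Context: $K\ge1$ is fixed, $n\in\mathbb Z_+$ is the horizon (number of rounds), $\sigma(n)>0$, $\beta_k(n)>0$, $\alpha_k(n)\in\mathbb R$, $\mathbf e_k$ is the $k$-th standard basis vector of $\mathbb R^K$, and $\Delta^K=\{\pi\in[0,1]^K:\sum_k\pi_k=1\}$. Bayesian bandit. In each round $i=1,\dots,n$ one arm is pulled and its reward is observed. The state at the beginning of round $i$ is $(\mathbf s,\mathbf q)$, where $s_k$ is the cumulative reward from arm $k$ and $q_k\in\{0,\dots,i-1\}$ the number of pulls of arm $k$ in rounds $1,\dots,i-1$. Given $(\mathbf s,\mathbf q)$, the posterior $\rho(\boldsymbol\nu|\mathbf s,\mathbf q)$ makes the $\nu_k$ independent with $\nu_k$ normal of mean $\frac{\alpha_k\beta_k^{-2}+s_k\sigma^{-2}}{q_k\sigma^{-2}+\beta_k^{-2}}$ and variance $\frac1{q_k\sigma^{-2}+\beta_k^{-2}}$. The goal is to maximize the total expected reward, each reward being averaged over the current posterior. The optimal expected cumulative reward $w^i(\mathbf s,\mathbf q)$ collected in rounds $i,\dots,n$ starting from state $(\mathbf s,\mathbf q)$ satisfies $w^{n+1}\equiv0$ and $$w^i(\mathbf s,\mathbf q)=\max_{1\le k\le K}\Big\{\int\mu_k(\boldsymbol\nu)\rho(\boldsymbol\nu|\mathbf s,\mathbf q)d\boldsymbol\nu+\int\mathbb E_{X\sim P_k^{\boldsymbol\nu}}\big[w^{i+1}(\mathbf s+X\mathbf e_k,\mathbf q+\mathbf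 e_k)\big]\rho(\boldsymbol\nu|\mathbf s,\mathbf q)d\boldsymbol\nu\Big\},$$ where $P^{\boldsymbol\nu}_k=\mathcal N(\nu_k,\sigma^2)$ is the reward law of arm $k$ and $\mu_k(\boldsymbol\nu)=\nu_k$ its mean. Admissible states at round $i$ are those with $q_k\in\{0,\dots,i-1\}$, and $s_k\in\mathbb R$ with $s_k=0$ if $q_k=0$. Convergence. Let $Q=\{\hat{\mathbf q}\in[0,1]^K:\hat\beta_k+\hat q_k>0\ \forall k\}$. "The rescaled Bayesian bandit problem with scaling factor $f(n)$ converges to the HJB equation" means: there is a function $v$ on $[0,1]\times\mathbb R^K\times Q$ that is a viscosity solution of the HJB equation in $(0,1)\times\mathbb R^K\times(0,1)^K$ with $v(1,\cdot,\cdot)=0$, such that $\frac1{f(n)}w^{i_n}(\mathbf s_n,\mathbf q_n)\to v(t,\hat{\mathbf s},\hat{\mathbf q})$ as $n\to\infty$ for every $(t,\hat{\mathbf s},\hat{\mathbf q})\in[0,1]\times\mathbb R^K\times Q$ and every sequence of rounds $i_n\in\{1,\dots,n+1\}$ and admissible states $(\mathbf s_n,\mathbf q_n)$ at round $i_n$ with $\big(\frac{i_n-1}{n},\frac{\mathbf s_n}{f(n)},\frac{\mathbf q_n}{n}\big)\to(t,\hat{\mathbf s},\hat{\mathbf q})$. *)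

theory Defs
  imports "HOL-Probability.Probability"
begin

text \<open>
  Arms are the elements of a finite type \<open>'k\<close>, so \<open>K = CARD('k) \<ge> 1\<close>. Environments \<open>\<nu>\<close> are
  functions \<open>'k \<Rightarrow> real\<close>, because the library's finite product measures live on functions;
  cumulative rewards, pull counts and parameters are vectors.
\<close>

section \<open>The Bayesian bandit with Gaussian rewards\<close>

abbreviation normal_law :: "real \<Rightarrow> real \<Rightarrow> real measure" where
  "normal_law m sd \<equiv> density lborel (\<lambda>x. ennreal (normal_density m sd x))"

definition post_mean :: "real \<Rightarrow> real^'k \<Rightarrow> real^'k \<Rightarrow> real^'k \<Rightarrow> nat^'k \<Rightarrow> 'k::finite \<Rightarrow> real" where
  "post_mean \<sigma> \<alpha> \<beta> s q k =
     (\<alpha>$k / (\<beta>$k)\<^sup>2 + s$k / \<sigma>\<^sup>2) / (real (q$k) / \<sigma>\<^sup>2 + 1 / (\<beta>$k)\<^sup>2)"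

definition post_var :: "real \<Rightarrow> real^'k \<Rightarrow> nat^'k \<Rightarrow> 'k::finite \<Rightarrow> real" where
  "post_var \<sigma> \<beta> q k = 1 / (real (q$k) / \<sigma>\<^sup>2 + 1 / (\<beta>$k)\<^sup>2)"

definition posterior ::
  "real \<Rightarrow> real^'k \<Rightarrow> real^'k \<Rightarrow> real^'k \<Rightarrow> nat^'k \<Rightarrow> ('k::finite \<Rightarrow> real) measure" where
  "posterior \<sigma> \<alpha> \<beta> s q =
     PiM UNIV (\<lambda>k. normal_law (post_mean \<sigma> \<alpha> \<beta> s q k) (sqrt (post_var \<sigma> \<beta> q k)))"

text \<open>Before any pull the posterior is the prior, the product of the laws \<open>N(\<alpha>\<^sub>k, \<beta>\<^sub>k\<^sup>2)\<close>.\<close>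

lemma posterior_initial:
  assumes "\<And>k. \<beta>$k > 0"
  shows "posterior \<sigma> \<alpha> \<beta> 0 0 = PiM UNIV (\<lambda>k::'k::finite. normal_law (\<alpha>$k) (\<beta>$k))"
proof -
  have "\<beta>$k \<noteq> 0" "sqrt ((\<beta>$k)\<^sup>2) = \<beta>$k" for k
    using assms[of k] by auto
  then show ?thesis
    by (simp add: posterior_def post_mean_def post_var_def)
qed

text \<open>
  \<open>opt_reward \<sigma> \<alpha> \<beta> n i s q\<close> is \<open>w\<^sup>i(s, q)\<close> for horizon \<open>n\<close>; it vanishes for \<open>i = n + 1\<close>.
\<close>

function opt_reward ::
  "real \<Rightarrow> real^'k \<Rightarrow> real^'k \<Rightarrow> nat \<Rightarrow> nat \<Rightarrow> real^'k \<Rightarrow> nat^'k::finite \<Rightarrow> real" where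
  "opt_reward \<sigma> \<alpha> \<beta> n i s q =
     (if i > n then 0
      else (MAX k. (\<integral>\<nu>. \<nu> k \<partial>posterior \<sigma> \<alpha> \<beta> s q)
        + (\<integral>\<nu>. (\<integral>x. opt_reward \<sigma> \<alpha> \<beta> n (i + 1) (s + axis k x) (q + axis k 1)
                   \<partial>normal_law (\<nu> k) \<sigma>)
             \<partial>posterior \<sigma> \<alpha> \<beta> s q)))"
  by auto
termination
  by (relation "Wellfounded.measure (\<lambda>(_, _, _, n, i, _, _). n + 1 - i)") auto

declare opt_reward.simps [simp del]

definition admissible :: "nat \<Rightarrow> real^'k \<Rightarrow> nat^'k::finite \<Rightarrow> bool" where
  "admissible i s q \<longleftrightarrow> (\<forall>k. q$k \<in> {0..i - 1} \<and> (q$k = 0 \<longrightarrow> s$k = 0))"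

section \<open>The HJB equation and its viscosity solutions\<close>

type_synonym 'k point = "real \<times> (real^'k) \<times> (real^'k)"

definition prob_simplex :: "(real^'k::finite) set" where
  "prob_simplex = {p. (\<forall>k. p$k \<in> {0..1}) \<and> (\<Sum>k\<in>UNIV. p$k) = 1}"

definition hat_mu :: "real \<Rightarrow> real \<Rightarrow> real \<Rightarrow> real \<Rightarrow> real" where
  "hat_mu s q a b = (a + s) / (b + q)"

definition partial_t :: "('k point \<Rightarrow> real) \<Rightarrow> 'k::finite point \<Rightarrow> real" where
  "partial_t \<phi> = (\<lambda>(t, s, q). deriv (\<lambda>h. \<phi> (t + h, s, q)) 0)"

definition partial_s :: "'k \<Rightarrow> ('k point \<Rightarrow> real) \<Rightarrow> 'k::finite point \<Rightarrow> real" where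
  "partial_s k \<phi> = (\<lambda>(t, s, q). deriv (\<lambda>h. \<phi> (t, s + axis k h, q)) 0)"

definition partial_q :: "'k \<Rightarrow> ('k point \<Rightarrow> real) \<Rightarrow> 'k::finite point \<Rightarrow> real" where
  "partial_q k \<phi> = (\<lambda>(t, s, q). deriv (\<lambda>h. \<phi> (t, s, q + axis k h)) 0)"

text \<open>
  Left-hand side of the HJB equation. The maximum over the compact simplex of an expression
  linear in \<open>p\<close> is attained, so it is the supremum.
\<close>

definition hjb_lhs ::
  "real^'k \<Rightarrow> real^'k \<Rightarrow> real \<Rightarrow> ('k point \<Rightarrow> real) \<Rightarrow> 'k::finite point \<Rightarrow> real" where
  "hjb_lhs ah bh sh \<phi> = (\<lambda>(t, s, q).
     partial_t \<phi> (t, s, q) +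
     (SUP p\<in>prob_simplex. \<Sum>k\<in>UNIV.
        (partial_q k \<phi> (t, s, q)
         + hat_mu (s$k) (q$k) (ah$k) (bh$k) * partial_s k \<phi> (t, s, q)
         + 1/2 * sh\<^sup>2 * partial_s k (partial_s k \<phi>) (t, s, q)
         + hat_mu (s$k) (q$k) (ah$k) (bh$k)) * p$k))"

text \<open>Twice continuously differentiable, with gradient \<open>g\<close> and Hessian \<open>H\<close>; for open \<open>S\<close>.\<close>

definition C2_on :: "'a::euclidean_space set \<Rightarrow> ('a \<Rightarrow> real) \<Rightarrow> bool" where
  "C2_on S \<phi> \<longleftrightarrow> (\<exists>(g :: 'a \<Rightarrow> 'a) (H :: 'a \<Rightarrow> 'a \<Rightarrow>\<^sub>L 'a).
     (\<forall>x\<in>S. (\<phi> has_derivative (\<lambda>h. g x \<bullet> h)) (at x)) \<and>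
     (\<forall>x\<in>S. (g has_derivative blinfun_apply (H x)) (at x)) \<and>
     continuous_on S H)"

definition hjb_domain :: "'k::finite point set" where
  "hjb_domain = {0<..<1} \<times> UNIV \<times> {q. \<forall>k. q$k \<in> {0<..<1}}"

text \<open>
  The signs below are those of a terminal value problem: \<^term>\<open>hjb_lhs\<close> is nondecreasing in the
  second derivatives, so its negative is the degenerate elliptic operator of the usual convention.
  It does not involve the value of the unknown, so test functions need not touch \<open>v\<close>.
\<close>

definition hjb_viscosity_subsolution ::
  "real^'k \<Rightarrow> real^'k \<Rightarrow> real \<Rightarrow> ('k::finite point \<Rightarrow> real) \<Rightarrow> bool" where
  "hjb_viscosity_subsolution ah bh sh v \<longleftrightarrow>
     (\<forall>\<phi>. \<forall>x\<in>hjb_domain. C2_on hjb_domain \<phi> \<longrightarrow>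
        (\<forall>\<^sub>F y in at x within hjb_domain. v y - \<phi> y \<le> v x - \<phi> x) \<longrightarrow>
        hjb_lhs ah bh sh \<phi> x \<ge> 0)"

definition hjb_viscosity_supersolution ::
  "real^'k \<Rightarrow> real^'k \<Rightarrow> real \<Rightarrow> ('k::finite point \<Rightarrow> real) \<Rightarrow> bool" where
  "hjb_viscosity_supersolution ah bh sh v \<longleftrightarrow>
     (\<forall>\<phi>. \<forall>x\<in>hjb_domain. C2_on hjb_domain \<phi> \<longrightarrow>
        (\<forall>\<^sub>F y in at x within hjb_domain. v y - \<phi> y \<ge> v x - \<phi> x) \<longrightarrow>
        hjb_lhs ah bh sh \<phi> x \<le> 0)"

definition hjb_viscosity_solution ::
  "real^'k \<Rightarrow> real^'k \<Rightarrow> real \<Rightarrow> ('k::finite point \<Rightarrow> real) \<Rightarrow> bool" where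
  "hjb_viscosity_solution ah bh sh v \<longleftrightarrow>
     continuous_on hjb_domain v \<and>
     hjb_viscosity_subsolution ah bh sh v \<and> hjb_viscosity_supersolution ah bh sh v"

section \<open>Convergence of the rescaled problem\<close>

definition Q_set :: "real^'k \<Rightarrow> (real^'k::finite) set" where
  "Q_set bh = {q. \<forall>k. q$k \<in> {0..1} \<and> bh$k + q$k > 0}"

text \<open>
  \<open>w n i s q\<close> is the optimal reward for horizon \<open>n\<close> from round \<open>i\<close> on. Only the values of \<open>v\<close>
  on \<open>[0,1] \<times> \<real>\<^sup>K \<times> Q\<close> matter.
\<close>

definition converges_to_hjb ::
  "(nat \<Rightarrow> real) \<Rightarrow> (nat \<Rightarrow> nat \<Rightarrow> real^'k \<Rightarrow> nat^'k \<Rightarrow> real) \<Rightarrow>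
   real^'k \<Rightarrow> real^'k::finite \<Rightarrow> real \<Rightarrow> bool" where
  "converges_to_hjb f w ah bh sh \<longleftrightarrow>
     (\<exists>v. hjb_viscosity_solution ah bh sh v \<and>
        (\<forall>s. \<forall>q\<in>Q_set bh. v (1, s, q) = 0) \<and>
        (\<forall>t\<in>{0..1}. \<forall>s. \<forall>q\<in>Q_set bh. \<forall>i S N.
           (\<forall>n\<ge>1. i n \<in> {1..n + 1} \<and> admissible (i n) (S n) (N n)) \<longrightarrow>
           (\<lambda>n. (real (i n) - 1) / real n) \<longlonglongrightarrow> t \<longrightarrow>
           (\<lambda>n. (1 / f n) *\<^sub>R S n) \<longlonglongrightarrow> s \<longrightarrow>
           (\<lambda>n. \<chi> k. real (N n $ k) / real n) \<longlonglongrightarrow> q \<longrightarrow>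
           (\<lambda>n. 1 / f n * w n (i n) (S n) (N n)) \<longlonglongrightarrow> v (t, s, q)))"

end

theory Submission
  imports Defs
begin

text \<open>
  The state of an arm is best described by its posterior mean \<open>m\<^sub>k\<close> and its precision \<open>b\<^sub>k\<close>, both
  rescaled: \<open>b\<^sub>k\<close> is \<open>\<beta>\<^sub>k + q\<^sub>k\<close> and \<open>m\<^sub>k\<close> is \<open>(\<alpha>\<^sub>k + s\<^sub>k) / (\<beta>\<^sub>k + q\<^sub>k)\<close> in the variables of the HJB
  equation. In these coordinates one round of the bandit is a pull of duration \<open>h = 1/n\<close>: it pays
  \<open>h m\<^sub>k\<close>, moves \<open>b\<^sub>k\<close> to \<open>b\<^sub>k + h\<close> and adds to \<open>m\<^sub>k\<close> a centred Gaussian of variance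
  \<open>\<sigma>\<^sup>2 (1/b\<^sub>k - 1/(b\<^sub>k + h))\<close>. So the posterior mean of an arm is a Brownian motion run at the clock
  \<open>-\<sigma>\<^sup>2/b\<^sub>k\<close>, exactly and for pulls of every duration, and the whole dependence on \<open>n\<close> sits in the
  duration and in \<open>\<sigma>\<close> (\<open>opt_reward_eq_sched_value\<close>).

  The limit can therefore be written down directly: \<open>value_fun \<sigma> \<tau>\<close> is the supremum, over all
  finite lists of durations with sum \<open>\<tau>\<close>, of the optimal reward when the arm may be changed only
  between two entries of the list. Convergence rests on three facts.
  Splitting an entry of the list can only help (\<open>sched_value_split_le\<close>), since Gaussian increments
  add up. Hence the equidistant list with step \<open>1/n\<close> is at most the supremum and, as \<open>n\<close> grows,
  beats every fixed list up to a rounding of its entries (\<open>sched_value_uniform_tendsto\<close>).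
  Driving two copies of the process with the same noise shows that all these rewards are
  equicontinuous in the state and in \<open>\<sigma>\<close>, uniformly over the lists (\<open>sched_value_coupling\<close>), which
  allows the state to vary with \<open>n\<close>. Finally, \<open>\<Sum>\<^sub>k (1 + m\<^sub>k\<^sup>2 + \<sigma>\<^sup>2/b\<^sub>k)\<close> is a martingale under every
  policy and controls what is earned per unit of time.

  The viscosity inequalities use the same structure. By Taylor expansion and the quadratic growth of
  the value function, a touching test function yields a global bound of the value function near its
  contact time by a polynomial in \<open>m\<close> with the right second-order coefficients, up to a quartic error
  (\<open>parabolic_jet\<close>). Gaussian expectations of such polynomials are explicit. The supersolution
  inequality follows by inserting this bound into the dynamic programming inequality for a single
  short pull. For the subsolution inequality a strict violation of the equation would make the
  polynomial decrease along every list of total duration \<open>\<delta>\<close> by an amount of order \<open>\<delta>\<close>, while the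
  quartic error started at \<open>0\<close> grows only to order \<open>\<delta>\<^sup>2\<close>.
\<close>

section \<open>Gaussian expectations\<close>

abbreviation std_normal :: "real measure" where
  "std_normal \<equiv> normal_law 0 1"

lemma prob_space_std_normal: "prob_space std_normal"
  by (rule prob_space_normal_density) simp

lemma integrable_std_normal_power: "integrable std_normal (\<lambda>x. x ^ n)"
  using integrable_std_normal_moment[of n] by (subst integrable_density) auto

lemma integrable_std_normal_abs: "integrable std_normal (\<lambda>x. \<bar>x\<bar>)"
  using integrable_std_normal_moment_abs[of 1] by (subst integrable_density) auto

lemma integrable_std_normal_const [simp]: "integrable std_normal (\<lambda>x. c::real)"
proof -
  interpret prob_space std_normal by (rule prob_space_std_normal)
  show ?thesis by simp
qed

lemma measure_std_normal_UNIV [simp]: "Sigma_Algebra.measure std_normal UNIV = 1"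
  using prob_space.prob_space[OF prob_space_std_normal] by simp

lemma integrable_std_normal_id [simp]: "integrable std_normal (\<lambda>x. x)"
  using integrable_std_normal_power[of 1] by simp

lemma integrable_std_normal_numeral [simp]: "integrable std_normal (\<lambda>x. x ^ numeral n)"
  by (rule integrable_std_normal_power)

lemma std_normal_moments [simp]:
  "(\<integral>x. x \<partial>std_normal) = 0"
  "(\<integral>x. x\<^sup>2 \<partial>std_normal) = 1"
  "(\<integral>x. x ^ 3 \<partial>std_normal) = 0"
  "(\<integral>x. x ^ 4 \<partial>std_normal) = 3"
  using integral_std_normal_moment_odd[of 0] integral_std_normal_moment_even[of 1]
    integral_std_normal_moment_odd[of 1] integral_std_normal_moment_even[of 2]
  by (simp_all add: integral_density eval_nat_numeral fact_reduce)

text \<open>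
  Every polynomial met below has degree at most four in the Gaussian increment: the growth and
  coupling functions are quadratic, the error term of the viscosity argument is quartic. The odd
  moments vanish and the fourth one is \<open>3\<close>.
\<close>

lemma integrable_std_normal_quartic:
  "integrable std_normal (\<lambda>x. c0 + c1 * x + c2 * x\<^sup>2 + c3 * x ^ 3 + c4 * x ^ 4)"
  by (intro Bochner_Integration.integrable_add integrable_mult_right) simp_all

lemma integral_std_normal_quartic:
  "(\<integral>x. c0 + c1 * x + c2 * x\<^sup>2 + c3 * x ^ 3 + c4 * x ^ 4 \<partial>std_normal) = c0 + c2 + 3 * c4"
  by simp

lemma normal_law_affine_distr:
  assumes "sd > 0"
  shows "normal_law \<mu> sd = distr std_normal borel (\<lambda>x. \<mu> + sd * x)"
proof -
  interpret prob_space std_normal by (rule prob_space_std_normal)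
  have "distributed std_normal lborel (\<lambda>x. x) (normal_density 0 1)"
    unfolding distributed_def by (auto intro!: measure_eqI simp: emeasure_distr)
  from normal_density_affine[OF this, of sd \<mu>] assms
  have "distributed std_normal lborel (\<lambda>x. \<mu> + sd * x) (normal_density \<mu> sd)"
    by simp
  then have "distr std_normal lborel (\<lambda>x. \<mu> + sd * x) = normal_law \<mu> sd"
    unfolding distributed_def by simp
  moreover have "distr std_normal lborel (\<lambda>x. \<mu> + sd * x) = distr std_normal borel (\<lambda>x. \<mu> + sd * x)"
    by (rule distr_cong) auto
  ultimately show ?thesis by simp
qed

lemma integral_normal_law:
  fixes \<phi> :: "real \<Rightarrow> real"
  assumes "sd > 0" "\<phi> \<in> borel_measurable borel"
  shows "(\<integral>x. \<phi> x \<partial>normal_law \<mu> sd) = (\<integral>x. \<phi> (\<mu> + sd * x) \<partial>std_normal)"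
  unfolding normal_law_affine_distr[OF assms(1)]
  by (rule integral_distr) (use assms in auto)

text \<open>
  The weights are positive so that both summands have a density; the degenerate case is added in
  the next lemma.
\<close>

lemma distr_sum_std_normal:
  assumes "b > 0" "c > 0"
  shows "distr (std_normal \<Otimes>\<^sub>M std_normal) borel (\<lambda>(x, y). b * x + c * y)
    = distr std_normal borel (\<lambda>x. sqrt (b\<^sup>2 + c\<^sup>2) * x)"
proof -
  interpret N: prob_space std_normal by (rule prob_space_std_normal)
  interpret P: pair_prob_space std_normal std_normal ..
  let ?P = "std_normal \<Otimes>\<^sub>M std_normal"
  have sets: "sets ?P = sets (borel \<Otimes>\<^sub>M borel)"
    by (intro sets_pair_measure_cong) simp_all
  have std: "distributed std_normal lborel (\<lambda>x. x) (normal_density 0 1)"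
    unfolding distributed_def by (auto intro!: measure_eqI simp: emeasure_distr)
  have lb: "distr M lborel g = distr M borel g" for M :: "(real \<times> real) measure" and g :: "_ \<Rightarrow> real"
    by (rule distr_cong) auto
  have d1: "distr ?P std_normal fst = std_normal"
    by (rule N.distr_pair_fst)
  have d2: "distr ?P std_normal snd = std_normal"
    by (subst P.distr_pair_swap) (auto simp: distr_distr comp_def split_beta N.distr_pair_fst)
  have b1: "distr ?P borel fst = std_normal"
    by (subst (3) d1[symmetric]) (rule distr_cong, auto)
  have b2: "distr ?P borel snd = std_normal"
    by (subst (3) d2[symmetric]) (rule distr_cong, auto)
  have dX: "distributed ?P lborel fst (normal_density 0 1)"
    unfolding distributed_def using b1 by (auto simp: lb sets measurable_cong_sets[OF sets])
  have dY: "distributed ?P lborel snd (normal_density 0 1)"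
    unfolding distributed_def using b2 by (auto simp: lb sets measurable_cong_sets[OF sets])
  have ind: "P.indep_var borel fst borel snd"
    unfolding P.indep_var_distribution_eq b1 b2
    by (auto simp: measurable_cong_sets[OF sets] intro!: distr_id2[symmetric] simp: sets)
  have ind': "P.indep_var borel (\<lambda>p. b * fst p) borel (\<lambda>p. c * snd p)"
    using P.indep_var_compose[OF ind, of "\<lambda>x. b * x" borel "\<lambda>x. c * x" borel]
    by (simp add: comp_def)
  have X: "distributed ?P lborel (\<lambda>p. b * fst p) (normal_density 0 b)"
    using P.normal_density_affine[OF dX, of b 0] assms by simp
  have Y: "distributed ?P lborel (\<lambda>p. c * snd p) (normal_density 0 c)"
    using P.normal_density_affine[OF dY, of c 0] assms by simp
  have "distributed ?P lborel (\<lambda>p. b * fst p + c * snd p) (normal_density 0 (sqrt (b\<^sup>2 + c\<^sup>2)))"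
    using P.add_indep_normal[OF ind' assms X Y] by simp
  then have "distr ?P borel (\<lambda>p. b * fst p + c * snd p) = normal_law 0 (sqrt (b\<^sup>2 + c\<^sup>2))"
    unfolding distributed_def by (simp add: lb)
  also have "\<dots> = distr std_normal borel (\<lambda>x. sqrt (b\<^sup>2 + c\<^sup>2) * x)"
    using assms by (subst normal_law_affine_distr) (auto intro: add_pos_pos)
  finally show ?thesis by (simp add: case_prod_unfold)
qed

text \<open>
  This one identity is used twice: it merges two consecutive pulls of the same arm into one, and it
  turns posterior and reward noise into the predictive law of the reward.
\<close>

lemma integral_std_normal_sum:
  fixes \<phi> :: "real \<Rightarrow> real"
  assumes "b \<ge> 0" "c \<ge> 0" and [measurable]: "\<phi> \<in> borel_measurable borel"
    and int: "integrable std_normal (\<lambda>z. \<phi> (sqrt (b\<^sup>2 + c\<^sup>2) * z))"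
  shows "(\<integral>x. (\<integral>y. \<phi> (b * x + c * y) \<partial>std_normal) \<partial>std_normal)
    = (\<integral>z. \<phi> (sqrt (b\<^sup>2 + c\<^sup>2) * z) \<partial>std_normal)"
proof (cases "b = 0 \<or> c = 0")
  case True
  then show ?thesis using assms by auto
next
  case False
  then have bc: "b > 0" "c > 0" using assms by auto
  interpret N: prob_space std_normal by (rule prob_space_std_normal)
  interpret P: pair_prob_space std_normal std_normal ..
  let ?P = "std_normal \<Otimes>\<^sub>M std_normal"
  have sets: "sets ?P = sets (borel \<Otimes>\<^sub>M borel)"
    by (intro sets_pair_measure_cong) simp_all
  have m: "(\<lambda>(x, y). b * x + c * y) \<in> borel_measurable ?P"
    by (simp add: measurable_cong_sets[OF sets refl])
  have "integrable (distr std_normal borel (\<lambda>x. sqrt (b\<^sup>2 + c\<^sup>2) * x)) \<phi>"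
    by (subst integrable_distr_eq) (use int in auto)
  then have i: "integrable ?P (\<lambda>(x, y). \<phi> (b * x + c * y))"
    unfolding distr_sum_std_normal[OF bc, symmetric]
    by (subst (asm) integrable_distr_eq[OF m]) (auto simp: case_prod_unfold)
  have "(\<integral>x. (\<integral>y. \<phi> (b * x + c * y) \<partial>std_normal) \<partial>std_normal)
    = (\<integral>p. (case p of (x, y) \<Rightarrow> \<phi> (b * x + c * y)) \<partial>?P)"
    using P.integral_fst'[OF i] by simp
  also have "\<dots> = (\<integral>z. \<phi> z \<partial>distr ?P borel (\<lambda>(x, y). b * x + c * y))"
    by (subst integral_distr[OF m]) (auto simp: case_prod_unfold)
  also have "\<dots> = (\<integral>z. \<phi> (sqrt (b\<^sup>2 + c\<^sup>2) * z) \<partial>std_normal)"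
    unfolding distr_sum_std_normal[OF bc] by (rule integral_distr) auto
  finally show ?thesis .
qed

section \<open>Schedules of pulls\<close>

lemma axis_eq_scaleR: "axis k (x::real) = x *\<^sub>R axis k 1"
  by (simp add: vec_eq_iff axis_def)

lemma norm_axis_real: "norm (axis k (x::real)) = \<bar>x\<bar>"
  unfolding axis_eq_scaleR[of k x] by simp

lemma sum_change_one:
  fixes f g :: "'k::finite \<Rightarrow> 'a::ab_group_add"
  assumes "\<And>j. j \<noteq> k \<Longrightarrow> f j = g j"
  shows "sum f UNIV = sum g UNIV + (f k - g k)"
proof -
  have "sum f UNIV = f k + sum f (UNIV - {k})" "sum g UNIV = g k + sum g (UNIV - {k})"
    by (auto intro: sum.remove)
  moreover have "sum f (UNIV - {k}) = sum g (UNIV - {k})"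
    by (rule sum.cong) (use assms in auto)
  ultimately show ?thesis by simp
qed

text \<open>
  Replaces \<open>\<bar>x\<bar>\<close> by a quadratic function, whose Gaussian expectation can be computed. The
  parameter \<open>\<eta>\<close> is free, so nothing is lost in a limit.
\<close>

lemma abs_le_eta_square:
  fixes x \<eta> :: real
  assumes "\<eta> > 0"
  shows "\<bar>x\<bar> \<le> \<eta> + x\<^sup>2 / \<eta>"
proof -
  have "0 \<le> (\<bar>x\<bar> - \<eta>)\<^sup>2 + \<bar>x\<bar> * \<eta>"
    using assms by (intro add_nonneg_nonneg) auto
  also have "\<dots> = \<eta>\<^sup>2 + x\<^sup>2 - \<bar>x\<bar> * \<eta>"
    by (simp add: power2_diff)
  finally show ?thesis
    using assms by (simp add: field_simps power2_eq_square)
qed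

text \<open>
  The posterior mean moves by a Gaussian whose variance is the posterior variance that the pull
  removes: \<open>\<sigma>\<^sup>2/b\<close> before, \<open>\<sigma>\<^sup>2/(b + h)\<close> after.
\<close>

definition step_sd :: "real \<Rightarrow> real \<Rightarrow> real \<Rightarrow> real" where
  "step_sd \<sigma> b h = \<sigma> * sqrt (1 / b - 1 / (b + h))"

text \<open>
  The vectors \<open>m\<close> and \<open>b\<close> are posterior means and precisions. A pull of duration \<open>h\<close> stands for a
  block of consecutive rounds with the same arm, hence the reward \<open>h m\<^sub>k\<close>.
\<close>

definition pull ::
  "real \<Rightarrow> real \<Rightarrow> 'k::finite \<Rightarrow> (real^'k \<Rightarrow> real^'k \<Rightarrow> real) \<Rightarrow> real^'k \<Rightarrow> real^'k \<Rightarrow> real" where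
  "pull \<sigma> h k F m b = h * m$k
     + (\<integral>x. F (m + axis k (step_sd \<sigma> (b$k) h * x)) (b + axis k h) \<partial>std_normal)"

text \<open>
  Optimal reward when the times at which the arm may be changed are prescribed: the list contains
  the durations of the pulls. Allowing unequal durations makes refinement, concatenation and cutting
  of a time interval operations on lists.
\<close>

primrec sched_value :: "real \<Rightarrow> real list \<Rightarrow> real^'k::finite \<Rightarrow> real^'k \<Rightarrow> real" where
  "sched_value \<sigma> [] m b = 0"
| "sched_value \<sigma> (h # hs) m b = (MAX k. pull \<sigma> h k (sched_value \<sigma> hs) m b)"

abbreviation nonneg_list :: "real list \<Rightarrow> bool" where
  "nonneg_list hs \<equiv> \<forall>h\<in>set hs. 0 \<le> h"

abbreviation pos_vec :: "real^'k \<Rightarrow> bool" where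
  "pos_vec b \<equiv> \<forall>k. 0 < b$k"

lemma sum_list_nonneg_list: "nonneg_list hs \<Longrightarrow> 0 \<le> sum_list hs"
  by (simp add: sum_list_nonneg)

lemma pos_vec_add_axis: "pos_vec b \<Longrightarrow> 0 \<le> h \<Longrightarrow> pos_vec (b + axis k h)"
  by (auto simp: axis_def add_pos_nonneg)

lemma step_var_nonneg: "0 < b \<Longrightarrow> 0 \<le> h \<Longrightarrow> 0 \<le> 1 / b - 1 / (b + h :: real)"
  by (simp add: frac_le)

lemma step_sd_square:
  "0 < b \<Longrightarrow> 0 \<le> h \<Longrightarrow> (step_sd \<sigma> b h)\<^sup>2 = \<sigma>\<^sup>2 * (1 / b - 1 / (b + h))"
  using step_var_nonneg[of b h] by (simp add: step_sd_def power_mult_distrib)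

lemma pull_le_sched_value: "pull \<sigma> h k (sched_value \<sigma> hs) m b \<le> sched_value \<sigma> (h # hs) m b"
  by simp

lemma sched_value_Cons_le:
  assumes "\<And>k. pull \<sigma> h k (sched_value \<sigma> hs) m b \<le> X"
  shows "sched_value \<sigma> (h # hs) m b \<le> X"
  using assms by simp

declare sched_value.simps(2) [simp del]

text \<open>
  Lipschitz continuity in \<open>m\<close> is the regularity carried through the dynamic programming recursion:
  it gives integrability against the Gaussian increment and is preserved by a pull.
\<close>

lemma integrable_lipschitz:
  fixes F :: "real^'k::finite \<Rightarrow> real"
  assumes "L-lipschitz_on UNIV F"
  shows "integrable std_normal (\<lambda>x. F (m + axis k (a * x)))"
proof (rule Bochner_Integration.integrable_bound)
  show "integrable std_normal (\<lambda>x. \<bar>F m\<bar> + L * \<bar>a\<bar> * \<bar>x\<bar>)"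
    by (intro Bochner_Integration.integrable_add integrable_mult_right
        integrable_std_normal_const integrable_std_normal_abs)
  have "continuous_on UNIV F"
    using assms by (rule lipschitz_on_continuous_on)
  then have "continuous_on UNIV (\<lambda>x. F (m + axis k (a * x)))"
    unfolding axis_eq_scaleR[of k "a * _"]
    by (rule continuous_on_compose2) (auto intro!: continuous_intros)
  then show "(\<lambda>x. F (m + axis k (a * x))) \<in> borel_measurable std_normal"
    using borel_measurable_continuous_onI by simp
  have "norm (F (m + axis k (a * x))) \<le> norm (\<bar>F m\<bar> + L * \<bar>a\<bar> * \<bar>x\<bar>)" for x
    using lipschitz_onD[OF assms, of "m + axis k (a * x)" m] lipschitz_on_nonneg[OF assms]
    by (simp add: dist_norm norm_axis_real abs_mult mult.assoc)
  then show "AE x in std_normal. norm (F (m + axis k (a * x))) \<le> norm (\<bar>F m\<bar> + L * \<bar>a\<bar> * \<bar>x\<bar>)"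
    by simp
qed

text \<open>
  Moving \<open>m\<close> moves the whole future path of the posterior means by the same vector, so the constant
  grows by the duration of the pull only.
\<close>

lemma pull_lipschitz:
  assumes "\<And>b. L-lipschitz_on UNIV (\<lambda>m. F m b)" and "h \<ge> 0"
  shows "(h + L)-lipschitz_on UNIV (\<lambda>m. pull \<sigma> h k F m b)"
proof (rule lipschitz_onI)
  fix m m' :: "real^'a"
  let ?g = "\<lambda>m x. F (m + axis k (step_sd \<sigma> (b$k) h * x)) (b + axis k h)"
  have i: "integrable std_normal (?g m)" for m
    by (rule integrable_lipschitz[OF assms(1)])
  have "\<bar>?g m x - ?g m' x\<bar> \<le> L * dist m m'" for x
    using lipschitz_onD[OF assms(1), of "m + axis k (step_sd \<sigma> (b$k) h * x)"
        "m' + axis k (step_sd \<sigma> (b$k) h * x)" "b + axis k h"]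
    by (simp add: dist_norm)
  then have "\<bar>\<integral>x. ?g m x - ?g m' x \<partial>std_normal\<bar> \<le> (\<integral>x. L * dist m m' \<partial>std_normal)"
    by (intro order_trans[OF integral_abs_bound] integral_mono integrable_abs)
      (auto intro!: i Bochner_Integration.integrable_diff)
  then have "\<bar>(\<integral>x. ?g m x \<partial>std_normal) - (\<integral>x. ?g m' x \<partial>std_normal)\<bar> \<le> L * dist m m'"
    by (simp add: i)
  moreover have "\<bar>h * m$k - h * m'$k\<bar> \<le> h * dist m m'"
    using assms(2) component_le_norm_cart[of "m - m'" k]
    by (simp add: right_diff_distrib[symmetric] abs_mult dist_norm mult_left_mono)
  ultimately show "dist (pull \<sigma> h k F m b) (pull \<sigma> h k F m' b) \<le> (h + L) * dist m m'"
    by (simp add: pull_def dist_real_def distrib_right)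
qed (use assms lipschitz_on_nonneg[OF assms(1)] in auto)

lemma sched_value_lipschitz:
  "nonneg_list hs \<Longrightarrow> (sum_list hs)-lipschitz_on UNIV (\<lambda>m. sched_value \<sigma> hs m b)"
proof (induction hs arbitrary: b)
  case Nil
  then show ?case by (simp add: lipschitz_on_def)
next
  case (Cons h hs)
  have P: "(h + sum_list hs)-lipschitz_on UNIV (\<lambda>m. pull \<sigma> h k (sched_value \<sigma> hs) m b)" for k
    by (rule pull_lipschitz) (use Cons in auto)
  have *: "sched_value \<sigma> (h # hs) m b \<le> sched_value \<sigma> (h # hs) m' b + (h + sum_list hs) * dist m m'"
    for m m'
  proof (rule sched_value_Cons_le)
    fix k
    show "pull \<sigma> h k (sched_value \<sigma> hs) m b
        \<le> sched_value \<sigma> (h # hs) m' b + (h + sum_list hs) * dist m m'"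
      using lipschitz_onD[OF P, of m m' k] pull_le_sched_value[of \<sigma> h k hs m' b]
      by (simp add: dist_real_def)
  qed
  show ?case
  proof (rule lipschitz_onI)
    fix m m' :: "real^'a"
    show "dist (sched_value \<sigma> (h # hs) m b) (sched_value \<sigma> (h # hs) m' b)
        \<le> sum_list (h # hs) * dist m m'"
      using *[of m m'] *[of m' m] by (simp add: dist_real_def dist_commute abs_le_iff)
  qed (use Cons.prems sum_list_nonneg_list in simp)
qed

lemmas integrable_sched_value = integrable_lipschitz[OF sched_value_lipschitz]

section \<open>Growth of the rewards\<close>

text \<open>
  A pull increases the expectation of \<open>m\<^sub>k\<^sup>2\<close> by exactly what \<open>\<sigma>\<^sup>2/b\<^sub>k\<close> loses, so this function is a
  martingale whatever arm is pulled. It dominates every \<open>\<bar>m\<^sub>k\<bar>\<close>, hence the reward per unit of time.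
\<close>

definition growth :: "real \<Rightarrow> real^'k::finite \<Rightarrow> real^'k \<Rightarrow> real" where
  "growth \<sigma> m b = (\<Sum>k\<in>UNIV. 1 + (m$k)\<^sup>2 + \<sigma>\<^sup>2 / b$k)"

lemma growth_nonneg: "pos_vec b \<Longrightarrow> 0 \<le> growth \<sigma> m b"
  unfolding growth_def by (intro sum_nonneg) (simp add: less_imp_le)

lemma component_le_growth:
  assumes "pos_vec b"
  shows "\<bar>m$k\<bar> \<le> growth \<sigma> m b"
proof -
  have "\<bar>m$k\<bar> \<le> 1 + (m$k)\<^sup>2"
    using abs_le_eta_square[of 1 "m$k"] by simp
  also have "\<dots> \<le> 1 + (m$k)\<^sup>2 + \<sigma>\<^sup>2 / b$k"
    using assms by (simp add: less_imp_le)
  also have "\<dots> \<le> growth \<sigma> m b"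
    unfolding growth_def using assms by (intro member_le_sum) (auto simp: less_imp_le)
  finally show ?thesis .
qed

lemma growth_update:
  "growth \<sigma> (m + axis k y) (b + axis k h)
    = growth \<sigma> m b + 2 * m$k * y + y\<^sup>2 - \<sigma>\<^sup>2 * (1 / b$k - 1 / (b$k + h))"
  unfolding growth_def
  by (subst sum_change_one[where k = k and g = "\<lambda>k. 1 + (m$k)\<^sup>2 + \<sigma>\<^sup>2 / b$k"])
    (auto simp: axis_def power2_sum algebra_simps)

lemma growth_martingale:
  assumes "pos_vec b" "0 \<le> h"
  shows "integrable std_normal
      (\<lambda>x. growth \<sigma> (m + axis k (step_sd \<sigma> (b$k) h * x)) (b + axis k h))"
    and "(\<integral>x. growth \<sigma> (m + axis k (step_sd \<sigma> (b$k) h * x)) (b + axis k h) \<partial>std_normal)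
      = growth \<sigma> m b"
proof -
  let ?s = "step_sd \<sigma> (b$k) h"
  have eq: "(\<lambda>x. growth \<sigma> (m + axis k (?s * x)) (b + axis k h))
    = (\<lambda>x. (growth \<sigma> m b - ?s\<^sup>2) + (2 * m$k * ?s) * x + ?s\<^sup>2 * x\<^sup>2 + 0 * x ^ 3 + 0 * x ^ 4)"
    using assms by (auto simp: growth_update step_sd_square power_mult_distrib)
  show "integrable std_normal (\<lambda>x. growth \<sigma> (m + axis k (?s * x)) (b + axis k h))"
    unfolding eq by (rule integrable_std_normal_quartic)
  show "(\<integral>x. growth \<sigma> (m + axis k (?s * x)) (b + axis k h) \<partial>std_normal) = growth \<sigma> m b"
    unfolding eq by (subst integral_std_normal_quartic) simp
qed

lemma sched_value_Cons_diff_le: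
  assumes "\<And>k. \<bar>pull \<sigma> h k (sched_value \<sigma> hs) m b - pull \<sigma>' h' k (sched_value \<sigma>' hs') m' b'\<bar> \<le> X"
  shows "\<bar>sched_value \<sigma> (h # hs) m b - sched_value \<sigma>' (h' # hs') m' b'\<bar> \<le> X"
proof -
  have "sched_value \<sigma> (h # hs) m b \<le> sched_value \<sigma>' (h' # hs') m' b' + X"
  proof (rule sched_value_Cons_le)
    fix k
    show "pull \<sigma> h k (sched_value \<sigma> hs) m b \<le> sched_value \<sigma>' (h' # hs') m' b' + X"
      using assms[of k] pull_le_sched_value[of \<sigma>' h' k hs' m' b'] by (auto simp: abs_le_iff)
  qed
  moreover have "sched_value \<sigma>' (h' # hs') m' b' \<le> sched_value \<sigma> (h # hs) m b + X"
  proof (rule sched_value_Cons_le)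
    fix k
    show "pull \<sigma>' h' k (sched_value \<sigma>' hs') m' b' \<le> sched_value \<sigma> (h # hs) m b + X"
      using assms[of k] pull_le_sched_value[of \<sigma> h k hs m b] by (auto simp: abs_le_iff)
  qed
  ultimately show ?thesis by (simp add: abs_le_iff)
qed

lemma abs_integral_diff_le:
  fixes f g d :: "'a \<Rightarrow> real"
  assumes "integrable M f" "integrable M g" "integrable M d" "\<And>x. \<bar>f x - g x\<bar> \<le> d x"
  shows "\<bar>integral\<^sup>L M f - integral\<^sup>L M g\<bar> \<le> integral\<^sup>L M d"
proof -
  have "\<bar>\<integral>x. f x - g x \<partial>M\<bar> \<le> integral\<^sup>L M d"
    by (intro order_trans[OF integral_abs_bound] integral_mono integrable_abs
        Bochner_Integration.integrable_diff assms)
  then show ?thesis using assms by simp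
qed

lemma sched_value_growth:
  "nonneg_list hs \<Longrightarrow> pos_vec b \<Longrightarrow> \<bar>sched_value \<sigma> hs m b\<bar> \<le> sum_list hs * growth \<sigma> m b"
proof (induction hs arbitrary: m b)
  case Nil
  then show ?case by simp
next
  case (Cons h hs)
  have h: "h \<ge> 0" and hs: "nonneg_list hs" using Cons.prems by auto
  have "\<bar>pull \<sigma> h k (sched_value \<sigma> hs) m b\<bar> \<le> sum_list (h # hs) * growth \<sigma> m b" for k
  proof -
    let ?m = "\<lambda>x. m + axis k (step_sd \<sigma> (b$k) h * x)" and ?b = "b + axis k h"
    have "\<bar>(\<integral>x. sched_value \<sigma> hs (?m x) ?b \<partial>std_normal) - (\<integral>x. 0 \<partial>std_normal)\<bar>
        \<le> (\<integral>x. sum_list hs * growth \<sigma> (?m x) ?b \<partial>std_normal)"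
      using Cons.IH[OF hs pos_vec_add_axis[OF Cons.prems(2) h]]
      by (intro abs_integral_diff_le integrable_sched_value hs integrable_mult_right growth_martingale
          Cons.prems h) auto
    also have "\<dots> = sum_list hs * growth \<sigma> m b"
      using growth_martingale[OF Cons.prems(2) h] by simp
    finally have "\<bar>(\<integral>x. sched_value \<sigma> hs (?m x) ?b \<partial>std_normal)\<bar> \<le> sum_list hs * growth \<sigma> m b"
      by simp
    moreover have "\<bar>h * m$k\<bar> \<le> h * growth \<sigma> m b"
      using component_le_growth[OF Cons.prems(2)] h by (simp add: abs_mult mult_left_mono)
    ultimately show ?thesis
      unfolding pull_def by (simp add: distrib_right)
  qed
  then have "pull \<sigma> h k (sched_value \<sigma> hs) m b \<le> sum_list (h # hs) * growth \<sigma> m b"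
    and "- (sum_list (h # hs) * growth \<sigma> m b) \<le> pull \<sigma> h k (sched_value \<sigma> hs) m b" for k
    by (auto simp: abs_le_iff minus_le_iff)
  then show ?case
    using pull_le_sched_value[of \<sigma> h undefined hs m b] sched_value_Cons_le[of \<sigma> h hs m b]
    by (smt (verit))
qed

text \<open>
  What is earned after the schedule \<open>hs1\<close> is at most its duration times \<open>growth\<close> at that time, and
  \<open>growth\<close> is a martingale. This makes rewards Lipschitz continuous in the length of the horizon.
\<close>

lemma sched_value_append_diff:
  "nonneg_list hs1 \<Longrightarrow> nonneg_list hs2 \<Longrightarrow> pos_vec b \<Longrightarrow>
    \<bar>sched_value \<sigma> (hs1 @ hs2) m b - sched_value \<sigma> hs1 m b\<bar> \<le> sum_list hs2 * growth \<sigma> m b"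
proof (induction hs1 arbitrary: m b)
  case Nil
  then show ?case using sched_value_growth by simp
next
  case (Cons h hs)
  have h: "h \<ge> 0" and hs: "nonneg_list hs" "nonneg_list (hs @ hs2)" using Cons.prems by auto
  have "\<bar>pull \<sigma> h k (sched_value \<sigma> (hs @ hs2)) m b - pull \<sigma> h k (sched_value \<sigma> hs) m b\<bar>
      \<le> sum_list hs2 * growth \<sigma> m b" for k
  proof -
    let ?m = "\<lambda>x. m + axis k (step_sd \<sigma> (b$k) h * x)" and ?b = "b + axis k h"
    have "\<bar>(\<integral>x. sched_value \<sigma> (hs @ hs2) (?m x) ?b \<partial>std_normal)
          - (\<integral>x. sched_value \<sigma> hs (?m x) ?b \<partial>std_normal)\<bar>
        \<le> (\<integral>x. sum_list hs2 * growth \<sigma> (?m x) ?b \<partial>std_normal)"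
      using Cons.IH[OF hs(1) Cons.prems(2) pos_vec_add_axis[OF Cons.prems(3) h]]
      by (intro abs_integral_diff_le integrable_sched_value hs integrable_mult_right growth_martingale
          Cons.prems h) auto
    also have "\<dots> = sum_list hs2 * growth \<sigma> m b"
      using growth_martingale[OF Cons.prems(3) h] by simp
    finally show ?thesis unfolding pull_def by simp
  qed
  then show ?case
    unfolding append_Cons by (rule sched_value_Cons_diff_le)
qed

section \<open>Refinement of schedules\<close>

text \<open>
  Not changing the arm at the intermediate time is allowed, and by the addition of Gaussian
  increments (the variances telescope) it reproduces the long pull exactly.
\<close>

lemma pull_split_le:
  assumes "0 \<le> \<sigma>" "0 \<le> h1" "0 \<le> h2" "nonneg_list hs" "pos_vec b"
  shows "pull \<sigma> (h1 + h2) k (sched_value \<sigma> hs) m b \<le> pull \<sigma> h1 k (sched_value \<sigma> (h2 # hs)) m b"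
proof -
  define s1 s2 where "s1 = step_sd \<sigma> (b$k) h1" and "s2 = step_sd \<sigma> (b$k + h1) h2"
  have b: "0 < b$k" using assms by auto
  have s: "0 \<le> s1" "0 \<le> s2"
    using step_var_nonneg[OF b, of h1] step_var_nonneg[of "b$k + h1" h2] assms b
    by (auto simp: s1_def s2_def step_sd_def)
  have "s1\<^sup>2 + s2\<^sup>2 = \<sigma>\<^sup>2 * (1 / b$k - 1 / (b$k + (h1 + h2)))"
    unfolding s1_def s2_def using assms b
    by (subst (1 2) step_sd_square) (auto simp: algebra_simps add_nonneg_pos)
  then have root: "sqrt (s1\<^sup>2 + s2\<^sup>2) = step_sd \<sigma> (b$k) (h1 + h2)"
    using assms by (simp add: step_sd_def real_sqrt_mult)
  let ?b = "b + axis k h1 + axis k h2"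
  have b_eq: "?b = b + axis k (h1 + h2)" by (simp add: vec_eq_iff axis_def)
  define \<phi> where "\<phi> = (\<lambda>z. sched_value \<sigma> hs (m + axis k z) ?b)"
  have lip: "(sum_list hs)-lipschitz_on UNIV (\<lambda>m. sched_value \<sigma> hs m ?b)"
    using assms by (intro sched_value_lipschitz)
  have \<phi>_int: "integrable std_normal (\<lambda>z. \<phi> (a * z))" for a
    unfolding \<phi>_def by (rule integrable_lipschitz[OF lip])
  have \<phi>_meas: "\<phi> \<in> borel_measurable borel"
    using borel_measurable_integrable[OF \<phi>_int[of 1]] by simp
  have lip2: "(h2 + sum_list hs)-lipschitz_on UNIV (\<lambda>m. pull \<sigma> h2 k (sched_value \<sigma> hs) m (b + axis k h1))"
    using assms by (intro pull_lipschitz sched_value_lipschitz) auto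
  have step2: "pull \<sigma> h2 k (sched_value \<sigma> hs) (m + axis k (s1 * x)) (b + axis k h1)
    = h2 * (m$k + s1 * x) + (\<integral>y. \<phi> (s1 * x + s2 * y) \<partial>std_normal)" for x
  proof -
    have "m + axis k (s1 * x) + axis k (s2 * y) = m + axis k (s1 * x + s2 * y)" for y
      by (simp add: vec_eq_iff axis_def)
    moreover have "step_sd \<sigma> ((b + axis k h1) $ k) h2 = s2" "(m + axis k (s1 * x)) $ k = m$k + s1 * x"
      by (simp_all add: s2_def axis_def)
    ultimately show ?thesis unfolding pull_def \<phi>_def by (simp only:)
  qed
  have i2: "integrable std_normal (\<lambda>x. pull \<sigma> h2 k (sched_value \<sigma> hs) (m + axis k (s1 * x)) (b + axis k h1))"
    by (rule integrable_lipschitz[OF lip2])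
  have i3: "integrable std_normal (\<lambda>x. h2 * (m$k + s1 * x))"
    by (intro integrable_mult_right Bochner_Integration.integrable_add) auto
  have i4: "integrable std_normal (\<lambda>x. \<integral>y. \<phi> (s1 * x + s2 * y) \<partial>std_normal)"
    using Bochner_Integration.integrable_diff[OF i2 i3] by (simp add: step2)
  have "pull \<sigma> (h1 + h2) k (sched_value \<sigma> hs) m b
      = (h1 + h2) * m$k + (\<integral>z. \<phi> (sqrt (s1\<^sup>2 + s2\<^sup>2) * z) \<partial>std_normal)"
    unfolding pull_def \<phi>_def root b_eq by simp
  also have "(\<integral>z. \<phi> (sqrt (s1\<^sup>2 + s2\<^sup>2) * z) \<partial>std_normal)
      = (\<integral>x. (\<integral>y. \<phi> (s1 * x + s2 * y) \<partial>std_normal) \<partial>std_normal)"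
    by (rule integral_std_normal_sum[symmetric]) (use s \<phi>_int \<phi>_meas in auto)
  also have "(h1 + h2) * m$k + \<dots> = h1 * m$k
      + (\<integral>x. pull \<sigma> h2 k (sched_value \<sigma> hs) (m + axis k (s1 * x)) (b + axis k h1) \<partial>std_normal)"
    unfolding step2 using i3 i4 by (simp add: algebra_simps)
  also have "\<dots> \<le> h1 * m$k
      + (\<integral>x. sched_value \<sigma> (h2 # hs) (m + axis k (s1 * x)) (b + axis k h1) \<partial>std_normal)"
    using assms by (intro add_left_mono integral_mono i2 integrable_sched_value pull_le_sched_value) auto
  also have "\<dots> = pull \<sigma> h1 k (sched_value \<sigma> (h2 # hs)) m b"
    unfolding pull_def s1_def ..
  finally show ?thesis .
qed

lemma sched_value_split_le:
  assumes "0 \<le> \<sigma>" "0 \<le> h1" "0 \<le> h2" "nonneg_list hs" "pos_vec b"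
  shows "sched_value \<sigma> ((h1 + h2) # hs) m b \<le> sched_value \<sigma> (h1 # h2 # hs) m b"
  using pull_split_le[OF assms] pull_le_sched_value order_trans by (intro sched_value_Cons_le) blast

lemma pull_mono:
  assumes "0 \<le> h" "nonneg_list hs1" "nonneg_list hs2" "pos_vec b"
    and "\<And>m b :: real^'k::finite. pos_vec b \<Longrightarrow> sched_value \<sigma> hs1 m b \<le> sched_value \<sigma> hs2 m b"
  shows "pull \<sigma> h k (sched_value \<sigma> hs1) m b \<le> pull \<sigma> h k (sched_value \<sigma> hs2) (m :: real^'k) b"
  unfolding pull_def using assms(1-4)
  by (intro add_left_mono integral_mono integrable_sched_value
      assms(5)[OF pos_vec_add_axis[OF assms(4,1)]])

lemma sched_value_Cons_mono:
  assumes "0 \<le> h" "nonneg_list hs1" "nonneg_list hs2" "pos_vec b"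
    and "\<And>m b :: real^'k::finite. pos_vec b \<Longrightarrow> sched_value \<sigma> hs1 m b \<le> sched_value \<sigma> hs2 m b"
  shows "sched_value \<sigma> (h # hs1) m b \<le> sched_value \<sigma> (h # hs2) (m :: real^'k) b"
  using pull_mono[OF assms] pull_le_sched_value order_trans by (intro sched_value_Cons_le) blast

lemma sched_value_zero_step [simp]: "sched_value \<sigma> (0 # hs) m b = sched_value \<sigma> hs m b"
  by (simp add: sched_value.simps(2) pull_def step_sd_def axis_eq_scaleR[of _ 0])

lemma sched_value_refine:
  assumes "0 \<le> \<sigma>" "0 \<le> h" "nonneg_list hs" "pos_vec b"
  shows "sched_value \<sigma> ((real p * h) # hs) m b \<le> sched_value \<sigma> (replicate p h @ hs) m b"
  using assms(4)
proof (induction p arbitrary: m b)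
  case 0
  then show ?case by (simp)
next
  case (Suc p)
  have "sched_value \<sigma> ((real (Suc p) * h) # hs) m b = sched_value \<sigma> ((h + real p * h) # hs) m b"
    by (simp add: algebra_simps)
  also have "\<dots> \<le> sched_value \<sigma> (h # (real p * h) # hs) m b"
    using assms Suc.prems by (intro sched_value_split_le) auto
  also have "\<dots> \<le> sched_value \<sigma> (h # (replicate p h @ hs)) m b"
    using assms Suc by (intro sched_value_Cons_mono) auto
  finally show ?case by simp
qed

lemma sched_value_refine_list:
  assumes "0 \<le> \<sigma>" "0 \<le> h" "pos_vec b"
  shows "sched_value \<sigma> (map (\<lambda>p. real p * h) ps) m b \<le> sched_value \<sigma> (replicate (sum_list ps) h) m b"
  using assms(3)
proof (induction ps arbitrary: m b)
  case Nil
  then show ?case by simp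
next
  case (Cons p ps)
  have "sched_value \<sigma> (map (\<lambda>p. real p * h) (p # ps)) m b
      \<le> sched_value \<sigma> ((real p * h) # replicate (sum_list ps) h) m b"
    using assms Cons by (simp only: list.map, intro sched_value_Cons_mono) auto
  also have "\<dots> \<le> sched_value \<sigma> (replicate p h @ replicate (sum_list ps) h) m b"
    using assms Cons.prems by (intro sched_value_refine) auto
  finally show ?case by (simp add: replicate_add)
qed

text \<open>
  Any prescribed time can be turned into a switching time by splitting the pull that runs across it.
\<close>

lemma sched_value_cut:
  assumes "0 \<le> \<sigma>" "nonneg_list hs" "0 \<le> \<delta>" "\<delta> \<le> sum_list hs"
  shows "\<exists>hs1 hs2. nonneg_list hs1 \<and> nonneg_list hs2 \<and> sum_list hs1 = \<delta>
    \<and> sum_list hs2 = sum_list hs - \<delta>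
    \<and> (\<forall>m b. pos_vec b \<longrightarrow> sched_value \<sigma> hs m b \<le> sched_value \<sigma> (hs1 @ hs2) (m :: real^'k::finite) b)"
  using assms(2-)
proof (induction hs arbitrary: \<delta>)
  case Nil
  then show ?case by (intro exI[of _ "[]"]) auto
next
  case (Cons h hs)
  have h: "0 \<le> h" and hs: "nonneg_list hs" using Cons.prems by auto
  show ?case
  proof (cases "\<delta> \<le> h")
    case True
    have "sched_value \<sigma> (h # hs) m b \<le> sched_value \<sigma> (\<delta> # (h - \<delta>) # hs) m b"
      if "pos_vec b" for m b :: "real^'k"
      using sched_value_split_le[of \<sigma> \<delta> "h - \<delta>" hs b m] assms(1) Cons.prems True hs that by simp
    then show ?thesis
      using Cons.prems True h hs
      by (intro exI[of _ "[\<delta>]"] exI[of _ "(h - \<delta>) # hs"]) auto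
  next
    case False
    obtain hs1 hs2 where *: "nonneg_list hs1" "nonneg_list hs2" "sum_list hs1 = \<delta> - h"
      "sum_list hs2 = sum_list hs - (\<delta> - h)"
      "\<And>m b :: real^'k. pos_vec b \<Longrightarrow> sched_value \<sigma> hs m b \<le> sched_value \<sigma> (hs1 @ hs2) m b"
      using Cons.IH[OF hs, of "\<delta> - h"] Cons.prems False by auto
    have "sched_value \<sigma> (h # hs) m b \<le> sched_value \<sigma> (h # (hs1 @ hs2)) m b"
      if "pos_vec b" for m b :: "real^'k"
      using * h hs that by (intro sched_value_Cons_mono) auto
    then show ?thesis
      using * h by (intro exI[of _ "h # hs1"] exI[of _ hs2]) auto
  qed
qed

section \<open>Continuity by coupling\<close>

text \<open>
  Two copies with noise levels \<open>\<sigma>\<close>, \<open>\<sigma>'\<close> and precisions \<open>b\<close>, \<open>b + \<delta>\<close> that are driven by the same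
  noise drift apart in one pull by a variance that is a small multiple of \<open>1/b - 1/(b + h)\<close>. The
  latter telescopes along the path, which is what keeps the estimate uniform in the number of pulls.
\<close>

lemma step_sd_difference:
  assumes "0 < c" "c \<le> b" "0 \<le> \<delta>" "0 \<le> h"
  shows "(step_sd \<sigma> b h - step_sd \<sigma>' (b + \<delta>) h)\<^sup>2
    \<le> (2 * (\<sigma> - \<sigma>')\<^sup>2 + 2 * \<sigma>'\<^sup>2 * (\<delta> / c)\<^sup>2) * (1 / b - 1 / (b + h))"
proof -
  define g g' where "g = 1 / b - 1 / (b + h)" and "g' = 1 / (b + \<delta>) - 1 / (b + \<delta> + h)"
  have b: "0 < b" using assms by simp
  have g_eq: "g = h / (b * (b + h))" and g'_eq: "g' = h / ((b + \<delta>) * (b + \<delta> + h))"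
    using assms b by (simp_all add: g_def g'_def field_simps)
  have g0: "0 \<le> g" "0 \<le> g'" using assms b by (simp_all add: g_eq g'_eq)
  have "g' \<le> g"
    unfolding g_eq g'_eq using assms b by (intro divide_left_mono mult_mono) auto
  \<comment> \<open>the ratio of the two standard deviations is at least \<open>b / (b + \<delta>)\<close>\<close>
  have "b\<^sup>2 * g \<le> (b + \<delta>)\<^sup>2 * g'"
  proof -
    have "b\<^sup>2 * g = h * (b / (b + h))" "(b + \<delta>)\<^sup>2 * g' = h * ((b + \<delta>) / (b + \<delta> + h))"
      using assms b by (simp_all add: g_eq g'_eq power2_eq_square)
    moreover have "b / (b + h) \<le> (b + \<delta>) / (b + \<delta> + h)"
      using assms b by (simp add: field_simps)
    ultimately show ?thesis using assms(4) by (simp only: mult_left_mono)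
  qed
  then have "sqrt (b\<^sup>2 * g) \<le> sqrt ((b + \<delta>)\<^sup>2 * g')" by (rule real_sqrt_le_mono)
  then have le: "b * sqrt g \<le> (b + \<delta>) * sqrt g'"
    using assms b by (simp add: real_sqrt_mult)
  have "c * (sqrt g - sqrt g') \<le> b * (sqrt g - sqrt g')"
    using assms \<open>g' \<le> g\<close> by (intro mult_right_mono) auto
  also have "\<dots> \<le> \<delta> * sqrt g'" using le by (simp add: algebra_simps)
  also have "\<dots> \<le> \<delta> * sqrt g" using assms \<open>g' \<le> g\<close> by (intro mult_left_mono) auto
  finally have "sqrt g - sqrt g' \<le> \<delta> / c * sqrt g"
    using assms by (simp add: field_simps)
  then have "(sqrt g - sqrt g')\<^sup>2 \<le> (\<delta> / c * sqrt g)\<^sup>2"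
    using \<open>g' \<le> g\<close> by (intro power_mono) auto
  then have d: "(sqrt g - sqrt g')\<^sup>2 \<le> (\<delta> / c)\<^sup>2 * g"
    using g0 by (simp only: power_mult_distrib real_sqrt_pow2)
  have "step_sd \<sigma> b h - step_sd \<sigma>' (b + \<delta>) h = (\<sigma> - \<sigma>') * sqrt g + \<sigma>' * (sqrt g - sqrt g')"
    by (simp add: step_sd_def g_def g'_def algebra_simps)
  also have "\<dots>\<^sup>2 \<le> 2 * ((\<sigma> - \<sigma>') * sqrt g)\<^sup>2 + 2 * (\<sigma>' * (sqrt g - sqrt g'))\<^sup>2"
  proof -
    have "(x + y)\<^sup>2 \<le> 2 * x\<^sup>2 + 2 * y\<^sup>2" for x y :: real
      using zero_le_power2[of "x - y"] by (simp add: power2_eq_square algebra_simps)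
    then show ?thesis .
  qed
  also have "\<dots> \<le> 2 * (\<sigma> - \<sigma>')\<^sup>2 * g + 2 * (\<sigma>'\<^sup>2 * ((\<delta> / c)\<^sup>2 * g))"
    using g0 d by (simp add: power_mult_distrib mult_left_mono)
  finally show ?thesis by (simp add: g_def algebra_simps)
qed

text \<open>
  Squared distance of the two copies, plus a compensator \<open>A\<^sub>k/b\<^sub>k\<close> that pays for the distance they
  will still gain: with \<open>A\<close> from the preceding lemma the sum is a supermartingale.
\<close>

definition coupling_cost ::
  "real^'k::finite \<Rightarrow> real^'k \<Rightarrow> real^'k \<Rightarrow> real^'k \<Rightarrow> real" where
  "coupling_cost A m m' b = (\<Sum>k\<in>UNIV. (m$k - m'$k)\<^sup>2 + A$k / b$k)"

lemma coupling_cost_ge: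
  assumes "pos_vec b" "\<forall>k. 0 \<le> A$k"
  shows "(m$k - m'$k)\<^sup>2 \<le> coupling_cost A m m' b"
proof -
  have "(m$k - m'$k)\<^sup>2 \<le> (m$k - m'$k)\<^sup>2 + A$k / b$k"
    using assms by (simp add: less_imp_le)
  also have "\<dots> \<le> coupling_cost A m m' b"
    unfolding coupling_cost_def using assms by (intro member_le_sum) (auto simp: less_imp_le)
  finally show ?thesis .
qed

lemma coupling_cost_update:
  "coupling_cost A (m + axis k y) (m' + axis k y') (b + axis k h)
    = coupling_cost A m m' b + 2 * (m$k - m'$k) * (y - y') + (y - y')\<^sup>2
      - A$k * (1 / b$k - 1 / (b$k + h))"
  unfolding coupling_cost_def
  by (subst sum_change_one[where k = k and g = "\<lambda>k. (m$k - m'$k)\<^sup>2 + A$k / b$k"])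
    (auto simp: axis_def power2_eq_square algebra_simps)

lemma coupling_cost_supermartingale:
  assumes "(s - s')\<^sup>2 \<le> A$k * (1 / b$k - 1 / (b$k + h))"
  shows "integrable std_normal
      (\<lambda>x. coupling_cost A (m + axis k (s * x)) (m' + axis k (s' * x)) (b + axis k h))"
    and "(\<integral>x. coupling_cost A (m + axis k (s * x)) (m' + axis k (s' * x)) (b + axis k h) \<partial>std_normal)
      \<le> coupling_cost A m m' b"
proof -
  have eq: "(\<lambda>x. coupling_cost A (m + axis k (s * x)) (m' + axis k (s' * x)) (b + axis k h))
    = (\<lambda>x. (coupling_cost A m m' b - A$k * (1 / b$k - 1 / (b$k + h)))
        + (2 * (m$k - m'$k) * (s - s')) * x + (s - s')\<^sup>2 * x\<^sup>2 + 0 * x ^ 3 + 0 * x ^ 4)"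
    by (auto simp: coupling_cost_update power_mult_distrib algebra_simps power2_eq_square)
  show "integrable std_normal
      (\<lambda>x. coupling_cost A (m + axis k (s * x)) (m' + axis k (s' * x)) (b + axis k h))"
    unfolding eq by (rule integrable_std_normal_quartic)
  show "(\<integral>x. coupling_cost A (m + axis k (s * x)) (m' + axis k (s' * x)) (b + axis k h) \<partial>std_normal)
      \<le> coupling_cost A m m' b"
    unfolding eq by (subst integral_std_normal_quartic) (use assms in simp)
qed

text \<open>
  Both copies follow the same policy and receive the same noise. Per unit of time their rewards
  differ by at most \<open>\<bar>m\<^sub>k - m'\<^sub>k\<bar>\<close>, which the supermartingale \<open>coupling_cost\<close> controls. The bound
  depends on the schedule through its total duration only.
\<close>

lemma sched_value_coupling:
  fixes \<delta> :: "real^'k::finite"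
  assumes "0 < c" "0 < \<eta>" "\<forall>k. 0 \<le> \<delta>$k"
    and A: "\<And>k. A$k = 2 * (\<sigma> - \<sigma>')\<^sup>2 + 2 * \<sigma>'\<^sup>2 * (\<delta>$k / c)\<^sup>2"
  shows "nonneg_list hs \<Longrightarrow> \<forall>k. c \<le> b$k \<Longrightarrow>
    \<bar>sched_value \<sigma> hs m b - sched_value \<sigma>' hs m' (b + \<delta>)\<bar>
      \<le> sum_list hs * (\<eta> + coupling_cost A m m' b / \<eta>)"
proof (induction hs arbitrary: m m' b)
  case Nil
  then show ?case by simp
next
  case (Cons h hs)
  have h: "h \<ge> 0" and hs: "nonneg_list hs" using Cons.prems by auto
  have b: "pos_vec b" using assms(1) Cons.prems(2) less_le_trans by blast
  have A0: "\<forall>k. 0 \<le> A$k" by (simp add: A)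
  have "\<bar>pull \<sigma> h k (sched_value \<sigma> hs) m b - pull \<sigma>' h k (sched_value \<sigma>' hs) m' (b + \<delta>)\<bar>
      \<le> sum_list (h # hs) * (\<eta> + coupling_cost A m m' b / \<eta>)" for k
  proof -
    let ?s = "step_sd \<sigma> (b$k) h" and ?s' = "step_sd \<sigma>' ((b + \<delta>)$k) h"
    let ?m = "\<lambda>x. m + axis k (?s * x)" and ?m' = "\<lambda>x. m' + axis k (?s' * x)"
    let ?b = "b + axis k h"
    have b': "b + \<delta> + axis k h = ?b + \<delta>" by (simp add: algebra_simps)
    have sd: "(?s - ?s')\<^sup>2 \<le> A$k * (1 / b$k - 1 / (b$k + h))"
      using step_sd_difference[of c "b$k" "\<delta>$k" h \<sigma> \<sigma>'] assms Cons.prems h by (simp add: A)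
    have c': "\<forall>j. c \<le> ?b$j"
      using Cons.prems(2) h by (auto simp: axis_def add_increasing2)
    have int: "integrable std_normal
        (\<lambda>x. sum_list hs * (\<eta> + coupling_cost A (?m x) (?m' x) ?b / \<eta>))"
      by (intro integrable_mult_right Bochner_Integration.integrable_add integrable_divide
          integrable_std_normal_const coupling_cost_supermartingale sd)
    have "\<bar>(\<integral>x. sched_value \<sigma> hs (?m x) ?b \<partial>std_normal)
          - (\<integral>x. sched_value \<sigma>' hs (?m' x) (b + \<delta> + axis k h) \<partial>std_normal)\<bar>
        \<le> (\<integral>x. sum_list hs * (\<eta> + coupling_cost A (?m x) (?m' x) ?b / \<eta>) \<partial>std_normal)"
      unfolding b' using Cons.IH[OF hs c']
      by (intro abs_integral_diff_le integrable_sched_value hs int)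
    also have "\<dots> = sum_list hs * (\<eta> + (\<integral>x. coupling_cost A (?m x) (?m' x) ?b \<partial>std_normal) / \<eta>)"
      using coupling_cost_supermartingale(1)[where A = A, OF sd, of m m'] by simp
    also have "\<dots> \<le> sum_list hs * (\<eta> + coupling_cost A m m' b / \<eta>)"
      using coupling_cost_supermartingale(2)[where A = A, OF sd, of m m'] assms(2) sum_list_nonneg_list[OF hs]
      by (intro mult_left_mono add_left_mono divide_right_mono) auto
    finally have 1: "\<bar>(\<integral>x. sched_value \<sigma> hs (?m x) ?b \<partial>std_normal)
          - (\<integral>x. sched_value \<sigma>' hs (?m' x) (b + \<delta> + axis k h) \<partial>std_normal)\<bar>
        \<le> sum_list hs * (\<eta> + coupling_cost A m m' b / \<eta>)" .
    have "\<bar>m$k - m'$k\<bar> \<le> \<eta> + (m$k - m'$k)\<^sup>2 / \<eta>"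
      by (rule abs_le_eta_square[OF assms(2)])
    also have "\<dots> \<le> \<eta> + coupling_cost A m m' b / \<eta>"
      using coupling_cost_ge[OF b A0] assms(2) by (intro add_left_mono divide_right_mono) auto
    finally have "h * \<bar>m$k - m'$k\<bar> \<le> h * (\<eta> + coupling_cost A m m' b / \<eta>)"
      using h by (rule mult_left_mono)
    then have "\<bar>h * m$k - h * m'$k\<bar> \<le> h * (\<eta> + coupling_cost A m m' b / \<eta>)"
      using h by (simp add: right_diff_distrib[symmetric] abs_mult)
    with 1 show ?thesis
      unfolding pull_def sum_list.Cons distrib_right[of h "sum_list hs"] by linarith
  qed
  then show ?case by (rule sched_value_Cons_diff_le)
qed

lemma tendsto_zeroI_linear:
  fixes f :: "'a \<Rightarrow> real"
  assumes "\<And>\<eta>. \<eta> > 0 \<Longrightarrow> \<forall>\<^sub>F x in F. \<bar>f x\<bar> \<le> K * \<eta>" "K \<ge> 0"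
  shows "(f \<longlongrightarrow> 0) F"
proof (rule tendstoI)
  fix e :: real assume e: "e > 0"
  have "K * (e / (K + 1)) < e" using e assms(2) by (simp add: field_simps)
  with assms(1)[of "e / (K + 1)"] e assms(2) show "\<forall>\<^sub>F x in F. dist (f x) 0 < e"
    by (auto elim!: eventually_mono)
qed

lemma pos_vec_lower_bound:
  fixes b :: "real^'k::finite"
  assumes "pos_vec b"
  obtains c where "0 < c" "\<forall>k. 2 * c \<le> b$k"
proof
  show "0 < (MIN k. b$k) / 2" using assms by simp
  show "\<forall>k. 2 * ((MIN k. b$k) / 2) \<le> b$k" by simp
qed

text \<open>
  The coupling compares precisions \<open>b \<le> b + \<delta>\<close>. For arbitrary precisions it is applied twice, passing
  through the componentwise maximum \<open>u\<close>.
\<close>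

lemma sched_value_equicontinuous:
  fixes m :: "real^'k::finite"
  assumes \<sigma>: "(\<sigma>n \<longlongrightarrow> \<sigma>) F" and m: "(mn \<longlongrightarrow> m) F" and b: "(bn \<longlongrightarrow> b) F" and pos: "pos_vec b"
    and "0 \<le> T" "0 < e"
  shows "\<forall>\<^sub>F n in F. \<forall>hs. nonneg_list hs \<longrightarrow> sum_list hs \<le> T \<longrightarrow>
    \<bar>sched_value (\<sigma>n n) hs (mn n) (bn n) - sched_value \<sigma> hs m b\<bar> \<le> e"
proof -
  obtain c where c: "0 < c" "\<forall>k. 2 * c \<le> b$k" using pos_vec_lower_bound[OF pos] .
  define \<eta> where "\<eta> = e / (4 * (T + 1))"
  have \<eta>: "0 < \<eta>" and T\<eta>: "T * (4 * \<eta>) \<le> e" using assms(5,6) by (simp_all add: \<eta>_def field_simps)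
  define u where "u n = (\<chi> k. max (bn n$k) (b$k))" for n
  define \<delta>1 \<delta>2 where "\<delta>1 n = u n - bn n" and "\<delta>2 n = u n - b" for n
  have u: "(u \<longlongrightarrow> b) F"
  proof -
    have "((\<lambda>n. max (bn n$k) (b$k)) \<longlongrightarrow> max (b$k) (b$k)) F" for k
      by (intro tendsto_max tendsto_vec_nth b tendsto_const)
    then show ?thesis unfolding u_def by (intro vec_tendstoI) simp
  qed
  have \<delta>: "(\<delta>1 \<longlongrightarrow> 0) F" "(\<delta>2 \<longlongrightarrow> 0) F"
    using tendsto_diff[OF u b] tendsto_diff[OF u tendsto_const[of b]] by (simp_all add: \<delta>1_def[abs_def] \<delta>2_def[abs_def])
  have \<delta>_nonneg: "\<forall>k. 0 \<le> \<delta>1 n$k" "\<forall>k. 0 \<le> \<delta>2 n$k" for n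
    by (simp_all add: \<delta>1_def \<delta>2_def u_def)
  define A1 where "A1 n = (\<chi> k. 2 * (\<sigma>n n - \<sigma>)\<^sup>2 + 2 * \<sigma>\<^sup>2 * (\<delta>1 n$k / c)\<^sup>2)" for n
  define A2 where "A2 n = (\<chi> k. 2 * (\<sigma> - \<sigma>)\<^sup>2 + 2 * \<sigma>\<^sup>2 * (\<delta>2 n$k / c)\<^sup>2)" for n
  have "((\<lambda>n. coupling_cost (A1 n) (mn n) m (bn n)) \<longlongrightarrow>
      (\<Sum>k\<in>UNIV. (m$k - m$k)\<^sup>2 + (2 * (\<sigma> - \<sigma>)\<^sup>2 + 2 * \<sigma>\<^sup>2 * ((0::real^'k)$k / c)\<^sup>2) / b$k)) F"
    unfolding coupling_cost_def A1_def vec_lambda_beta using c pos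
    by (intro tendsto_sum tendsto_intros tendsto_vec_nth m b \<sigma> \<delta>) (auto simp: less_imp_neq[symmetric])
  then have C1: "((\<lambda>n. coupling_cost (A1 n) (mn n) m (bn n)) \<longlongrightarrow> 0) F" by simp
  have "((\<lambda>n. coupling_cost (A2 n) m m b) \<longlongrightarrow>
      (\<Sum>k\<in>UNIV. (m$k - m$k)\<^sup>2 + (2 * (\<sigma> - \<sigma>)\<^sup>2 + 2 * \<sigma>\<^sup>2 * ((0::real^'k)$k / c)\<^sup>2) / b$k)) F"
    unfolding coupling_cost_def A2_def vec_lambda_beta using c pos
    by (intro tendsto_sum tendsto_intros tendsto_vec_nth m b \<sigma> \<delta>) (auto simp: less_imp_neq[symmetric])
  then have C2: "((\<lambda>n. coupling_cost (A2 n) m m b) \<longlongrightarrow> 0) F" by simp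
  have "\<forall>\<^sub>F n in F. c \<le> bn n$k" for k
    using order_tendstoD(1)[OF tendsto_vec_nth[OF b, of k], of c] c(1) c(2)[rule_format, of k]
    by (auto elim: eventually_mono)
  then have ev: "\<forall>\<^sub>F n in F. \<forall>k. c \<le> bn n$k" by (rule eventually_all_finite)
  have "\<forall>\<^sub>F n in F. coupling_cost (A1 n) (mn n) m (bn n) < \<eta>\<^sup>2"
    "\<forall>\<^sub>F n in F. coupling_cost (A2 n) m m b < \<eta>\<^sup>2"
    using order_tendstoD(2)[OF C1] order_tendstoD(2)[OF C2] \<eta> by simp_all
  with ev show ?thesis
  proof eventually_elim
    case (elim n)
    show ?case
    proof (intro allI impI)
      fix hs assume hs: "nonneg_list hs" "sum_list hs \<le> T"
      have small: "sum_list hs * (\<eta> + C / \<eta>) \<le> e / 2" if "C < \<eta>\<^sup>2" for C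
      proof -
        have "C / \<eta> \<le> \<eta>" using that \<eta> by (simp add: divide_le_eq power2_eq_square)
        then have "sum_list hs * (\<eta> + C / \<eta>) \<le> sum_list hs * (2 * \<eta>)"
          using sum_list_nonneg_list[OF hs(1)] by (intro mult_left_mono) auto
        also have "\<dots> \<le> T * (2 * \<eta>)" using hs \<eta> by (intro mult_right_mono) auto
        finally show ?thesis using T\<eta> by linarith
      qed
      have "\<bar>sched_value (\<sigma>n n) hs (mn n) (bn n) - sched_value \<sigma> hs m (bn n + \<delta>1 n)\<bar> \<le> e / 2"
        by (rule order_trans[OF sched_value_coupling[OF c(1) \<eta> \<delta>_nonneg(1), of "A1 n"] small])
          (use elim hs in \<open>auto simp: A1_def\<close>)
      moreover have "\<bar>sched_value \<sigma> hs m b - sched_value \<sigma> hs m (b + \<delta>2 n)\<bar> \<le> e / 2"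
      proof (rule order_trans[OF sched_value_coupling[OF c(1) \<eta> \<delta>_nonneg(2), of "A2 n"] small])
        show "\<forall>k. c \<le> b$k" using c by (smt (verit))
      qed (use elim hs in \<open>auto simp: A2_def\<close>)
      moreover have u_eq: "bn n + \<delta>1 n = b + \<delta>2 n" by (simp add: \<delta>1_def \<delta>2_def)
      ultimately show "\<bar>sched_value (\<sigma>n n) hs (mn n) (bn n) - sched_value \<sigma> hs m b\<bar> \<le> e"
        unfolding u_eq by linarith
    qed
  qed
qed

lemma tendsto_MAX:
  fixes f :: "'a \<Rightarrow> 'k::finite \<Rightarrow> real"
  assumes "\<And>k. ((\<lambda>n. f n k) \<longlongrightarrow> g k) F"
  shows "((\<lambda>n. MAX k. f n k) \<longlongrightarrow> (MAX k. g k)) F"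
proof (rule Lim_transform2[OF tendsto_const Lim_null_comparison])
  have "((\<lambda>n. \<Sum>k\<in>UNIV. \<bar>g k - f n k\<bar>) \<longlongrightarrow> (\<Sum>k\<in>(UNIV::'k set). \<bar>g k - g k\<bar>)) F"
    by (intro tendsto_intros assms)
  then show "((\<lambda>n. \<Sum>k\<in>UNIV. \<bar>g k - f n k\<bar>) \<longlongrightarrow> 0) F" by simp
  show "\<forall>\<^sub>F n in F. norm ((MAX k. g k) - (MAX k. f n k)) \<le> (\<Sum>k\<in>UNIV. \<bar>g k - f n k\<bar>)"
  proof (rule always_eventually, rule allI)
    fix n
    let ?S = "\<Sum>k\<in>UNIV. \<bar>g k - f n k\<bar>"
    have S: "\<bar>g k - f n k\<bar> \<le> ?S" for k by (rule member_le_sum) auto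
    have "g k \<le> (MAX k. f n k) + ?S" for k
      using S[of k] Max_ge[of "range (f n)" "f n k"] by (auto simp del: Max_ge)
    then have 1: "(MAX k. g k) \<le> (MAX k. f n k) + ?S" by auto
    have "f n k \<le> (MAX k. g k) + ?S" for k
      using S[of k] Max_ge[of "range g" "g k"] by (auto simp del: Max_ge)
    then have "(MAX k. f n k) \<le> (MAX k. g k) + ?S" by auto
    with 1 show "norm ((MAX k. g k) - (MAX k. f n k)) \<le> ?S"
      unfolding real_norm_def by linarith
  qed
qed

lemma tendsto_axis:
  assumes "(f \<longlongrightarrow> (x::real)) F"
  shows "((\<lambda>n. axis k (f n)) \<longlongrightarrow> axis k x) F"
  unfolding axis_eq_scaleR[of k "f _"] axis_eq_scaleR[of k x]
  by (intro tendsto_intros assms)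

text \<open>
  For a schedule with a fixed number of entries the reward is continuous in the state and in the
  durations. In the application \<open>r n h\<close> rounds \<open>h\<close> down to a multiple of \<open>1/n\<close>.
\<close>

lemma sched_value_grid_tendsto:
  fixes m :: "real^'k::finite"
  assumes r: "\<And>h. 0 \<le> h \<Longrightarrow> (\<lambda>n. r n h) \<longlonglongrightarrow> h" "\<And>n h. 0 \<le> h \<Longrightarrow> 0 \<le> r n h"
  shows "nonneg_list hs \<Longrightarrow> mn \<longlonglongrightarrow> m \<Longrightarrow> bn \<longlonglongrightarrow> b \<Longrightarrow> pos_vec b \<Longrightarrow>
    (\<lambda>n. sched_value \<sigma> (map (r n) hs) (mn n) (bn n)) \<longlonglongrightarrow> sched_value \<sigma> hs m b"
proof (induction hs arbitrary: mn m bn b)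
  case Nil
  then show ?case by simp
next
  case (Cons h hs)
  have h: "0 \<le> h" and hs: "nonneg_list hs" using Cons.prems by auto
  have rhs: "nonneg_list (map (r n) hs)" for n using hs r(2) by auto
  have rsum: "(\<lambda>n. sum_list (map (r n) hs)) \<longlonglongrightarrow> sum_list hs"
    using hs by (induction hs) (auto intro!: tendsto_add r)
  have pull: "(\<lambda>n. pull \<sigma> (r n h) k (sched_value \<sigma> (map (r n) hs)) (mn n) (bn n))
      \<longlonglongrightarrow> pull \<sigma> h k (sched_value \<sigma> hs) m b" for k
  proof -
    define s where "s n = step_sd \<sigma> (bn n$k) (r n h)" for n
    have bk: "0 < b$k" using Cons.prems by auto
    have s: "s \<longlonglongrightarrow> step_sd \<sigma> (b$k) h"
      unfolding s_def step_sd_def using bk h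
      by (intro tendsto_intros tendsto_vec_nth Cons.prems r) auto
    have b: "(\<lambda>n. bn n + axis k (r n h)) \<longlonglongrightarrow> b + axis k h"
      by (intro tendsto_intros tendsto_axis Cons.prems r h)
    have pos: "pos_vec (b + axis k h)" using Cons.prems h by (intro pos_vec_add_axis)
    have lim: "(\<lambda>n. sched_value \<sigma> (map (r n) hs) (mn n + axis k (s n * x)) (bn n + axis k (r n h)))
        \<longlonglongrightarrow> sched_value \<sigma> hs (m + axis k (step_sd \<sigma> (b$k) h * x)) (b + axis k h)" for x
      by (intro Cons.IH hs b pos tendsto_intros tendsto_axis Cons.prems s)
    obtain K1 where K1: "\<And>n. \<bar>sched_value \<sigma> (map (r n) hs) (mn n) (bn n + axis k (r n h))\<bar> \<le> K1"
      using convergent_imp_Bseq[OF convergentI[OF lim[of 0]]]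
      unfolding Bseq_def axis_eq_scaleR[of k "_ * 0"] by auto
    have "(\<lambda>n. sum_list (map (r n) hs) * \<bar>s n\<bar>) \<longlonglongrightarrow> sum_list hs * \<bar>step_sd \<sigma> (b$k) h\<bar>"
      by (intro tendsto_intros rsum s)
    then have "Bseq (\<lambda>n. sum_list (map (r n) hs) * \<bar>s n\<bar>)"
      by (intro convergent_imp_Bseq convergentI)
    then obtain K2 where K2: "\<And>n. sum_list (map (r n) hs) * \<bar>s n\<bar> \<le> K2"
      unfolding Bseq_def real_norm_def using abs_le_D1 by blast
    \<comment> \<open>the Lipschitz bound in \<open>m\<close> reduces the majorant to the values at \<open>x = 0\<close>, which converge and are
        therefore bounded, as is the slope\<close>
    have dom: "\<bar>sched_value \<sigma> (map (r n) hs) (mn n + axis k (s n * x)) (bn n + axis k (r n h))\<bar>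
        \<le> K1 + K2 * \<bar>x\<bar>" for n x
    proof -
      have "\<bar>sched_value \<sigma> (map (r n) hs) (mn n + axis k (s n * x)) (bn n + axis k (r n h))
          - sched_value \<sigma> (map (r n) hs) (mn n) (bn n + axis k (r n h))\<bar>
        \<le> sum_list (map (r n) hs) * \<bar>s n\<bar> * \<bar>x\<bar>"
        using lipschitz_onD[OF sched_value_lipschitz[OF rhs], of "mn n + axis k (s n * x)" "mn n"]
        by (simp add: dist_norm norm_axis_real abs_mult mult.assoc)
      also have "\<dots> \<le> K2 * \<bar>x\<bar>" by (intro mult_right_mono K2) auto
      finally show ?thesis using K1[of n] by linarith
    qed
    have "(\<lambda>n. \<integral>x. sched_value \<sigma> (map (r n) hs) (mn n + axis k (s n * x)) (bn n + axis k (r n h)) \<partial>std_normal)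
        \<longlonglongrightarrow> (\<integral>x. sched_value \<sigma> hs (m + axis k (step_sd \<sigma> (b$k) h * x)) (b + axis k h) \<partial>std_normal)"
    proof (rule integral_dominated_convergence)
      show "integrable std_normal (\<lambda>x. K1 + K2 * \<bar>x\<bar>)"
        by (intro Bochner_Integration.integrable_add integrable_mult_right
            integrable_std_normal_const integrable_std_normal_abs)
    qed (use lim dom integrable_sched_value[OF rhs, THEN borel_measurable_integrable]
          integrable_sched_value[OF hs, THEN borel_measurable_integrable] in auto)
    then show ?thesis
      unfolding pull_def s_def
      by (intro tendsto_intros tendsto_vec_nth Cons.prems r h)
  qed
  show ?case
    unfolding list.map sched_value.simps by (rule tendsto_MAX[OF pull])
qed

section \<open>The value function in continuous time\<close>

text \<open>
  The continuous-time value function. Since refining a schedule helps, the supremum describes a limit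
  of ever finer switching times.
\<close>

definition value_fun :: "real \<Rightarrow> real \<Rightarrow> real^'k::finite \<Rightarrow> real^'k \<Rightarrow> real" where
  "value_fun \<sigma> \<tau> m b = (SUP hs\<in>{hs. nonneg_list hs \<and> sum_list hs = \<tau>}. sched_value \<sigma> hs m b)"

lemma sched_value_le_value_fun:
  assumes "nonneg_list hs" "sum_list hs = \<tau>" "pos_vec b"
  shows "sched_value \<sigma> hs m b \<le> value_fun \<sigma> \<tau> m b"
  unfolding value_fun_def
proof (rule cSUP_upper)
  show "bdd_above ((\<lambda>hs. sched_value \<sigma> hs m b) ` {hs. nonneg_list hs \<and> sum_list hs = \<tau>})"
    using sched_value_growth[OF _ assms(3), of _ \<sigma> m]
    by (intro bdd_aboveI2[of _ _ "\<tau> * growth \<sigma> m b"]) (auto simp: abs_le_iff)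
qed (use assms in auto)

lemma value_fun_le:
  assumes "0 \<le> \<tau>" "\<And>hs. nonneg_list hs \<Longrightarrow> sum_list hs = \<tau> \<Longrightarrow> sched_value \<sigma> hs m b \<le> X"
  shows "value_fun \<sigma> \<tau> m b \<le> X"
proof -
  have "[\<tau>] \<in> {hs. nonneg_list hs \<and> sum_list hs = \<tau>}" using assms(1) by simp
  then show ?thesis
    unfolding value_fun_def by (intro cSUP_least) (use assms(2) in blast)+
qed

lemma value_fun_approx:
  assumes "0 \<le> \<tau>" "X < value_fun \<sigma> \<tau> m b"
  obtains hs where "nonneg_list hs" "sum_list hs = \<tau>" "X < sched_value \<sigma> hs m b"
  using value_fun_le[OF assms(1), of \<sigma> m b X] assms(2) by (force simp: not_less[symmetric])

lemma value_fun_growth: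
  assumes "0 \<le> \<tau>" "pos_vec b"
  shows "\<bar>value_fun \<sigma> \<tau> m b\<bar> \<le> \<tau> * growth \<sigma> m b"
proof (rule abs_leI)
  show "value_fun \<sigma> \<tau> m b \<le> \<tau> * growth \<sigma> m b"
    using sched_value_growth[OF _ assms(2), of _ \<sigma> m] by (intro value_fun_le assms) (auto simp: abs_le_iff)
  have "- (\<tau> * growth \<sigma> m b) \<le> sched_value \<sigma> [\<tau>] m b"
    using sched_value_growth[OF _ assms(2), of "[\<tau>]" \<sigma> m] assms by (auto simp: abs_le_iff)
  also have "\<dots> \<le> value_fun \<sigma> \<tau> m b"
    by (rule sched_value_le_value_fun) (use assms in auto)
  finally show "- value_fun \<sigma> \<tau> m b \<le> \<tau> * growth \<sigma> m b" by simp
qed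

lemma value_fun_zero: "pos_vec b \<Longrightarrow> value_fun \<sigma> 0 m b = 0"
  using value_fun_growth[of 0 b \<sigma> m] by simp

lemma value_fun_lipschitz:
  assumes "0 \<le> \<tau>" "pos_vec b"
  shows "\<tau>-lipschitz_on UNIV (\<lambda>m. value_fun \<sigma> \<tau> m b)"
proof (rule lipschitz_onI)
  fix m m' :: "real^'a"
  have *: "value_fun \<sigma> \<tau> m b \<le> value_fun \<sigma> \<tau> m' b + \<tau> * dist m m'" for m m'
  proof (rule value_fun_le[OF assms(1)])
    fix hs :: "real list" assume hs: "nonneg_list hs" "sum_list hs = \<tau>"
    show "sched_value \<sigma> hs m b \<le> value_fun \<sigma> \<tau> m' b + \<tau> * dist m m'"
      using sched_value_le_value_fun[OF hs assms(2), of \<sigma> m']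
        lipschitz_onD[OF sched_value_lipschitz[OF hs(1)], of m m' \<sigma> b] hs(2)
      by (simp add: dist_real_def abs_le_iff)
  qed
  show "dist (value_fun \<sigma> \<tau> m b) (value_fun \<sigma> \<tau> m' b) \<le> \<tau> * dist m m'"
    using *[of m m'] *[of m' m] by (simp add: dist_real_def dist_commute abs_le_iff)
qed (rule assms)

text \<open>
  For a longer horizon, cut a schedule and drop its end; for a shorter one, append a pull.
\<close>

lemma value_fun_time_diff:
  fixes m :: "real^'k::finite"
  assumes "0 \<le> \<sigma>" "0 \<le> \<tau>" "0 \<le> \<tau>'" "pos_vec b"
  shows "\<bar>value_fun \<sigma> \<tau> m b - value_fun \<sigma> \<tau>' m b\<bar> \<le> \<bar>\<tau> - \<tau>'\<bar> * growth \<sigma> m b"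
proof -
  have *: "\<bar>value_fun \<sigma> \<tau> m b - value_fun \<sigma> \<tau>' m b\<bar> \<le> (\<tau>' - \<tau>) * growth \<sigma> m b"
    if le: "0 \<le> \<tau>" "\<tau> \<le> \<tau>'" for \<tau> \<tau>' :: real
  proof -
    have "value_fun \<sigma> \<tau> m b \<le> value_fun \<sigma> \<tau>' m b + (\<tau>' - \<tau>) * growth \<sigma> m b"
    proof (rule value_fun_le[OF le(1)])
      fix hs :: "real list" assume hs: "nonneg_list hs" "sum_list hs = \<tau>"
      show "sched_value \<sigma> hs m b \<le> value_fun \<sigma> \<tau>' m b + (\<tau>' - \<tau>) * growth \<sigma> m b"
        using sched_value_append_diff[OF hs(1) _ assms(4), of "[\<tau>' - \<tau>]" \<sigma> m]
          sched_value_le_value_fun[of "hs @ [\<tau>' - \<tau>]" \<tau>' b \<sigma> m] hs le assms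
        by (auto simp: abs_le_iff)
    qed
    moreover have "value_fun \<sigma> \<tau>' m b \<le> value_fun \<sigma> \<tau> m b + (\<tau>' - \<tau>) * growth \<sigma> m b"
    proof (rule value_fun_le)
      fix hs :: "real list" assume hs: "nonneg_list hs" "sum_list hs = \<tau>'"
      obtain hs1 hs2 where *: "nonneg_list hs1" "nonneg_list hs2" "sum_list hs1 = \<tau>"
        "sum_list hs2 = \<tau>' - \<tau>" "sched_value \<sigma> hs m b \<le> sched_value \<sigma> (hs1 @ hs2) m b"
        using sched_value_cut[OF assms(1) hs(1) le(1), where 'k = 'k] hs le assms(4) by metis
      show "sched_value \<sigma> hs m b \<le> value_fun \<sigma> \<tau> m b + (\<tau>' - \<tau>) * growth \<sigma> m b"
        using sched_value_append_diff[OF *(1,2) assms(4), of \<sigma> m] *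
          sched_value_le_value_fun[OF *(1,3) assms(4), of \<sigma> m] by (simp add: abs_le_iff)
    qed (use le in simp)
    ultimately show ?thesis by (simp add: abs_le_iff)
  qed
  show ?thesis
    using *[of \<tau> \<tau>'] *[of \<tau>' \<tau>] assms by (cases "\<tau> \<le> \<tau>'") (auto simp: abs_minus_commute)
qed

text \<open>
  The state is handled by equicontinuity, uniformly over the schedules in the supremum, and the time
  by the preceding bound.
\<close>

lemma value_fun_tendsto:
  fixes m :: "real^'k::finite"
  assumes "0 \<le> \<sigma>" and \<tau>: "(\<tau>n \<longlongrightarrow> \<tau>) F" and m: "(mn \<longlongrightarrow> m) F" and b: "(bn \<longlongrightarrow> b) F"
    and pos: "pos_vec b" and "0 \<le> \<tau>" and ev: "\<forall>\<^sub>F n in F. 0 \<le> \<tau>n n"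
  shows "((\<lambda>n. value_fun \<sigma> (\<tau>n n) (mn n) (bn n)) \<longlongrightarrow> value_fun \<sigma> \<tau> m b) F"
proof -
  have "((\<lambda>n. value_fun \<sigma> (\<tau>n n) (mn n) (bn n) - value_fun \<sigma> (\<tau>n n) m b) \<longlongrightarrow> 0) F"
  proof (rule tendsto_zeroI_linear[where K = 1])
    fix e :: real assume "0 < e"
    have T: "0 \<le> \<tau> + 1" using assms by simp
    have "\<forall>\<^sub>F n in F. \<tau>n n < \<tau> + 1" using order_tendstoD(2)[OF \<tau>] by simp
    moreover have "\<forall>\<^sub>F n in F. 0 < bn n $ k" for k
      using order_tendstoD(1)[OF tendsto_vec_nth[OF b, of k], of 0] pos by simp
    then have "\<forall>\<^sub>F n in F. pos_vec (bn n)" by (rule eventually_all_finite)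
    ultimately show "\<forall>\<^sub>F n in F. \<bar>value_fun \<sigma> (\<tau>n n) (mn n) (bn n) - value_fun \<sigma> (\<tau>n n) m b\<bar> \<le> 1 * e"
      using ev sched_value_equicontinuous[OF tendsto_const[of \<sigma>] m b pos T \<open>0 < e\<close>]
    proof eventually_elim
      case (elim n)
      have "value_fun \<sigma> (\<tau>n n) (mn n) (bn n) \<le> value_fun \<sigma> (\<tau>n n) m b + e"
      proof (rule value_fun_le)
        fix hs :: "real list" assume hs: "nonneg_list hs" "sum_list hs = \<tau>n n"
        then have "\<bar>sched_value \<sigma> hs (mn n) (bn n) - sched_value \<sigma> hs m b\<bar> \<le> e"
          using elim by simp
        with sched_value_le_value_fun[OF hs pos, of \<sigma> m]
        show "sched_value \<sigma> hs (mn n) (bn n) \<le> value_fun \<sigma> (\<tau>n n) m b + e"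
          by (simp add: abs_le_iff)
      qed (use elim in simp)
      moreover have "value_fun \<sigma> (\<tau>n n) m b \<le> value_fun \<sigma> (\<tau>n n) (mn n) (bn n) + e"
      proof (rule value_fun_le)
        fix hs :: "real list" assume hs: "nonneg_list hs" "sum_list hs = \<tau>n n"
        then have "\<bar>sched_value \<sigma> hs (mn n) (bn n) - sched_value \<sigma> hs m b\<bar> \<le> e"
          using elim by simp
        with sched_value_le_value_fun[OF hs elim(2), of \<sigma> "mn n"]
        show "sched_value \<sigma> hs m b \<le> value_fun \<sigma> (\<tau>n n) (mn n) (bn n) + e"
          by (simp add: abs_le_iff)
      qed (use elim in simp)
      ultimately show ?case by (simp add: abs_le_iff)
    qed
  qed simp
  moreover have "((\<lambda>n. value_fun \<sigma> (\<tau>n n) m b) \<longlongrightarrow> value_fun \<sigma> \<tau> m b) F"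
  proof (rule Lim_transform2[OF tendsto_const Lim_null_comparison])
    show "\<forall>\<^sub>F n in F. norm (value_fun \<sigma> \<tau> m b - value_fun \<sigma> (\<tau>n n) m b) \<le> \<bar>\<tau> - \<tau>n n\<bar> * growth \<sigma> m b"
      using ev by eventually_elim (use value_fun_time_diff assms in auto)
    have "((\<lambda>n. \<bar>\<tau> - \<tau>n n\<bar> * growth \<sigma> m b) \<longlongrightarrow> \<bar>\<tau> - \<tau>\<bar> * growth \<sigma> m b) F"
      by (intro tendsto_intros \<tau>)
    then show "((\<lambda>n. \<bar>\<tau> - \<tau>n n\<bar> * growth \<sigma> m b) \<longlongrightarrow> 0) F" by simp
  qed
  ultimately show ?thesis by (auto dest: tendsto_add)
qed

lemma floor_ratio_tendsto:
  assumes "0 \<le> h"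
  shows "(\<lambda>n. real (nat \<lfloor>h * real n\<rfloor>) * (1 / real n)) \<longlonglongrightarrow> h"
proof (rule Lim_transform2[OF tendsto_const Lim_null_comparison])
  show "(\<lambda>n. 1 / real n) \<longlonglongrightarrow> 0" by (rule lim_1_over_n)
  show "\<forall>\<^sub>F n in sequentially. norm (h - real (nat \<lfloor>h * real n\<rfloor>) * (1 / real n)) \<le> 1 / real n"
  proof (rule eventually_sequentiallyI[of 1])
    fix n :: nat assume n: "1 \<le> n"
    have f: "real (nat \<lfloor>h * real n\<rfloor>) = real_of_int \<lfloor>h * real n\<rfloor>"
      using assms by simp
    have "\<bar>h * real n - real (nat \<lfloor>h * real n\<rfloor>)\<bar> \<le> 1"
      unfolding f by linarith
    then have "\<bar>h * real n - real (nat \<lfloor>h * real n\<rfloor>)\<bar> / real n \<le> 1 / real n"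
      by (rule divide_right_mono) simp
    moreover have "h - real (nat \<lfloor>h * real n\<rfloor>) * (1 / real n)
        = (h * real n - real (nat \<lfloor>h * real n\<rfloor>)) / real n"
      using n by (simp add: field_simps)
    ultimately show "norm (h - real (nat \<lfloor>h * real n\<rfloor>) * (1 / real n)) \<le> 1 / real n"
      by simp
  qed
qed

lemma sched_value_replicate_diff:
  assumes "0 \<le> h" "pos_vec b"
  shows "\<bar>sched_value \<sigma> (replicate p h) m b - sched_value \<sigma> (replicate q h) m b\<bar>
    \<le> \<bar>real p * h - real q * h\<bar> * growth \<sigma> m b"
proof -
  have *: "\<bar>sched_value \<sigma> (replicate q h) m b - sched_value \<sigma> (replicate p h) m b\<bar>
    \<le> \<bar>real p * h - real q * h\<bar> * growth \<sigma> m b" if "p \<le> q" for p q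
  proof -
    define r where "r = q - p"
    have q: "q = p + r" using that by (simp add: r_def)
    have "\<bar>sched_value \<sigma> (replicate p h @ replicate r h) m b - sched_value \<sigma> (replicate p h) m b\<bar>
        \<le> (real r * h) * growth \<sigma> m b"
      using sched_value_append_diff[of "replicate p h" "replicate r h" b \<sigma> m] assms
      by (simp add: sum_list_replicate)
    moreover have "\<bar>real p * h - real q * h\<bar> = real r * h"
      using assms(1) by (simp add: q distrib_right)
    ultimately show ?thesis by (simp add: q replicate_add)
  qed
  show ?thesis using *[of p q] *[of q p] by (cases "p \<le> q") (simp_all add: abs_minus_commute)
qed

text \<open>
  The upper bound is immediate from the supremum and its continuity in time. For the lower bound,
  take a nearly optimal schedule, round its entries down to multiples of \<open>1/n\<close>, and refine it to
  the equidistant schedule; the number of steps lost by rounding is \<open>o(n)\<close>.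
\<close>

lemma sched_value_uniform_tendsto:
  fixes m :: "real^'k::finite"
  assumes "0 \<le> \<sigma>" "pos_vec b" "0 \<le> \<tau>" and J: "(\<lambda>n. real (J n) * (1 / real n)) \<longlonglongrightarrow> \<tau>"
  shows "(\<lambda>n. sched_value \<sigma> (replicate (J n) (1 / real n)) m b) \<longlonglongrightarrow> value_fun \<sigma> \<tau> m b"
proof (rule order_tendstoI)
  fix X assume X: "value_fun \<sigma> \<tau> m b < X"
  have "(\<lambda>n. value_fun \<sigma> (real (J n) * (1 / real n)) m b) \<longlonglongrightarrow> value_fun \<sigma> \<tau> m b"
    by (rule value_fun_tendsto[OF assms(1) J]) (use assms in auto)
  from order_tendstoD(2)[OF this X]
  show "\<forall>\<^sub>F n in sequentially. sched_value \<sigma> (replicate (J n) (1 / real n)) m b < X"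
  proof eventually_elim
    case (elim n)
    have "sched_value \<sigma> (replicate (J n) (1 / real n)) m b \<le> value_fun \<sigma> (real (J n) * (1 / real n)) m b"
      by (rule sched_value_le_value_fun) (use assms in \<open>auto simp: sum_list_replicate\<close>)
    with elim show ?case by simp
  qed
next
  fix X assume "X < value_fun \<sigma> \<tau> m b"
  then obtain hs where hs: "nonneg_list hs" "sum_list hs = \<tau>" "X < sched_value \<sigma> hs m b"
    using value_fun_approx[OF assms(3)] by blast
  define r where "r = (\<lambda>n h. real (nat \<lfloor>h * real n\<rfloor>) * (1 / real n))"
  define P where "P n = sum_list (map (\<lambda>h. nat \<lfloor>h * real n\<rfloor>) hs)" for n
  have r: "(\<lambda>n. r n h) \<longlonglongrightarrow> h" if "0 \<le> h" for h
    unfolding r_def by (rule floor_ratio_tendsto[OF that])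
  have "(\<lambda>n. sum_list (map (r n) hs)) \<longlonglongrightarrow> sum_list hs"
    using hs(1) by (induction hs) (auto intro!: tendsto_add r)
  moreover have "sum_list (map (r n) hs) = real (P n) * (1 / real n)" for n
    unfolding P_def r_def by (induction hs) (auto simp: algebra_simps)
  ultimately have P: "(\<lambda>n. real (P n) * (1 / real n)) \<longlonglongrightarrow> \<tau>" using hs by simp
  have "(\<lambda>n. sched_value \<sigma> (map (r n) hs) m b) \<longlonglongrightarrow> sched_value \<sigma> hs m b"
    by (rule sched_value_grid_tendsto) (use r hs assms in \<open>auto simp: r_def\<close>)
  then have "(\<lambda>n. sched_value \<sigma> (map (r n) hs) m b
      - \<bar>real (P n) * (1 / real n) - real (J n) * (1 / real n)\<bar> * growth \<sigma> m b)
      \<longlonglongrightarrow> sched_value \<sigma> hs m b - \<bar>\<tau> - \<tau>\<bar> * growth \<sigma> m b"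
    by (intro tendsto_intros P J)
  from order_tendstoD(1)[OF this, of X] hs(3)
  have "\<forall>\<^sub>F n in sequentially. X < sched_value \<sigma> (map (r n) hs) m b
      - \<bar>real (P n) * (1 / real n) - real (J n) * (1 / real n)\<bar> * growth \<sigma> m b"
    by simp
  then show "\<forall>\<^sub>F n in sequentially. X < sched_value \<sigma> (replicate (J n) (1 / real n)) m b"
  proof eventually_elim
    case (elim n)
    have "sched_value \<sigma> (map (r n) hs) m b \<le> sched_value \<sigma> (replicate (P n) (1 / real n)) m b"
      using sched_value_refine_list[OF assms(1) _ assms(2), of "1 / real n" "map (\<lambda>h. nat \<lfloor>h * real n\<rfloor>) hs" m]
      by (simp add: r_def P_def comp_def)
    with elim sched_value_replicate_diff[OF _ assms(2), of "1 / real n" \<sigma> "P n" m "J n"]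
    show ?case by (simp add: abs_le_iff)
  qed
qed

text \<open>
  The discrete rewards converge also along varying states and noise levels; this is the convergence
  of the rescaled bandit.
\<close>

lemma sched_value_convergence:
  fixes m :: "real^'k::finite"
  assumes "0 \<le> \<sigma>" "pos_vec b" "0 \<le> \<tau>" and J: "(\<lambda>n. real (J n) * (1 / real n)) \<longlonglongrightarrow> \<tau>"
    and \<sigma>: "\<sigma>n \<longlonglongrightarrow> \<sigma>" and m: "mn \<longlonglongrightarrow> m" and b: "bn \<longlonglongrightarrow> b"
  shows "(\<lambda>n. sched_value (\<sigma>n n) (replicate (J n) (1 / real n)) (mn n) (bn n)) \<longlonglongrightarrow> value_fun \<sigma> \<tau> m b"
proof -
  have "(\<lambda>n. sched_value (\<sigma>n n) (replicate (J n) (1 / real n)) (mn n) (bn n)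
      - sched_value \<sigma> (replicate (J n) (1 / real n)) m b) \<longlonglongrightarrow> 0"
  proof (rule tendsto_zeroI_linear[where K = 1])
    fix e :: real assume e: "0 < e"
    have "\<forall>\<^sub>F n in sequentially. real (J n) * (1 / real n) < \<tau> + 1"
      using order_tendstoD(2)[OF J] by simp
    moreover have "0 \<le> \<tau> + 1" using assms by simp
    note sched_value_equicontinuous[OF \<sigma> m b assms(2) this e]
    ultimately show "\<forall>\<^sub>F n in sequentially. \<bar>sched_value (\<sigma>n n) (replicate (J n) (1 / real n)) (mn n) (bn n)
      - sched_value \<sigma> (replicate (J n) (1 / real n)) m b\<bar> \<le> 1 * e"
      by eventually_elim (simp add: sum_list_replicate)
  qed simp
  from tendsto_add[OF this sched_value_uniform_tendsto[OF assms(1-4), of m]] show ?thesis by simp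
qed

text \<open>
  One half of dynamic programming. A supremum need not commute with the expectation over the
  increment, so the inequality is first stated for equidistant schedules, which converge pointwise
  and are dominated by \<open>growth\<close>.
\<close>

lemma pull_value_fun_le:
  fixes m :: "real^'k::finite"
  assumes "0 \<le> \<sigma>" "pos_vec b" "0 \<le> \<tau>" "0 \<le> h"
  shows "pull \<sigma> h k (value_fun \<sigma> \<tau>) m b \<le> value_fun \<sigma> (h + \<tau>) m b"
proof -
  define J where "J n = nat \<lfloor>\<tau> * real n\<rfloor>" for n
  have J: "(\<lambda>n. real (J n) * (1 / real n)) \<longlonglongrightarrow> \<tau>"
    unfolding J_def by (rule floor_ratio_tendsto[OF assms(3)])
  define U :: "nat \<Rightarrow> real^'k \<Rightarrow> real^'k \<Rightarrow> real" where "U n = sched_value \<sigma> (replicate (J n) (1 / real n))" for n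
  let ?m = "\<lambda>x. m + axis k (step_sd \<sigma> (b$k) h * x)" and ?b = "b + axis k h"
  have pos: "pos_vec ?b" using assms by (intro pos_vec_add_axis)
  have "Bseq (\<lambda>n. real (J n) * (1 / real n))"
    by (intro convergent_imp_Bseq convergentI[OF J])
  then obtain T where T: "\<And>n. real (J n) * (1 / real n) \<le> T"
    unfolding Bseq_def real_norm_def using abs_le_D1 by blast
  have "\<bar>U n (?m x) ?b\<bar> \<le> T * growth \<sigma> (?m x) ?b" for n x
  proof -
    have "\<bar>U n (?m x) ?b\<bar> \<le> (real (J n) * (1 / real n)) * growth \<sigma> (?m x) ?b"
      using sched_value_growth[OF _ pos, of "replicate (J n) (1 / real n)" \<sigma> "?m x"]
      by (simp add: U_def sum_list_replicate)
    also have "\<dots> \<le> T * growth \<sigma> (?m x) ?b"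
      by (intro mult_right_mono T growth_nonneg pos)
    finally show ?thesis .
  qed
  moreover have U_int: "integrable std_normal (\<lambda>x. U n (?m x) ?b)" for n
    unfolding U_def by (rule integrable_sched_value) simp
  ultimately have "(\<lambda>n. \<integral>x. U n (?m x) ?b \<partial>std_normal) \<longlonglongrightarrow> (\<integral>x. value_fun \<sigma> \<tau> (?m x) ?b \<partial>std_normal)"
    using sched_value_uniform_tendsto[OF assms(1) pos assms(3) J]
      integrable_lipschitz[OF value_fun_lipschitz[OF assms(3) pos, of \<sigma>], THEN borel_measurable_integrable]
      U_int[THEN borel_measurable_integrable]
    by (intro integral_dominated_convergence[where w = "\<lambda>x. T * growth \<sigma> (?m x) ?b"]
        integrable_mult_right growth_martingale assms)
      (auto simp: U_def[abs_def])
  then have lhs: "(\<lambda>n. pull \<sigma> h k (U n) m b) \<longlonglongrightarrow> pull \<sigma> h k (value_fun \<sigma> \<tau>) m b"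
    unfolding pull_def by (intro tendsto_intros)
  have rhs: "(\<lambda>n. value_fun \<sigma> (h + real (J n) * (1 / real n)) m b) \<longlonglongrightarrow> value_fun \<sigma> (h + \<tau>) m b"
    by (rule value_fun_tendsto[OF assms(1)]) (use assms J in \<open>auto intro!: tendsto_intros\<close>)
  have "pull \<sigma> h k (U n) m b \<le> value_fun \<sigma> (h + real (J n) * (1 / real n)) m b" for n
    unfolding U_def
    by (rule order_trans[OF pull_le_sched_value sched_value_le_value_fun])
      (use assms in \<open>auto simp: sum_list_replicate\<close>)
  then show ?thesis by (intro LIMSEQ_le[OF lhs rhs]) auto
qed

section \<open>The bandit in posterior coordinates\<close>

text \<open>
  The posterior mean multiplied by \<open>n/f\<close>, written with the quantities whose limits are given.
\<close>

definition scaled_mean :: "real \<Rightarrow> real \<Rightarrow> real^'k \<Rightarrow> real^'k \<Rightarrow> nat \<Rightarrow> real^'k \<Rightarrow> nat^'k::finite \<Rightarrow> real^'k" where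
  "scaled_mean \<sigma> f \<alpha> \<beta> n s q = (\<chi> k. (\<sigma>\<^sup>2 * \<alpha>$k / (f * (\<beta>$k)\<^sup>2) + s$k / f)
      / (\<sigma>\<^sup>2 / ((\<beta>$k)\<^sup>2 * real n) + real (q$k) / real n))"

text \<open>
  The posterior precision multiplied by \<open>\<sigma>\<^sup>2/n\<close>.
\<close>

definition scaled_precision :: "real \<Rightarrow> real^'k \<Rightarrow> nat \<Rightarrow> nat^'k::finite \<Rightarrow> real^'k" where
  "scaled_precision \<sigma> \<beta> n q = (\<chi> k. \<sigma>\<^sup>2 / ((\<beta>$k)\<^sup>2 * real n) + real (q$k) / real n)"

lemma scaled_precision_pos:
  assumes "0 < \<sigma>" "pos_vec \<beta>" "1 \<le> n"
  shows "pos_vec (scaled_precision \<sigma> \<beta> n q)"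
  using assms by (auto simp: scaled_precision_def intro!: add_pos_nonneg divide_pos_pos mult_pos_pos zero_less_power)

lemma post_var_scaled:
  assumes "0 < \<sigma>" "pos_vec \<beta>" "1 \<le> n"
  shows "post_var \<sigma> \<beta> q k = \<sigma>\<^sup>2 / (real n * scaled_precision \<sigma> \<beta> n q $ k)"
    and "post_var \<sigma> \<beta> q k > 0"
proof -
  have b: "0 < \<beta>$k" and n: "0 < real n" using assms by auto
  have D: "0 < real (q$k) / \<sigma>\<^sup>2 + 1 / (\<beta>$k)\<^sup>2" using assms(1) b by (simp add: add_nonneg_pos)
  have "real n * scaled_precision \<sigma> \<beta> n q $ k = \<sigma>\<^sup>2 * (real (q$k) / \<sigma>\<^sup>2 + 1 / (\<beta>$k)\<^sup>2)"
    using assms(1) b n by (simp add: scaled_precision_def field_simps)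
  then show "post_var \<sigma> \<beta> q k = \<sigma>\<^sup>2 / (real n * scaled_precision \<sigma> \<beta> n q $ k)"
    using assms(1) by (simp add: post_var_def)
  show "post_var \<sigma> \<beta> q k > 0" using D by (simp add: post_var_def)
qed

lemma post_mean_scaled:
  assumes "0 < \<sigma>" "pos_vec \<beta>" "1 \<le> n" "0 < f"
  shows "post_mean \<sigma> \<alpha> \<beta> s q k = f * (1 / real n * scaled_mean \<sigma> f \<alpha> \<beta> n s q $ k)"
proof -
  have b: "0 < \<beta>$k" and n: "0 < real n" using assms by auto
  have D: "0 < real (q$k) / \<sigma>\<^sup>2 + 1 / (\<beta>$k)\<^sup>2" using assms(1) b by (simp add: add_nonneg_pos)
  have 1: "\<sigma>\<^sup>2 / ((\<beta>$k)\<^sup>2 * real n) + real (q$k) / real n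
      = \<sigma>\<^sup>2 / real n * (real (q$k) / \<sigma>\<^sup>2 + 1 / (\<beta>$k)\<^sup>2)"
    using assms(1) b n by (simp add: field_simps)
  have 2: "\<sigma>\<^sup>2 * \<alpha>$k / (f * (\<beta>$k)\<^sup>2) + s$k / f = \<sigma>\<^sup>2 / f * (\<alpha>$k / (\<beta>$k)\<^sup>2 + s$k / \<sigma>\<^sup>2)"
    using assms b by (simp add: field_simps)
  show ?thesis
    unfolding scaled_mean_def post_mean_def vec_lambda_beta 1 2 using assms D n by simp
qed

lemma integral_posterior_marginal:
  fixes \<phi> :: "real \<Rightarrow> real"
  assumes "\<And>k. post_var \<sigma> \<beta> q k > 0" and [measurable]: "\<phi> \<in> borel_measurable borel"
  shows "(\<integral>\<nu>. \<phi> (\<nu> k) \<partial>posterior \<sigma> \<alpha> \<beta> s q)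
    = (\<integral>x. \<phi> (post_mean \<sigma> \<alpha> \<beta> s q k + sqrt (post_var \<sigma> \<beta> q k) * x) \<partial>std_normal)"
proof -
  let ?N = "\<lambda>k. normal_law (post_mean \<sigma> \<alpha> \<beta> s q k) (sqrt (post_var \<sigma> \<beta> q k))"
  have P: "prob_space (?N k)" for k
    using assms(1) by (intro prob_space_normal_density) simp
  interpret product_prob_space ?N UNIV
    by (intro product_prob_spaceI P)
  have comp: "(\<lambda>\<nu>. \<nu> k) \<in> measurable (PiM UNIV ?N) (?N k)" by simp
  have "(\<integral>\<nu>. \<phi> (\<nu> k) \<partial>posterior \<sigma> \<alpha> \<beta> s q) = (\<integral>x. \<phi> x \<partial>distr (PiM UNIV ?N) (?N k) (\<lambda>\<nu>. \<nu> k))"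
    unfolding posterior_def by (rule integral_distr[symmetric, OF comp]) simp
  also have "distr (PiM UNIV ?N) (?N k) (\<lambda>\<nu>. \<nu> k) = ?N k"
    by (rule PiM_component) simp
  also have "(\<integral>x. \<phi> x \<partial>?N k) = (\<integral>x. \<phi> (post_mean \<sigma> \<alpha> \<beta> s q k + sqrt (post_var \<sigma> \<beta> q k) * x) \<partial>std_normal)"
    using assms by (intro integral_normal_law) auto
  finally show ?thesis .
qed

text \<open>
  Averaging the reward law over the posterior gives the predictive law: the variances of the
  posterior and of the reward add up.
\<close>

lemma integral_predictive:
  fixes \<phi> :: "real \<Rightarrow> real"
  assumes "0 < \<sigma>" "\<And>k. post_var \<sigma> \<beta> q k > 0" and [measurable]: "\<phi> \<in> borel_measurable borel"
    and int: "\<And>a c. integrable std_normal (\<lambda>x. \<phi> (a + c * x))"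
  shows "(\<integral>\<nu>. (\<integral>x. \<phi> x \<partial>normal_law (\<nu> k) \<sigma>) \<partial>posterior \<sigma> \<alpha> \<beta> s q)
    = (\<integral>x. \<phi> (post_mean \<sigma> \<alpha> \<beta> s q k + sqrt (post_var \<sigma> \<beta> q k + \<sigma>\<^sup>2) * x) \<partial>std_normal)"
proof -
  interpret prob_space std_normal by (rule prob_space_std_normal)
  let ?m = "post_mean \<sigma> \<alpha> \<beta> s q k" and ?v = "post_var \<sigma> \<beta> q k"
  have v: "0 < ?v" by (rule assms)
  have "(\<integral>\<nu>. (\<integral>x. \<phi> x \<partial>normal_law (\<nu> k) \<sigma>) \<partial>posterior \<sigma> \<alpha> \<beta> s q)
      = (\<integral>\<nu>. (\<lambda>z. \<integral>y. \<phi> (z + \<sigma> * y) \<partial>std_normal) (\<nu> k) \<partial>posterior \<sigma> \<alpha> \<beta> s q)"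
    using assms by (simp only: integral_normal_law)
  also have "\<dots> = (\<integral>x. (\<integral>y. \<phi> (?m + sqrt ?v * x + \<sigma> * y) \<partial>std_normal) \<partial>std_normal)"
  proof (rule integral_posterior_marginal[OF assms(2)])
    have [measurable_cong]: "sets std_normal = sets borel" by simp
    show "(\<lambda>z. \<integral>y. \<phi> (z + \<sigma> * y) \<partial>std_normal) \<in> borel_measurable borel"
      by measurable
  qed
  also have "\<dots> = (\<integral>x. (\<integral>y. (\<lambda>z. \<phi> (?m + z)) (sqrt ?v * x + \<sigma> * y) \<partial>std_normal) \<partial>std_normal)"
    by (simp add: add.assoc)
  also have "\<dots> = (\<integral>z. \<phi> (?m + sqrt ((sqrt ?v)\<^sup>2 + \<sigma>\<^sup>2) * z) \<partial>std_normal)"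
    by (rule integral_std_normal_sum) (use assms v int in \<open>auto simp: less_imp_le\<close>)
  finally show ?thesis using v by simp
qed

lemma scaled_precision_pull:
  assumes "1 \<le> n"
  shows "scaled_precision \<sigma> \<beta> n (q + axis k 1) = scaled_precision \<sigma> \<beta> n q + axis k (1 / real n)"
  by (simp add: scaled_precision_def vec_eq_iff axis_def add_divide_distrib)

text \<open>
  The reward shifts \<open>s\<^sub>k\<close> by its posterior mean plus predictive noise. In the updated posterior mean
  the deterministic part cancels, and the standard deviation of the noise becomes
  \<open>\<surd>n \<sigma>/f \<cdot> \<surd>(1/b\<^sub>k - 1/(b\<^sub>k + 1/n))\<close>.
\<close>

lemma scaled_mean_pull:
  fixes \<beta> :: "real^'k::finite" and q :: "nat^'k"
  assumes "0 < \<sigma>" "pos_vec \<beta>" "1 \<le> n" "0 < f"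
  defines "b \<equiv> scaled_precision \<sigma> \<beta> n q"
  shows "scaled_mean \<sigma> f \<alpha> \<beta> n
      (s + axis k (post_mean \<sigma> \<alpha> \<beta> s q k + sqrt (post_var \<sigma> \<beta> q k + \<sigma>\<^sup>2) * x)) (q + axis k 1)
    = scaled_mean \<sigma> f \<alpha> \<beta> n s q + axis k (step_sd (sqrt (real n) / f * \<sigma>) (b$k) (1 / real n) * x)"
proof -
  define h where "h = 1 / real n"
  have h: "0 < h" and n: "0 < real n" using assms(3) by (auto simp: h_def)
  define bk where "bk = b$k"
  have bk: "0 < bk" unfolding bk_def b_def using scaled_precision_pos[OF assms(1-3)] by simp
  define mk where "mk = scaled_mean \<sigma> f \<alpha> \<beta> n s q $ k"
  define A where "A = \<sigma>\<^sup>2 * \<alpha>$k / (f * (\<beta>$k)\<^sup>2) + s$k / f"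
  have A: "A = bk * mk"
    using bk unfolding mk_def bk_def b_def by (simp add: A_def scaled_mean_def scaled_precision_def)
  have sq: "sqrt (post_var \<sigma> \<beta> q k + \<sigma>\<^sup>2) / f / (bk + h)
      = step_sd (sqrt (real n) / f * \<sigma>) bk h"
  proof -
    have v: "post_var \<sigma> \<beta> q k + \<sigma>\<^sup>2 = \<sigma>\<^sup>2 * ((bk + h) / bk)"
      using post_var_scaled(1)[OF assms(1-3), of q k] bk n
      by (simp add: h_def bk_def b_def field_simps)
    have "1 / bk - 1 / (bk + h) = h * ((bk + h) / bk) / (bk + h)\<^sup>2"
    proof -
      have "1 / bk - 1 / (bk + h) = h / (bk * (bk + h))" using bk h by (simp add: field_simps)
      then show ?thesis using bk h by (simp add: power2_eq_square)
    qed
    then have "step_sd (sqrt (real n) / f * \<sigma>) bk h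
        = sqrt (real n) / f * \<sigma> * (sqrt h * sqrt ((bk + h) / bk) / (bk + h))"
      using bk h by (simp add: step_sd_def real_sqrt_mult real_sqrt_divide)
    also have "\<dots> = (sqrt (real n) * sqrt h) * (\<sigma> * sqrt ((bk + h) / bk) / f / (bk + h))"
      by (simp add: ac_simps)
    also have "sqrt (real n) * sqrt h = 1"
      using n by (simp add: h_def flip: real_sqrt_mult)
    finally have "step_sd (sqrt (real n) / f * \<sigma>) bk h = \<sigma> * sqrt ((bk + h) / bk) / f / (bk + h)"
      by simp
    moreover have "sqrt (\<sigma>\<^sup>2 * ((bk + h) / bk)) = \<sigma> * sqrt ((bk + h) / bk)"
      unfolding real_sqrt_mult using assms(1) by simp
    ultimately show ?thesis unfolding v by (simp only:)
  qed
  define X where "X = post_mean \<sigma> \<alpha> \<beta> s q k + sqrt (post_var \<sigma> \<beta> q k + \<sigma>\<^sup>2) * x"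
  have X: "X / f = h * mk + sqrt (post_var \<sigma> \<beta> q k + \<sigma>\<^sup>2) / f * x"
    unfolding X_def using assms(4) post_mean_scaled[OF assms(1-4), of \<alpha> s q k]
    by (simp add: h_def mk_def add_divide_distrib)
  have "(A + X / f) / (bk + h) = ((bk + h) * mk + sqrt (post_var \<sigma> \<beta> q k + \<sigma>\<^sup>2) / f * x) / (bk + h)"
    by (simp add: A X algebra_simps)
  also have "\<dots> = mk + sqrt (post_var \<sigma> \<beta> q k + \<sigma>\<^sup>2) / f / (bk + h) * x"
    using bk h by (simp add: add_divide_distrib)
  finally have key: "(A + X / f) / (bk + h) = mk + step_sd (sqrt (real n) / f * \<sigma>) bk h * x"
    unfolding sq .
  have "scaled_mean \<sigma> f \<alpha> \<beta> n (s + axis k X) (q + axis k 1) $ k = (A + X / f) / (bk + h)"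
    by (simp add: scaled_mean_def A_def bk_def b_def scaled_precision_def h_def axis_def add_divide_distrib algebra_simps)
  moreover have "scaled_mean \<sigma> f \<alpha> \<beta> n (s + axis k X) (q + axis k 1) $ j = scaled_mean \<sigma> f \<alpha> \<beta> n s q $ j" if "j \<noteq> k" for j
    using that by (simp add: scaled_mean_def axis_def)
  ultimately show ?thesis
    unfolding X_def[symmetric] using key
    by (auto simp: vec_eq_iff axis_def mk_def bk_def h_def)
qed

text \<open>
  The bandit with horizon \<open>n\<close> is the problem with equidistant switching times: \<open>n + 1 - i\<close> pulls of
  duration \<open>1/n\<close> are left at round \<open>i\<close>.
\<close>

lemma opt_reward_eq_sched_value:
  fixes \<beta> :: "real^'k::finite"
  assumes "0 < \<sigma>" "pos_vec \<beta>" "1 \<le> n" "0 < f"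
  shows "opt_reward \<sigma> \<alpha> \<beta> n i s q
    = f * sched_value (sqrt (real n) / f * \<sigma>) (replicate (n + 1 - i) (1 / real n))
        (scaled_mean \<sigma> f \<alpha> \<beta> n s q) (scaled_precision \<sigma> \<beta> n q)"
proof (induction "n + 1 - i" arbitrary: i s q)
  case 0
  then show ?case by (simp add: opt_reward.simps)
next
  case (Suc j)
  have i: "i \<le> n" "j = n + 1 - (i + 1)" using Suc.hyps(2) by auto
  define h where "h = 1 / real n"
  define sh where "sh = sqrt (real n) / f * \<sigma>"
  define b where "b = scaled_precision \<sigma> \<beta> n q"
  define m where "m = scaled_mean \<sigma> f \<alpha> \<beta> n s q"
  have v: "post_var \<sigma> \<beta> q k > 0" for k by (rule post_var_scaled(2)[OF assms(1-3)])
  have "(\<integral>\<nu>. \<nu> k \<partial>posterior \<sigma> \<alpha> \<beta> s q)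
        + (\<integral>\<nu>. (\<integral>x. opt_reward \<sigma> \<alpha> \<beta> n (i + 1) (s + axis k x) (q + axis k 1)
                   \<partial>normal_law (\<nu> k) \<sigma>) \<partial>posterior \<sigma> \<alpha> \<beta> s q)
      = f * pull sh h k (sched_value sh (replicate j h)) m b" for k
  proof -
    let ?pm = "post_mean \<sigma> \<alpha> \<beta> s q k" and ?ps = "sqrt (post_var \<sigma> \<beta> q k + \<sigma>\<^sup>2)"
    have mean: "(\<integral>\<nu>. \<nu> k \<partial>posterior \<sigma> \<alpha> \<beta> s q) = f * (h * m$k)"
      using integral_posterior_marginal[OF v, where \<phi> = "\<lambda>x. x" and k = k and \<alpha> = \<alpha> and s = s] post_mean_scaled[OF assms, of \<alpha> s q k]
      by (simp add: h_def m_def)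
    define \<phi> where "\<phi> x = f * sched_value sh (replicate j h)
        (scaled_mean \<sigma> f \<alpha> \<beta> n (s + axis k x) (q + axis k 1)) (b + axis k h)" for x
    have \<phi>: "opt_reward \<sigma> \<alpha> \<beta> n (i + 1) (s + axis k x) (q + axis k 1) = \<phi> x" for x
      using Suc.hyps(1)[OF i(2), of "s + axis k x" "q + axis k 1"]
      unfolding \<phi>_def sh_def h_def b_def i(2) scaled_precision_pull[OF assms(3)] .
    have ps: "0 < ?ps" using v[of k] by (simp add: add_pos_nonneg)
    have pull_x: "\<phi> (?pm + ?ps * x)
        = f * sched_value sh (replicate j h) (m + axis k (step_sd sh (b$k) h * x)) (b + axis k h)" for x
      unfolding \<phi>_def scaled_mean_pull[OF assms] sh_def h_def b_def m_def ..
    \<comment> \<open>every affine argument can be written as a predictive reward \<open>?pm + ?ps * _\<close>, so Lipschitz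
        continuity in \<open>m\<close> applies\<close>
    have \<phi>_int: "integrable std_normal (\<lambda>x. \<phi> (a + c * x))" for a c
    proof -
      have "\<phi> (a + c * x) = f * sched_value sh (replicate j h)
          (m + axis k (step_sd sh (b$k) h * ((a - ?pm) / ?ps)) + axis k (step_sd sh (b$k) h * (c / ?ps) * x)) (b + axis k h)" for x
      proof -
        have "a + c * x = ?pm + ?ps * ((a - ?pm) / ?ps + c / ?ps * x)"
          using ps by (simp add: distrib_left)
        then have "\<phi> (a + c * x) = f * sched_value sh (replicate j h)
            (m + axis k (step_sd sh (b$k) h * ((a - ?pm) / ?ps + c / ?ps * x))) (b + axis k h)"
          by (simp only: pull_x)
        also have "m + axis k (step_sd sh (b$k) h * ((a - ?pm) / ?ps + c / ?ps * x))
            = m + axis k (step_sd sh (b$k) h * ((a - ?pm) / ?ps)) + axis k (step_sd sh (b$k) h * (c / ?ps) * x)"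
          by (simp add: vec_eq_iff axis_def algebra_simps)
        finally show ?thesis .
      qed
      then show ?thesis
        by (simp only:) (intro integrable_mult_right integrable_sched_value, simp add: h_def)
    qed
    have \<phi>_meas: "\<phi> \<in> borel_measurable borel"
      using borel_measurable_integrable[OF \<phi>_int[of 0 1]] by simp
    show ?thesis
      unfolding \<phi> mean integral_predictive[OF assms(1) v \<phi>_meas \<phi>_int] pull_x pull_def
      by (simp add: distrib_left)
  qed
  then have "opt_reward \<sigma> \<alpha> \<beta> n i s q = (MAX k. f * pull sh h k (sched_value sh (replicate j h)) m b)"
    using i by (subst opt_reward.simps) simp
  also have "\<dots> = f * (MAX k. pull sh h k (sched_value sh (replicate j h)) m b)"
    using mono_Max_commute[of "\<lambda>x. f * x" "range (\<lambda>k. pull sh h k (sched_value sh (replicate j h)) m b)"] assms(4)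
    by (simp add: mono_def image_image)
  finally show ?case
    unfolding Suc.hyps(2)[symmetric] replicate_Suc sched_value.simps
    by (simp add: sh_def h_def b_def m_def)
qed

section \<open>Second-order expansions\<close>

text \<open>
  The mean value theorem along the ray towards \<open>x + d\<close>, with differentiability of the gradient at
  \<open>x\<close>, gives the expansion with the diagonal values \<open>H d \<bullet> d\<close> of the derivative of the gradient.
\<close>

lemma second_order_taylor:
  fixes \<phi> :: "'a::euclidean_space \<Rightarrow> real"
  assumes S: "open S" "x \<in> S"
    and g: "\<And>y. y \<in> S \<Longrightarrow> (\<phi> has_derivative (\<lambda>h. g y \<bullet> h)) (at y)"
    and H: "(g has_derivative H) (at x)" and "0 < \<epsilon>"
  obtains r where "0 < r"
    "\<And>d. norm d < r \<Longrightarrow> \<bar>\<phi> (x + d) - \<phi> x - g x \<bullet> d - H d \<bullet> d / 2\<bar> \<le> \<epsilon> * (norm d)\<^sup>2"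
proof -
  obtain r1 where r1: "0 < r1" "ball x r1 \<subseteq> S" using S openE by blast
  obtain r2 where r2: "0 < r2"
    "\<And>y. norm (y - x) < r2 \<Longrightarrow> norm (g y - g x - H (y - x)) \<le> \<epsilon> * norm (y - x)"
    using H \<open>0 < \<epsilon>\<close> unfolding has_derivative_at_alt by blast
  interpret H: bounded_linear H using H by (rule has_derivative_bounded_linear)
  show thesis
  proof
    show "0 < min r1 r2" using r1 r2 by simp
    fix d :: 'a assume d: "norm d < min r1 r2"
    define \<psi> where "\<psi> l = \<phi> (x + l *\<^sub>R d) - \<phi> x - l * (g x \<bullet> d) - l\<^sup>2 * (H d \<bullet> d) / 2" for l
    have D: "(\<psi> has_real_derivative (g (x + l *\<^sub>R d) - g x - H (l *\<^sub>R d)) \<bullet> d) (at l)"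
      if "0 \<le> l" "l \<le> 1" for l
    proof -
      have "norm (l *\<^sub>R d) \<le> norm d" using that by (simp add: mult_left_le_one_le)
      then have "x + l *\<^sub>R d \<in> S" using r1 d by (auto simp: dist_norm subset_iff)
      note \<phi> = g[OF this]
      have "((\<lambda>l. \<phi> (x + l *\<^sub>R d)) has_derivative (\<lambda>h. g (x + l *\<^sub>R d) \<bullet> (h *\<^sub>R d))) (at l)"
        by (rule has_derivative_compose[where f = "\<lambda>l. x + l *\<^sub>R d", OF _ \<phi>])
          (auto intro!: derivative_eq_intros)
      then have "((\<lambda>l. \<phi> (x + l *\<^sub>R d)) has_real_derivative g (x + l *\<^sub>R d) \<bullet> d) (at l)"
        by (rule has_derivative_imp_has_field_derivative) (simp add: mult.commute)
      then show ?thesis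
        unfolding \<psi>_def by (auto intro!: derivative_eq_intros simp: inner_diff_left H.scaleR)
    qed
    obtain l where l: "0 < l" "l < 1" "\<psi> 1 - \<psi> 0 = (1 - 0) * ((g (x + l *\<^sub>R d) - g x - H (l *\<^sub>R d)) \<bullet> d)"
      using MVT2[of 0 1 \<psi> "\<lambda>l. (g (x + l *\<^sub>R d) - g x - H (l *\<^sub>R d)) \<bullet> d"] D by auto
    have ld: "norm (l *\<^sub>R d) \<le> norm d" using l by (simp add: mult_left_le_one_le)
    have "\<bar>\<psi> 1\<bar> = \<bar>(g (x + l *\<^sub>R d) - g x - H (l *\<^sub>R d)) \<bullet> d\<bar>"
      using l(3) by (simp add: \<psi>_def)
    also have "\<dots> \<le> norm (g (x + l *\<^sub>R d) - g x - H (l *\<^sub>R d)) * norm d"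
      by (rule Cauchy_Schwarz_ineq2)
    also have "\<dots> \<le> (\<epsilon> * norm (l *\<^sub>R d)) * norm d"
      using r2(2)[of "x + l *\<^sub>R d"] ld d by (intro mult_right_mono) auto
    also have "\<dots> \<le> (\<epsilon> * norm d) * norm d"
      using ld \<open>0 < \<epsilon>\<close> by (intro mult_right_mono mult_left_mono) auto
    finally show "\<bar>\<phi> (x + d) - \<phi> x - g x \<bullet> d - H d \<bullet> d / 2\<bar> \<le> \<epsilon> * (norm d)\<^sup>2"
      by (simp add: \<psi>_def power2_eq_square mult.assoc)
  qed
qed

definition cmult :: "real^'k \<Rightarrow> real^'k \<Rightarrow> real^'k::finite" where
  "cmult x y = (\<chi> k. x$k * y$k)"

lemma norm_cmult: "norm (cmult x y) \<le> norm x * norm y"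
proof -
  have "(norm (cmult x y))\<^sup>2 = (\<Sum>k\<in>UNIV. (x$k)\<^sup>2 * (y$k)\<^sup>2)"
    by (simp add: cmult_def norm_vec_def L2_set_def sum_nonneg power_mult_distrib)
  also have "\<dots> \<le> (\<Sum>k\<in>UNIV. (norm x)\<^sup>2 * (y$k)\<^sup>2)"
  proof (intro sum_mono mult_right_mono)
    fix k show "(x$k)\<^sup>2 \<le> (norm x)\<^sup>2"
      using power_mono[OF component_le_norm_cart[of x k], of 2] by simp
  qed simp
  also have "\<dots> = (norm x * norm y)\<^sup>2"
    by (simp add: power_mult_distrib sum_distrib_left[symmetric] norm_vec_def[of y] L2_set_def sum_nonneg)
  finally show ?thesis by (rule power2_le_imp_le) simp
qed

lemma inner_cmult: "x \<bullet> cmult y z = cmult y x \<bullet> z"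
  by (simp add: cmult_def inner_vec_def ac_simps)

text \<open>
  Displacement of \<open>(t, s, q)\<close> when time advances by \<open>u\<close>, the posterior means by \<open>dm\<close> and the pull
  counts by \<open>dq\<close>: since \<open>s\<^sub>k\<close> is \<open>b\<^sub>k m\<^sub>k\<close> up to a constant, it changes by
  \<open>b\<^sub>k dm\<^sub>k + m\<^sub>k dq\<^sub>k + dq\<^sub>k dm\<^sub>k\<close>.
\<close>

definition displacement :: "real^'k \<Rightarrow> real^'k \<Rightarrow> real \<Rightarrow> real^'k \<Rightarrow> real^'k \<Rightarrow> 'k::finite point" where
  "displacement b m u dm dq = (u, cmult b dm + cmult m dq + cmult dq dm, dq)"

lemma norm_prod_le: "norm (x, y) \<le> norm x + norm y"
  by (simp add: norm_Pair sqrt_sum_squares_le_sum)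

lemma norm_le_sum_nonneg:
  fixes dq :: "real^'k::finite"
  assumes "\<forall>k. 0 \<le> dq$k"
  shows "norm dq \<le> (\<Sum>k\<in>UNIV. dq$k)"
  using norm_le_l1_cart[of dq] assms by simp

text \<open>
  Along a trajectory \<open>dq\<close> is nonnegative with sum \<open>u\<close>, so time and pull counts are of order \<open>u\<close> and
  only the second-order terms in \<open>dm\<close> have to be kept: mixed terms \<open>u \<cdot> dm\<close> split into \<open>\<epsilon> dm\<^sup>2\<close> and
  \<open>C u\<^sup>2\<close>. For small \<open>dm\<close> the bound is the Taylor expansion. For \<open>dm\<close> bounded away from \<open>0\<close> the quartic
  term dominates the quadratic growth of both sides, so the bound holds for all \<open>dm\<close> and can be
  integrated against a Gaussian law.
\<close>

lemma parabolic_jet: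
  fixes v :: "'k::finite point \<Rightarrow> real" and b m :: "real^'k"
  assumes taylor: "\<And>e. 0 < e \<Longrightarrow> \<exists>r>0. \<forall>d. norm d < r \<longrightarrow>
      v (x + d) \<le> v x + (a, gs, gq) \<bullet> d + H d \<bullet> d / 2 + e * (norm d)\<^sup>2"
    and H: "bounded_linear H" and "0 < \<epsilon>" "0 < u0"
    and growth: "\<And>u dm dq. 0 \<le> u \<Longrightarrow> u \<le> u0 \<Longrightarrow> \<forall>k. 0 \<le> dq$k \<Longrightarrow> (\<Sum>k\<in>UNIV. dq$k) = u \<Longrightarrow>
      v (x + displacement b m u dm dq) \<le> K * (1 + (norm dm)\<^sup>2)"
  shows "\<exists>C \<rho>. 0 < C \<and> 0 < \<rho> \<and> \<rho> \<le> u0 \<and>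
    (\<forall>u dm dq. 0 \<le> u \<longrightarrow> u \<le> \<rho> \<longrightarrow> (\<forall>k. 0 \<le> dq$k) \<longrightarrow> (\<Sum>k\<in>UNIV. dq$k) = u \<longrightarrow>
      v (x + displacement b m u dm dq) \<le> v x + a * u + (gq + cmult m gs) \<bullet> dq + cmult b gs \<bullet> dm
        + (H (0, cmult b dm, 0) \<bullet> (0, cmult b dm, 0) / 2 + \<epsilon> * (norm dm)\<^sup>2) + C * u\<^sup>2 + C * norm dm ^ 4)"
proof -
  interpret H: bounded_linear H by (rule H)
  obtain B where B: "0 \<le> B" "\<And>d. norm (H d) \<le> norm d * B"
    using H.nonneg_bounded by blast
  have HB: "\<bar>H y \<bullet> z\<bar> \<le> B * norm y * norm z" for y z
    using order_trans[OF Cauchy_Schwarz_ineq2 mult_right_mono[OF B(2)[of y], of "norm z"]]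
    by (simp add: mult.commute)
  \<comment> \<open>precision of the Taylor expansion for which its remainder contributes at most \<open>\<epsilon>/2 \<cdot> dm\<^sup>2\<close>\<close>
  define e where "e = \<epsilon> / (4 * ((norm b)\<^sup>2 + 1))"
  have e: "0 < e" "e * (2 * (norm b)\<^sup>2) \<le> \<epsilon> / 2"
  proof -
    show "0 < e" using \<open>0 < \<epsilon>\<close> by (simp add: e_def add_nonneg_pos)
    have "e * (2 * (norm b)\<^sup>2) \<le> e * (2 * ((norm b)\<^sup>2 + 1))"
      using \<open>0 < e\<close> by (intro mult_left_mono) auto
    also have "\<dots> = \<epsilon> / 2"
      using add_nonneg_pos[of "(norm b)\<^sup>2" 1] by (simp add: e_def field_simps)
    finally show "e * (2 * (norm b)\<^sup>2) \<le> \<epsilon> / 2" .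
  qed
  obtain r where r: "0 < r" "\<And>d. norm d < r \<Longrightarrow>
      v (x + d) \<le> v x + (a, gs, gq) \<bullet> d + H d \<bullet> d / 2 + e * (norm d)\<^sup>2"
    using taylor[OF e(1)] by blast
  define Kz where "Kz = 3 + norm m"
  define M1 where "M1 = norm gs + B * norm b * Kz"
  define C1 where "C1 = 2 * M1\<^sup>2 / \<epsilon> + (B / 2 + 2 * e) * Kz\<^sup>2"
  define \<rho> where "\<rho> = min (min 1 u0) (r / (norm b + Kz + 1))"
  have nonneg: "0 \<le> Kz" "0 \<le> M1" "0 \<le> C1"
    using B(1) e(1) \<open>0 < \<epsilon>\<close> by (simp_all add: Kz_def M1_def C1_def)
  have den: "0 < norm b + Kz + 1" using nonneg by (simp add: add_nonneg_pos)
  have \<rho>: "0 < \<rho>" "\<rho> \<le> u0" "\<rho> \<le> 1" "\<rho> \<le> r / (norm b + Kz + 1)"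
    using r(1) \<open>0 < u0\<close> den by (simp_all add: \<rho>_def)
  then have \<rho>r: "\<rho> * (norm b + Kz + 1) \<le> r" using den by (simp add: le_divide_eq)
  define M2 where "M2 = \<bar>v x\<bar> + \<bar>a\<bar> + norm (gq + cmult m gs) + norm (cmult b gs) + B * (norm b)\<^sup>2 / 2"
  have M2: "0 \<le> M2" using B(1) by (simp add: M2_def)
  define C2 where "C2 = (\<bar>K\<bar> + M2) * (1 / \<rho> ^ 4 + 1 / \<rho>\<^sup>2)"
  have C2: "0 \<le> C2" using M2 \<rho> by (simp add: C2_def)
  define C where "C = C1 + C2 + 1"
  show ?thesis
  proof (rule exI[of _ C], rule exI[of _ \<rho>], intro conjI allI impI)
    show "0 < C" using nonneg C2 by (simp add: C_def)
    show "0 < \<rho>" "\<rho> \<le> u0" by (fact \<rho>)+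
    fix u :: real and dm dq :: "real^'k"
    assume u: "0 \<le> u" "u \<le> \<rho>" and dq: "\<forall>k. 0 \<le> dq$k" "(\<Sum>k\<in>UNIV. dq$k) = u"
    have ndq: "norm dq \<le> u" using norm_le_sum_nonneg[OF dq(1)] dq(2) by simp
    let ?e = "(0, cmult b dm, 0) :: 'k point"
    let ?z = "(u, cmult m dq + cmult dq dm, dq)"
    let ?L = "a * u + (gq + cmult m gs) \<bullet> dq + cmult b gs \<bullet> dm"
    have ne: "norm ?e \<le> norm b * norm dm" using norm_cmult[of b dm] by (simp add: norm_Pair)
    have d: "displacement b m u dm dq = ?e + ?z" by (simp add: displacement_def algebra_simps)
    show "v (x + displacement b m u dm dq) \<le> v x + a * u + (gq + cmult m gs) \<bullet> dq + cmult b gs \<bullet> dm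
        + (H ?e \<bullet> ?e / 2 + \<epsilon> * (norm dm)\<^sup>2) + C * u\<^sup>2 + C * norm dm ^ 4"
    proof (cases "norm dm < \<rho>")
      case True
      have n1: "norm dm \<le> 1" using True \<rho> by simp
      have nz: "norm ?z \<le> Kz * u"
      proof -
        have "norm ?z \<le> norm u + norm (cmult m dq + cmult dq dm) + norm dq"
          using norm_prod_le[of u "(cmult m dq + cmult dq dm, dq)"]
            norm_prod_le[of "cmult m dq + cmult dq dm" dq] by simp
        also have "\<dots> \<le> u + (norm m * norm dq + norm dq * norm dm) + norm dq"
          using u norm_cmult[of m dq] norm_cmult[of dq dm]
            norm_triangle_ineq[of "cmult m dq" "cmult dq dm"] by simp
        also have "\<dots> \<le> u + (norm m * u + u * 1) + u"
          using ndq n1 u by (intro add_mono mult_mono) auto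
        finally show ?thesis by (simp add: Kz_def algebra_simps)
      qed
      have "norm (?e + ?z) \<le> norm b * norm dm + Kz * u"
        using norm_triangle_ineq[of ?e ?z] ne nz by linarith
      also have "\<dots> \<le> norm b * \<rho> + Kz * \<rho>"
        using True u nonneg by (intro add_mono mult_left_mono) auto
      also have "\<dots> < r" using \<rho>r \<rho>(1) by (simp add: algebra_simps)
      finally have main: "v (x + displacement b m u dm dq)
        \<le> v x + (a, gs, gq) \<bullet> (?e + ?z) + H (?e + ?z) \<bullet> (?e + ?z) / 2 + e * (norm (?e + ?z))\<^sup>2"
        unfolding d by (rule r(2))
      have ud: "norm dq * norm dm \<le> u * norm dm" using ndq by (intro mult_right_mono) auto
      have "gs \<bullet> cmult dq dm \<le> norm gs * norm (cmult dq dm)" by (rule norm_cauchy_schwarz)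
      also have "\<dots> \<le> norm gs * (u * norm dm)"
        using norm_cmult[of dq dm] ud by (intro mult_left_mono) auto
      finally have lin: "(a, gs, gq) \<bullet> (?e + ?z) \<le> ?L + norm gs * (u * norm dm)"
        by (simp add: inner_add_left inner_add_right inner_cmult[of gs])
      have nez: "norm ?e * norm ?z \<le> (norm b * norm dm) * (Kz * u)"
        using ne nz nonneg u by (intro mult_mono) auto
      have nzz: "norm ?z * norm ?z \<le> (Kz * u) * (Kz * u)" using nz nonneg u by (intro mult_mono) auto
      have "H (?e + ?z) \<bullet> (?e + ?z) = H ?e \<bullet> ?e + H ?e \<bullet> ?z + H ?z \<bullet> ?e + H ?z \<bullet> ?z"
        by (simp only: H.add inner_add_left inner_add_right add.assoc)
      also have "\<dots> \<le> H ?e \<bullet> ?e + B * (norm ?e * norm ?z) + B * (norm ?e * norm ?z) + B * (norm ?z * norm ?z)"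
        using HB[of ?e ?z] HB[of ?z ?e] HB[of ?z ?z]
        by (intro add_mono) (auto simp: abs_le_iff mult.assoc mult.commute mult.left_commute)
      also have "\<dots> \<le> H ?e \<bullet> ?e + B * ((norm b * norm dm) * (Kz * u))
          + B * ((norm b * norm dm) * (Kz * u)) + B * ((Kz * u) * (Kz * u))"
        using B(1) nez nzz by (intro add_mono mult_left_mono order_refl)
      finally have quad: "H (?e + ?z) \<bullet> (?e + ?z) / 2
          \<le> H ?e \<bullet> ?e / 2 + B * norm b * Kz * (u * norm dm) + B / 2 * Kz\<^sup>2 * u\<^sup>2"
        by (simp add: power2_eq_square algebra_simps)
      have "(norm (?e + ?z))\<^sup>2 \<le> (norm ?e + norm ?z)\<^sup>2"
        by (intro power_mono norm_triangle_ineq) auto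
      also have "\<dots> \<le> 2 * (norm ?e)\<^sup>2 + 2 * (norm ?z)\<^sup>2"
        using zero_le_power2[of "norm ?e - norm ?z"] by (simp add: power2_eq_square algebra_simps)
      also have "\<dots> \<le> 2 * (norm b * norm dm)\<^sup>2 + 2 * (Kz * u)\<^sup>2"
        using ne nz by (intro add_mono mult_left_mono power_mono) auto
      finally have "e * (norm (?e + ?z))\<^sup>2 \<le> e * (2 * (norm b * norm dm)\<^sup>2 + 2 * (Kz * u)\<^sup>2)"
        using e(1) by (intro mult_left_mono) auto
      also have "\<dots> = e * (2 * (norm b)\<^sup>2) * (norm dm)\<^sup>2 + 2 * e * Kz\<^sup>2 * u\<^sup>2"
        by (simp add: power_mult_distrib algebra_simps)
      also have "\<dots> \<le> \<epsilon> / 2 * (norm dm)\<^sup>2 + 2 * e * Kz\<^sup>2 * u\<^sup>2"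
        using e(2) by (intro add_right_mono mult_right_mono) auto
      finally have sq: "e * (norm (?e + ?z))\<^sup>2 \<le> \<epsilon> / 2 * (norm dm)\<^sup>2 + 2 * e * Kz\<^sup>2 * u\<^sup>2" .
      have cross: "M1 * (u * norm dm) \<le> \<epsilon> / 2 * (norm dm)\<^sup>2 + 2 * M1\<^sup>2 / \<epsilon> * u\<^sup>2"
      proof -
        have "0 \<le> (\<epsilon> * norm dm - 2 * M1 * u)\<^sup>2 + 2 * \<epsilon> * (M1 * (u * norm dm))"
          using \<open>0 < \<epsilon>\<close> nonneg u by (intro add_nonneg_nonneg) auto
        then have "2 * \<epsilon> * (M1 * (u * norm dm)) \<le> \<epsilon>\<^sup>2 * (norm dm)\<^sup>2 + 4 * M1\<^sup>2 * u\<^sup>2"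
          by (simp add: power2_eq_square algebra_simps)
        then have "(2 * \<epsilon> * (M1 * (u * norm dm))) / (2 * \<epsilon>)
            \<le> (\<epsilon>\<^sup>2 * (norm dm)\<^sup>2 + 4 * M1\<^sup>2 * u\<^sup>2) / (2 * \<epsilon>)"
          using \<open>0 < \<epsilon>\<close> by (intro divide_right_mono) auto
        then show ?thesis using \<open>0 < \<epsilon>\<close> by (simp add: field_simps power2_eq_square)
      qed
      have "v (x + displacement b m u dm dq) \<le> v x + ?L + H ?e \<bullet> ?e / 2 + \<epsilon> * (norm dm)\<^sup>2 + C1 * u\<^sup>2"
        using main lin quad sq cross by (simp add: M1_def C1_def algebra_simps)
      moreover have "C1 * u\<^sup>2 \<le> C * u\<^sup>2" using C2 by (intro mult_right_mono) (auto simp: C_def)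
      moreover have "0 \<le> C * norm dm ^ 4" using \<open>0 < C\<close> by simp
      ultimately show ?thesis by linarith
    next
      case False
      define N where "N = norm dm"
      have N: "\<rho> \<le> N" "0 < N" using False \<rho>(1) by (auto simp: N_def)
      have pN: "1 \<le> N ^ 4 / \<rho> ^ 4" "N\<^sup>2 \<le> N ^ 4 / \<rho>\<^sup>2"
      proof -
        show "1 \<le> N ^ 4 / \<rho> ^ 4" using power_mono[OF N(1), of 4] \<rho>(1) by simp
        have "\<rho>\<^sup>2 * N\<^sup>2 \<le> N\<^sup>2 * N\<^sup>2" using power_mono[OF N(1), of 2] \<rho>(1) by (intro mult_right_mono) auto
        then show "N\<^sup>2 \<le> N ^ 4 / \<rho>\<^sup>2" using \<rho>(1) by (simp add: le_divide_eq mult.commute power_add[symmetric])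
      qed
      have "(\<bar>K\<bar> + M2) * (1 + N\<^sup>2) \<le> (\<bar>K\<bar> + M2) * (N ^ 4 / \<rho> ^ 4 + N ^ 4 / \<rho>\<^sup>2)"
        using M2 pN by (intro mult_left_mono add_mono) auto
      also have "\<dots> = C2 * N ^ 4" by (simp add: C2_def algebra_simps)
      finally have far: "(\<bar>K\<bar> + M2) * (1 + N\<^sup>2) \<le> C2 * N ^ 4" .
      have N1: "N \<le> 1 + N\<^sup>2" using abs_le_eta_square[of 1 N] N by simp
      have u1: "u \<le> 1 + N\<^sup>2" using u \<rho> zero_le_power2[of N] by linarith
      have "v (x + displacement b m u dm dq) \<le> K * (1 + N\<^sup>2)"
        unfolding N_def using growth[of u dq dm] u \<rho> dq by simp
      also have "\<dots> \<le> \<bar>K\<bar> * (1 + N\<^sup>2)" by (intro mult_right_mono) auto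
      finally have up: "v (x + displacement b m u dm dq) \<le> \<bar>K\<bar> * (1 + N\<^sup>2)" .
      have l1: "\<bar>a * u\<bar> \<le> \<bar>a\<bar> * (1 + N\<^sup>2)"
        unfolding abs_mult using u u1 by (intro mult_left_mono) simp_all
      have l2: "\<bar>(gq + cmult m gs) \<bullet> dq\<bar> \<le> norm (gq + cmult m gs) * (1 + N\<^sup>2)"
        by (rule order_trans[OF Cauchy_Schwarz_ineq2 mult_left_mono]) (use ndq u1 in simp_all)
      have l3: "\<bar>cmult b gs \<bullet> dm\<bar> \<le> norm (cmult b gs) * (1 + N\<^sup>2)"
        by (rule order_trans[OF Cauchy_Schwarz_ineq2 mult_left_mono]) (use N1 in \<open>auto simp: N_def\<close>)
      have "\<bar>H ?e \<bullet> ?e\<bar> \<le> B * (norm ?e * norm ?e)" using HB[of ?e ?e] by (simp add: mult.assoc)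
      also have "\<dots> \<le> B * ((norm b * N) * (norm b * N))"
        unfolding N_def using B(1) ne by (intro mult_left_mono mult_mono) auto
      also have "\<dots> = B * (norm b)\<^sup>2 * N\<^sup>2" by (simp add: power2_eq_square)
      also have "\<dots> \<le> B * (norm b)\<^sup>2 * (1 + N\<^sup>2)" using B(1) by (intro mult_left_mono) auto
      finally have l4: "\<bar>H ?e \<bullet> ?e\<bar> \<le> B * (norm b)\<^sup>2 * (1 + N\<^sup>2)" .
      have l5: "\<bar>v x\<bar> \<le> \<bar>v x\<bar> * (1 + N\<^sup>2)" by (simp add: distrib_left)
      have "M2 * (1 + N\<^sup>2) = \<bar>v x\<bar> * (1 + N\<^sup>2) + \<bar>a\<bar> * (1 + N\<^sup>2) + norm (gq + cmult m gs) * (1 + N\<^sup>2)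
          + norm (cmult b gs) * (1 + N\<^sup>2) + B * (norm b)\<^sup>2 * (1 + N\<^sup>2) / 2"
        by (simp add: M2_def algebra_simps)
      then have low: "- (M2 * (1 + N\<^sup>2)) \<le> v x + a * u + (gq + cmult m gs) \<bullet> dq + cmult b gs \<bullet> dm + H ?e \<bullet> ?e / 2"
        using l1 l2 l3 l4 l5 by (simp only: abs_le_iff) linarith
      have "C2 * N ^ 4 \<le> C * N ^ 4" using nonneg by (intro mult_right_mono) (auto simp: C_def)
      moreover have "0 \<le> C * u\<^sup>2" "0 \<le> \<epsilon> * (norm dm)\<^sup>2" using \<open>0 < C\<close> \<open>0 < \<epsilon>\<close> by auto
      ultimately show ?thesis
        using up low far unfolding N_def[symmetric] distrib_right[of "\<bar>K\<bar>"] by linarith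
    qed
  qed
qed

section \<open>Dynamic programming at a contact point\<close>

lemma norm_power2_axis:
  "(norm (dm + axis k y))\<^sup>2 = (norm dm)\<^sup>2 + 2 * dm$k * y + y\<^sup>2"
  unfolding power2_norm_eq_inner
  by (simp add: inner_add_left inner_add_right inner_axis inner_axis' inner_commute power2_eq_square algebra_simps)

lemma norm_power4_axis:
  "norm (dm + axis k y) ^ 4 = norm dm ^ 4 + 4 * (norm dm)\<^sup>2 * dm$k * y
    + (4 * (dm$k)\<^sup>2 + 2 * (norm dm)\<^sup>2) * y\<^sup>2 + 4 * dm$k * y ^ 3 + y ^ 4"
proof -
  have "norm (dm + axis k y) ^ 4 = ((norm dm)\<^sup>2 + 2 * dm$k * y + y\<^sup>2)\<^sup>2"
    by (simp add: norm_power2_axis[symmetric] power_mult[symmetric])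
  also have "\<dots> = ((norm dm)\<^sup>2)\<^sup>2 + 4 * (norm dm)\<^sup>2 * dm$k * y
    + (4 * (dm$k)\<^sup>2 + 2 * (norm dm)\<^sup>2) * y\<^sup>2 + 4 * dm$k * y ^ 3 + y ^ 4"
    by (simp add: power2_eq_square power3_eq_cube power4_eq_xxxx algebra_simps)
  finally show ?thesis by (simp add: power_mult[symmetric])
qed

lemma step_sd_square_quotient:
  "0 < b \<Longrightarrow> 0 \<le> h \<Longrightarrow> (step_sd \<sigma> b h)\<^sup>2 = h * (\<sigma>\<^sup>2 / (b * (b + h)))"
  by (subst step_sd_square) (auto simp: field_simps)

text \<open>
  Here \<open>B\<close> is quadratic with diagonal entries \<open>Bd k\<close>, and \<open>a + r\<^sub>k + m\<^sub>k + \<sigma>\<^sup>2/b\<^sub>k\<^sup>2 \<cdot> Bd k\<close> is the rate at which the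
  polynomial bound plus the reward changes in expectation while arm \<open>k\<close> is pulled at the contact
  point. If all rates were at most \<open>-\<theta>\<close>, then for every schedule of total duration \<open>\<delta>\<close>, followed by
  anything, the reward would be at most \<open>V0 - \<theta>\<delta>/2\<close> up to \<open>O(\<delta>\<^sup>2)\<close>, contradicting that \<open>V0\<close> is the
  supremum over schedules.

  The induction runs over the initial part of the schedule, with \<open>w\<close> the part of \<open>\<delta>\<close> that is still
  to come. Away from the contact point the rate may be larger by a multiple of \<open>dm\<^sup>2\<close>; this and the
  growth of the quartic term are absorbed by the correction \<open>C (dm\<^sup>4 + D w dm\<^sup>2 + E w\<^sup>2)\<close>, whose
  decrease in \<open>w\<close> pays for them and which equals \<open>C E \<delta>\<^sup>2\<close> at the start.
\<close>

lemma value_fun_subsolution: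
  fixes m b r p :: "real^'k::finite"
  assumes "0 \<le> \<sigma>" "pos_vec b" "0 < \<rho>" "\<rho> \<le> \<tau>" "0 < C"
    and up: "\<And>u dm dq. 0 \<le> u \<Longrightarrow> u \<le> \<rho> \<Longrightarrow> \<forall>k. 0 \<le> dq$k \<Longrightarrow> (\<Sum>k\<in>UNIV. dq$k) = u \<Longrightarrow>
      value_fun \<sigma> (\<tau> - u) (m + dm) (b + dq)
        \<le> value_fun \<sigma> \<tau> m b + a * u + r \<bullet> dq + p \<bullet> dm + B dm + C * u\<^sup>2 + C * norm dm ^ 4"
    and B0: "B 0 = 0"
    and B: "\<And>dm y k. B (dm + axis k y) = B dm + L k dm * y + Bd k * y\<^sup>2"
  shows "\<exists>k. 0 \<le> a + r$k + m$k + \<sigma>\<^sup>2 / (b$k)\<^sup>2 * Bd k"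
proof (rule ccontr)
  assume "\<not> ?thesis"
  then have neg: "a + r$k + m$k + \<sigma>\<^sup>2 / (b$k)\<^sup>2 * Bd k < 0" for k
    by (meson not_le)
  define \<theta> where "\<theta> = (MIN k. - (a + r$k + m$k + \<sigma>\<^sup>2 / (b$k)\<^sup>2 * Bd k))"
  have "0 < - (a + r$k + m$k + \<sigma>\<^sup>2 / (b$k)\<^sup>2 * Bd k)" for k
    using neg[of k] by linarith
  then have \<theta>: "0 < \<theta>"
    unfolding \<theta>_def by (subst Min_gr_iff) (blast intro: finite_imageI finite)+
  have \<theta>_le: "a + r$k + m$k + \<sigma>\<^sup>2 / (b$k)\<^sup>2 * Bd k \<le> - \<theta>" for k
  proof -
    have "\<theta> \<le> - (a + r$k + m$k + \<sigma>\<^sup>2 / (b$k)\<^sup>2 * Bd k)"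
      unfolding \<theta>_def by (rule Min_le) auto
    then show ?thesis by simp
  qed
  define \<kappa> where "\<kappa> = (\<Sum>k\<in>UNIV. \<sigma>\<^sup>2 / (b$k)\<^sup>2)"
  have \<kappa>: "\<sigma>\<^sup>2 / (b$k)\<^sup>2 \<le> \<kappa>" for k
    unfolding \<kappa>_def by (rule member_le_sum) auto
  have \<kappa>0: "0 \<le> \<kappa>" unfolding \<kappa>_def by (intro sum_nonneg) auto
  \<comment> \<open>\<open>6\<kappa>\<close> is the growth rate of \<open>dm\<^sup>4\<close> per \<open>dm\<^sup>2\<close>; the rest of \<open>D\<close> pays for replacing \<open>dm\<^sub>k\<close> by
    \<open>\<theta>/4 + 4/\<theta> \<cdot> dm\<^sup>2\<close> in the reward; \<open>E\<close> pays for the fourth moment and for the growth of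
    \<open>D w dm\<^sup>2\<close>\<close>
  define D where "D = 6 * \<kappa> + 4 / (\<theta> * C)"
  define E where "E = 3 * \<kappa>\<^sup>2 + D * \<kappa>"
  have D0: "0 \<le> D" using \<kappa>0 \<theta> \<open>0 < C\<close> by (simp add: D_def)
  have E0: "0 \<le> E" using \<kappa>0 D0 by (simp add: E_def)
  have "\<forall>\<^sub>F \<delta> in at_right 0. \<bar>Bd k\<bar> * (\<sigma>\<^sup>2 / (b$k)\<^sup>2 - \<sigma>\<^sup>2 / (b$k + \<delta>)\<^sup>2) < \<theta> / 4" for k
  proof (rule order_tendstoD)
    have "((\<lambda>\<delta>. \<bar>Bd k\<bar> * (\<sigma>\<^sup>2 / (b$k)\<^sup>2 - \<sigma>\<^sup>2 / (b$k + \<delta>)\<^sup>2)) \<longlongrightarrow>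
        \<bar>Bd k\<bar> * (\<sigma>\<^sup>2 / (b$k)\<^sup>2 - \<sigma>\<^sup>2 / (b$k + 0)\<^sup>2)) (at_right 0)"
      using assms(2) by (intro tendsto_intros) (auto simp: less_imp_neq[symmetric])
    then show "((\<lambda>\<delta>. \<bar>Bd k\<bar> * (\<sigma>\<^sup>2 / (b$k)\<^sup>2 - \<sigma>\<^sup>2 / (b$k + \<delta>)\<^sup>2)) \<longlongrightarrow> 0) (at_right 0)"
      by simp
  qed (use \<theta> in simp)
  then have ev1: "\<forall>\<^sub>F \<delta> in at_right 0. \<forall>k. \<bar>Bd k\<bar> * (\<sigma>\<^sup>2 / (b$k)\<^sup>2 - \<sigma>\<^sup>2 / (b$k + \<delta>)\<^sup>2) < \<theta> / 4"
    by (rule eventually_all_finite)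
  have ev2: "\<forall>\<^sub>F \<delta> in at_right 0. C * (1 + E) * \<delta> < \<theta> / 2"
  proof (rule order_tendstoD)
    have "((\<lambda>\<delta>. C * (1 + E) * \<delta>) \<longlongrightarrow> C * (1 + E) * 0) (at_right 0)" by (intro tendsto_intros)
    then show "((\<lambda>\<delta>. C * (1 + E) * \<delta>) \<longlongrightarrow> 0) (at_right 0)" by simp
  qed (use \<theta> in simp)
  have ev3: "\<forall>\<^sub>F \<delta> in at_right (0::real). 0 < \<delta> \<and> \<delta> < \<rho>"
    using eventually_at_right_less eventually_at_right_real[OF \<open>0 < \<rho>\<close>] by eventually_elim auto
  obtain \<delta> where \<delta>: "0 < \<delta>" "\<delta> \<le> \<rho>" "C * (1 + E) * \<delta> < \<theta> / 2"
    "\<And>k. \<bar>Bd k\<bar> * (\<sigma>\<^sup>2 / (b$k)\<^sup>2 - \<sigma>\<^sup>2 / (b$k + \<delta>)\<^sup>2) \<le> \<theta> / 4"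
    using eventually_happens'[OF _ eventually_conj[OF ev1 eventually_conj[OF ev2 ev3]]]
    by (auto simp: less_imp_le)
  define V0 where "V0 = value_fun \<sigma> \<tau> m b"
  define bound where "bound w s dq dm = V0 + a * s + r \<bullet> dq + p \<bullet> dm + B dm + C * \<delta>\<^sup>2 - \<theta> / 2 * w
      + C * (norm dm ^ 4 + D * w * (norm dm)\<^sup>2 + E * w\<^sup>2)" for w s :: real and dq dm :: "real^'k"
  have main: "sched_value \<sigma> (hs1 @ hs2) (m + dm) (b + dq) \<le> bound (sum_list hs1) s dq dm"
    if hs2: "nonneg_list hs2" "sum_list hs2 = \<tau> - \<delta>" and "nonneg_list hs1" "\<forall>k. 0 \<le> dq$k"
      "s = (\<Sum>k\<in>UNIV. dq$k)" "s + sum_list hs1 = \<delta>" for hs1 hs2 s dq dm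
    using that(3-)
  proof (induction hs1 arbitrary: s dq dm)
    case Nil
    have pos: "pos_vec (b + dq)" using assms(2) Nil by (auto intro: add_pos_nonneg)
    have s: "s = \<delta>" using Nil by simp
    have "sched_value \<sigma> hs2 (m + dm) (b + dq) \<le> value_fun \<sigma> (\<tau> - \<delta>) (m + dm) (b + dq)"
      by (rule sched_value_le_value_fun[OF hs2 pos])
    also have "\<dots> \<le> V0 + a * s + r \<bullet> dq + p \<bullet> dm + B dm + C * \<delta>\<^sup>2 + C * norm dm ^ 4"
      using up[of \<delta> dq dm] Nil \<delta> s by (simp add: V0_def)
    finally show ?case by (simp add: bound_def)
  next
    case (Cons h hs)
    have h: "0 \<le> h" and hs: "nonneg_list hs" using Cons.prems by auto
    define w where "w = sum_list hs"
    have w: "0 \<le> w" "s + h + w = \<delta>" using sum_list_nonneg_list[OF hs] Cons.prems by (simp_all add: w_def)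
    have s_comp: "dq$k \<le> s" for k
      unfolding Cons.prems(3) using Cons.prems by (intro member_le_sum) auto
    define N where "N = (norm dm)\<^sup>2"
    have N0: "0 \<le> N" by (simp add: N_def)
    have pos: "pos_vec (b + dq)" using assms(2) Cons.prems by (auto intro: add_pos_nonneg)
    show ?case
      unfolding append_Cons sum_list.Cons
    proof (rule sched_value_Cons_le)
      fix k
      define \<beta> where "\<beta> = (b + dq)$k"
      define sd where "sd = step_sd \<sigma> \<beta> h"
      define g where "g = \<sigma>\<^sup>2 / (\<beta> * (\<beta> + h))"
      have \<beta>: "0 < b$k" "b$k \<le> \<beta>" "\<beta> + h \<le> b$k + \<delta>"
        using assms(2) Cons.prems s_comp[of k] w by (auto simp: \<beta>_def)
      have sd2: "sd\<^sup>2 = h * g"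
        unfolding sd_def g_def using \<beta> h by (intro step_sd_square_quotient) auto
      have g_up: "g \<le> \<sigma>\<^sup>2 / (b$k)\<^sup>2"
        unfolding g_def power2_eq_square[of "b$k"] using \<beta> h
        by (intro divide_left_mono mult_mono) auto
      have g_low: "\<sigma>\<^sup>2 / (b$k + \<delta>)\<^sup>2 \<le> g"
        unfolding g_def power2_eq_square[of "b$k + \<delta>"] using \<beta> h
        by (intro divide_left_mono mult_mono) auto
      have g0: "0 \<le> g" using \<beta> h by (simp add: g_def)
      \<comment> \<open>\<open>\<delta>\<close> is so small that the change of the diffusion coefficient costs at most \<open>\<theta>/4\<close>\<close>
      have gB: "g * Bd k \<le> \<sigma>\<^sup>2 / (b$k)\<^sup>2 * Bd k + \<theta> / 4"
      proof -
        have "(g - \<sigma>\<^sup>2 / (b$k)\<^sup>2) * Bd k \<le> \<bar>g - \<sigma>\<^sup>2 / (b$k)\<^sup>2\<bar> * \<bar>Bd k\<bar>"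
          by (metis abs_ge_self abs_mult)
        also have "\<dots> \<le> (\<sigma>\<^sup>2 / (b$k)\<^sup>2 - \<sigma>\<^sup>2 / (b$k + \<delta>)\<^sup>2) * \<bar>Bd k\<bar>"
          using g_up g_low by (intro mult_right_mono) auto
        also have "\<dots> \<le> \<theta> / 4" using \<delta>(4)[of k] by (simp add: mult.commute)
        finally show ?thesis by (simp add: left_diff_distrib)
      qed
      have g\<kappa>: "g \<le> \<kappa>" using g_up \<kappa>[of k] by simp
      have dmk: "(dm$k)\<^sup>2 \<le> N"
        using power_mono[OF component_le_norm_cart[of dm k], of 2] by (simp add: N_def)
      have IH: "sched_value \<sigma> (hs @ hs2) (m + dm + axis k (sd * x)) (b + dq + axis k h)
          \<le> bound w (s + h) (dq + axis k h) (dm + axis k (sd * x))" for x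
      proof -
        have "sched_value \<sigma> (hs @ hs2) (m + (dm + axis k (sd * x))) (b + (dq + axis k h))
            \<le> bound (sum_list hs) (s + h) (dq + axis k h) (dm + axis k (sd * x))"
        proof (rule Cons.IH[OF hs])
          show "\<forall>j. 0 \<le> (dq + axis k h)$j" using Cons.prems h by (auto simp: axis_def)
          show "s + h = (\<Sum>j\<in>UNIV. (dq + axis k h)$j)"
            using Cons.prems(3)
            by (subst sum_change_one[where g = "\<lambda>j. dq$j" and k = k]) (auto simp: axis_def)
          show "s + h + sum_list hs = \<delta>" using w by (simp add: w_def)
        qed
        then show ?thesis by (simp add: w_def add.assoc)
      qed
      define c0 where "c0 = V0 + a * (s + h) + r \<bullet> dq + r$k * h + p \<bullet> dm + B dm + C * \<delta>\<^sup>2 - \<theta> / 2 * w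
        + C * (norm dm ^ 4 + D * w * N + E * w\<^sup>2)"
      define c1 where "c1 = (p$k + L k dm + C * (4 * N * dm$k + D * w * (2 * dm$k))) * sd"
      define c2 where "c2 = (Bd k + C * (4 * (dm$k)\<^sup>2 + 2 * N + D * w)) * sd\<^sup>2"
      define c3 where "c3 = C * (4 * dm$k) * sd ^ 3"
      define c4 where "c4 = C * sd ^ 4"
      have poly: "bound w (s + h) (dq + axis k h) (dm + axis k (sd * x))
          = c0 + c1 * x + c2 * x\<^sup>2 + c3 * x ^ 3 + c4 * x ^ 4" for x
        unfolding bound_def norm_power4_axis norm_power2_axis B inner_add_right
          c0_def c1_def c2_def c3_def c4_def N_def
        by (simp add: inner_axis power_mult_distrib algebra_simps)
      have "(\<integral>x. sched_value \<sigma> (hs @ hs2) (m + dm + axis k (sd * x)) (b + dq + axis k h) \<partial>std_normal)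
          \<le> (\<integral>x. c0 + c1 * x + c2 * x\<^sup>2 + c3 * x ^ 3 + c4 * x ^ 4 \<partial>std_normal)"
        using hs hs2 IH unfolding poly
        by (intro integral_mono integrable_sched_value integrable_std_normal_quartic) auto
      also have "\<dots> = c0 + c2 + 3 * c4" by (rule integral_std_normal_quartic)
      finally have "pull \<sigma> h k (sched_value \<sigma> (hs @ hs2)) (m + dm) (b + dq)
          \<le> h * (m$k + dm$k) + (c0 + c2 + 3 * c4)"
        unfolding pull_def sd_def \<beta>_def by simp
      also have "\<dots> \<le> bound (h + sum_list hs) s dq dm"
      proof -
        have "dm$k \<le> \<theta> / 4 + (dm$k)\<^sup>2 / (\<theta> / 4)"
          using abs_le_eta_square[of "\<theta> / 4" "dm$k"] \<theta> by simp
        also have "(dm$k)\<^sup>2 / (\<theta> / 4) \<le> N / (\<theta> / 4)"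
          using dmk \<theta> by (intro divide_right_mono) auto
        finally have d1: "dm$k \<le> \<theta> / 4 + 4 / \<theta> * N" by simp
        have d2: "g * (4 * (dm$k)\<^sup>2 + 2 * N) \<le> \<kappa> * (6 * N)"
          using g\<kappa> dmk g0 N0 \<kappa>0 by (intro mult_mono) auto
        have d3: "g * (D * w) \<le> \<kappa> * (D * w)"
          using g\<kappa> D0 w by (intro mult_right_mono) auto
        have d4: "g\<^sup>2 \<le> \<kappa>\<^sup>2" using g\<kappa> g0 by (intro power_mono) auto
        have sd4: "sd ^ 4 = h\<^sup>2 * g\<^sup>2"
          using power_mult[of sd 2 2] sd2 by (simp add: power_mult_distrib)
        have CD: "C * D * N = 6 * C * \<kappa> * N + 4 / \<theta> * N"
          using \<theta> \<open>0 < C\<close> by (simp add: D_def field_simps)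
        have e1: "h * (m$k + dm$k + a + r$k + g * Bd k)
            \<le> h * (- \<theta> / 2 + 4 / \<theta> * N)"
          using d1 gB \<theta>_le[of k] by (intro mult_left_mono h) linarith
        have e2: "h * (C * (g * (4 * (dm$k)\<^sup>2 + 2 * N))) \<le> h * (C * (\<kappa> * (6 * N)))"
          using d2 h \<open>0 < C\<close> by (intro mult_left_mono) auto
        have e3: "h * (C * (g * (D * w))) \<le> h * (C * (\<kappa> * (D * w)))"
          using d3 h \<open>0 < C\<close> by (intro mult_left_mono) auto
        have e4: "3 * (C * (h\<^sup>2 * g\<^sup>2)) \<le> 3 * (C * (h\<^sup>2 * \<kappa>\<^sup>2))"
          using d4 h \<open>0 < C\<close> by (intro mult_left_mono) auto
        have e5: "h * (C * (\<kappa> * (D * w))) + 3 * (C * (h\<^sup>2 * \<kappa>\<^sup>2)) \<le> C * (E * (2 * w * h + h\<^sup>2))"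
        proof -
          have "0 \<le> C * (6 * \<kappa>\<^sup>2 * (w * h) + D * \<kappa> * (w * h) + D * \<kappa> * h\<^sup>2)"
            using \<open>0 < C\<close> \<kappa>0 D0 w h by simp
          then show ?thesis by (simp add: E_def algebra_simps power2_eq_square)
        qed
        have "h * (m$k + dm$k) + (c0 + c2 + 3 * c4) =
            V0 + a * s + r \<bullet> dq + p \<bullet> dm + B dm + C * \<delta>\<^sup>2 - \<theta> / 2 * w
              + C * (norm dm ^ 4 + D * w * N + E * w\<^sup>2)
            + h * (m$k + dm$k + a + r$k + g * Bd k) + h * (C * (g * (4 * (dm$k)\<^sup>2 + 2 * N)))
            + h * (C * (g * (D * w))) + 3 * (C * (h\<^sup>2 * g\<^sup>2))"
          unfolding c0_def c2_def c4_def sd2 sd4 by (simp add: algebra_simps)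
        also have "\<dots> \<le> V0 + a * s + r \<bullet> dq + p \<bullet> dm + B dm + C * \<delta>\<^sup>2 - \<theta> / 2 * w
              + C * (norm dm ^ 4 + D * w * N + E * w\<^sup>2)
            + h * (- \<theta> / 2 + 4 / \<theta> * N) + h * (C * (\<kappa> * (6 * N))) + C * (E * (2 * w * h + h\<^sup>2))"
          using e1 e2 e3 e4 e5 by linarith
        also have "\<dots> = V0 + a * s + r \<bullet> dq + p \<bullet> dm + B dm + C * \<delta>\<^sup>2 - \<theta> / 2 * w
              + C * (norm dm ^ 4 + D * w * N + E * w\<^sup>2)
            - h * \<theta> / 2 + h * (6 * C * \<kappa> * N + 4 / \<theta> * N) + C * (E * (2 * w * h + h\<^sup>2))"
          by (simp add: algebra_simps)
        also have "\<dots> = bound (h + sum_list hs) s dq dm"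
          unfolding bound_def w_def[symmetric] N_def[symmetric] CD[symmetric]
          by (simp add: algebra_simps power2_eq_square)
        finally show ?thesis .
      qed
      finally show "pull \<sigma> h k (sched_value \<sigma> (hs @ hs2)) (m + dm) (b + dq) \<le> bound (h + sum_list hs) s dq dm" .
    qed
  qed
  have \<tau>: "0 \<le> \<tau>" "\<delta> \<le> \<tau>" using \<delta> assms by auto
  have "V0 \<le> bound \<delta> 0 0 0"
    unfolding V0_def
  proof (rule value_fun_le[OF \<tau>(1)])
    fix hs :: "real list" assume hs: "nonneg_list hs" "sum_list hs = \<tau>"
    obtain hs1 hs2 where *: "nonneg_list hs1" "nonneg_list hs2" "sum_list hs1 = \<delta>"
      "sum_list hs2 = \<tau> - \<delta>" "sched_value \<sigma> hs m b \<le> sched_value \<sigma> (hs1 @ hs2) m b"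
      using sched_value_cut[OF assms(1) hs(1), of \<delta>, where 'k = 'k] hs \<delta> \<tau> assms(2) by auto
    show "sched_value \<sigma> hs m b \<le> bound \<delta> 0 0 0"
      using main[OF *(2,4,1), of 0 0 0] * by simp
  qed
  then have "\<theta> / 2 * \<delta> \<le> C * \<delta>\<^sup>2 + C * (E * \<delta>\<^sup>2)"
    by (simp add: bound_def B0)
  also have "\<dots> = C * (1 + E) * \<delta> * \<delta>" by (simp add: power2_eq_square algebra_simps)
  also have "\<dots> < \<theta> / 2 * \<delta>" using \<delta> by (intro mult_strict_right_mono)
  finally show False by simp
qed

text \<open>
  The lower bound is inserted into \<open>V \<ge> h m\<^sub>k + E V\<close> for one pull of duration \<open>h\<close> started at the contact
  point; division by \<open>h\<close> and \<open>h \<longlonglongrightarrow> 0\<close> give the inequality, since the quartic term contributes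
  \<open>O(h\<^sup>2)\<close>.
\<close>

lemma value_fun_supersolution:
  fixes m b r p :: "real^'k::finite"
  assumes "0 \<le> \<sigma>" "pos_vec b" "0 < \<rho>" "\<rho> \<le> \<tau>"
    and low: "\<And>u dm dq. 0 \<le> u \<Longrightarrow> u \<le> \<rho> \<Longrightarrow> \<forall>k. 0 \<le> dq$k \<Longrightarrow> (\<Sum>k\<in>UNIV. dq$k) = u \<Longrightarrow>
      - value_fun \<sigma> (\<tau> - u) (m + dm) (b + dq)
        \<le> - value_fun \<sigma> \<tau> m b + a * u + r \<bullet> dq + p \<bullet> dm + B dm + C * u\<^sup>2 + C * norm dm ^ 4"
    and B0: "B 0 = 0"
    and B: "\<And>dm y k. B (dm + axis k y) = B dm + L k dm * y + Bd k * y\<^sup>2"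
  shows "m$k \<le> a + r$k + \<sigma>\<^sup>2 / (b$k)\<^sup>2 * Bd k"
proof -
  have bk: "0 < b$k" using assms(2) by simp
  define g where "g h = \<sigma>\<^sup>2 / (b$k * (b$k + h))" for h
  have ineq: "m$k \<le> a + r$k + g h * Bd k + C * h + 3 * C * h * (g h)\<^sup>2" if h: "0 < h" "h \<le> \<rho>" for h
  proof -
    define sd where "sd = step_sd \<sigma> (b$k) h"
    have sd2: "sd\<^sup>2 = h * g h"
      unfolding sd_def g_def using bk h by (intro step_sd_square_quotient) auto
    define c0 where "c0 = value_fun \<sigma> \<tau> m b - (a * h + r$k * h + C * h\<^sup>2)"
    have low': "c0 + (- p$k * sd - L k 0 * sd) * x + (- Bd k * sd\<^sup>2) * x\<^sup>2 + 0 * x ^ 3 + (- C * sd ^ 4) * x ^ 4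
        \<le> value_fun \<sigma> (\<tau> - h) (m + axis k (sd * x)) (b + axis k h)" for x
    proof -
      have 1: "norm (axis k (sd * x)) ^ 4 = sd ^ 4 * x ^ 4"
        by (simp add: norm_axis_real power_mult_distrib flip: power_mult_distrib)
      have 2: "B (axis k (sd * x)) = L k 0 * (sd * x) + Bd k * (sd\<^sup>2 * x\<^sup>2)"
        using B[of 0 k "sd * x"] B0 by (simp add: power_mult_distrib)
      have "- value_fun \<sigma> (\<tau> - h) (m + axis k (sd * x)) (b + axis k h)
          \<le> - value_fun \<sigma> \<tau> m b + a * h + r \<bullet> axis k h + p \<bullet> axis k (sd * x)
            + B (axis k (sd * x)) + C * h\<^sup>2 + C * norm (axis k (sd * x)) ^ 4"
        using h by (intro low) (auto simp: axis_def)
      then show ?thesis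
        unfolding 1 2 c0_def by (simp add: inner_axis algebra_simps)
    qed
    have \<tau>h: "0 \<le> \<tau> - h" "pos_vec (b + axis k h)"
      using h assms pos_vec_add_axis[OF assms(2), of h k] by auto
    have "c0 + (- Bd k * sd\<^sup>2) + 3 * (- C * sd ^ 4)
        = (\<integral>x. c0 + (- p$k * sd - L k 0 * sd) * x + (- Bd k * sd\<^sup>2) * x\<^sup>2 + 0 * x ^ 3 + (- C * sd ^ 4) * x ^ 4 \<partial>std_normal)"
      by (rule integral_std_normal_quartic[symmetric])
    also have "\<dots> \<le> (\<integral>x. value_fun \<sigma> (\<tau> - h) (m + axis k (sd * x)) (b + axis k h) \<partial>std_normal)"
      by (intro integral_mono integrable_std_normal_quartic low' integrable_lipschitz[OF value_fun_lipschitz] \<tau>h)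
    finally have "h * m$k + (c0 + (- Bd k * sd\<^sup>2) + 3 * (- C * sd ^ 4)) \<le> pull \<sigma> h k (value_fun \<sigma> (\<tau> - h)) m b"
      unfolding pull_def sd_def by simp
    also have "\<dots> \<le> value_fun \<sigma> \<tau> m b"
      using pull_value_fun_le[OF assms(1,2) \<tau>h(1), of h k m] h by simp
    finally have "h * m$k \<le> a * h + r$k * h + C * h\<^sup>2 + Bd k * sd\<^sup>2 + 3 * C * (sd\<^sup>2)\<^sup>2"
      by (simp add: c0_def algebra_simps flip: power_mult)
    also have "\<dots> = h * (a + r$k + g h * Bd k + C * h + 3 * C * h * (g h)\<^sup>2)"
      unfolding sd2 by (simp add: power2_eq_square algebra_simps)
    finally show ?thesis using h by simp
  qed
  have lim: "((\<lambda>h. a + r$k + g h * Bd k + C * h + 3 * C * h * (g h)\<^sup>2) \<longlongrightarrow>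
      a + r$k + \<sigma>\<^sup>2 / (b$k * (b$k + 0)) * Bd k + C * 0 + 3 * C * 0 * (\<sigma>\<^sup>2 / (b$k * (b$k + 0)))\<^sup>2) (at_right 0)"
    unfolding g_def using bk by (intro tendsto_intros) auto
  have "\<forall>\<^sub>F h in at_right 0. m$k \<le> a + r$k + g h * Bd k + C * h + 3 * C * h * (g h)\<^sup>2"
    using eventually_at_right_less eventually_at_right_real[OF \<open>0 < \<rho>\<close>]
    by eventually_elim (use ineq in auto)
  from tendsto_lowerbound[OF lim this] show ?thesis
    by (simp add: power2_eq_square)
qed

section \<open>The HJB equation\<close>

lemma deriv_along:
  fixes \<phi> :: "'a::real_inner \<Rightarrow> real"
  assumes "(\<phi> has_derivative (\<lambda>h. g \<bullet> h)) (at x)"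
  shows "((\<lambda>h. \<phi> (x + h *\<^sub>R e)) has_real_derivative g \<bullet> e) (at 0)"
proof -
  have "((\<lambda>h. \<phi> (x + h *\<^sub>R e)) has_derivative (\<lambda>h. g \<bullet> (h *\<^sub>R e))) (at 0)"
    by (rule has_derivative_compose[where f = "\<lambda>h. x + h *\<^sub>R e" and g = \<phi>])
      (use assms in \<open>auto intro!: derivative_eq_intros\<close>)
  then show ?thesis
    by (rule has_derivative_imp_has_field_derivative) (simp add: mult.commute)
qed

lemma open_hjb_domain: "open (hjb_domain :: 'k::finite point set)"
proof -
  have "{q :: real^'k. \<forall>k. q$k \<in> {0<..<1}} = (\<Inter>k. (\<lambda>q. q$k) -` {0<..<1})" by auto
  moreover have "open ((\<lambda>q :: real^'k. q$k) -` {0<..<1})" for k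
    by (rule open_vimage_vec_nth) simp
  ultimately have "open {q :: real^'k. \<forall>k. q$k \<in> {0<..<1}}" by (simp add: open_INT)
  then show ?thesis unfolding hjb_domain_def by (intro open_Times) auto
qed

abbreviation dir_s :: "'k \<Rightarrow> 'k::finite point" where "dir_s k \<equiv> (0, axis k 1, 0)"

lemma partials_eq_gradient:
  fixes \<phi> :: "'k::finite point \<Rightarrow> real"
  assumes "(\<phi> has_derivative (\<lambda>h. g \<bullet> h)) (at x)"
  shows "partial_t \<phi> x = fst g"
    and "partial_s k \<phi> x = fst (snd g) $ k"
    and "partial_q k \<phi> x = snd (snd g) $ k"
proof -
  obtain t s q where x: "x = (t, s, q)" by (cases x) auto
  have eqs: "(t + h, s, q) = x + h *\<^sub>R (1, 0, 0)" "(t, s + axis k h, q) = x + h *\<^sub>R dir_s k"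
    "(t, s, q + axis k h) = x + h *\<^sub>R (0, 0, axis k 1)" for h
    by (simp_all add: x axis_eq_scaleR[of k h])
  note D = DERIV_imp_deriv[OF deriv_along[OF assms]]
  have "partial_t \<phi> x = g \<bullet> (1, 0, 0)" "partial_s k \<phi> x = g \<bullet> dir_s k" "partial_q k \<phi> x = g \<bullet> (0, 0, axis k 1)"
    unfolding partial_t_def partial_s_def partial_q_def
    by (subst x, simp only: prod.case eqs D)+
  then show "partial_t \<phi> x = fst g" "partial_s k \<phi> x = fst (snd g) $ k" "partial_q k \<phi> x = snd (snd g) $ k"
    by (simp_all add: inner_prod_def inner_axis)
qed

lemma second_partial_eq_hessian:
  fixes \<phi> :: "'k::finite point \<Rightarrow> real"
  assumes S: "open S" "x \<in> S"
    and g: "\<And>y. y \<in> S \<Longrightarrow> (\<phi> has_derivative (\<lambda>h. g y \<bullet> h)) (at y)"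
    and H: "(g has_derivative H) (at x)"
  shows "partial_s k (partial_s k \<phi>) x = H (dir_s k) \<bullet> dir_s k"
proof -
  obtain t s q where x: "x = (t, s, q)" by (cases x) auto
  have eq: "(t, s + axis k h, q) = x + h *\<^sub>R dir_s k" for h
    by (simp add: x axis_eq_scaleR[of k h])
  interpret H: bounded_linear H using H by (rule has_derivative_bounded_linear)
  have f: "((\<lambda>h. x + h *\<^sub>R dir_s k) has_derivative (\<lambda>h. h *\<^sub>R dir_s k)) (at 0)"
    by (auto intro!: derivative_eq_intros)
  have "(g has_derivative H) (at (x + 0 *\<^sub>R dir_s k))"
    using H by (simp only: scaleR_zero_left add_0_right)
  from has_derivative_compose[OF f this]
  have "((\<lambda>h. g (x + h *\<^sub>R dir_s k)) has_derivative (\<lambda>h. H (h *\<^sub>R dir_s k))) (at 0)" .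
  then have "((\<lambda>h. g (x + h *\<^sub>R dir_s k) \<bullet> dir_s k) has_derivative (\<lambda>h. H (h *\<^sub>R dir_s k) \<bullet> dir_s k)) (at 0)"
    by (rule has_derivative_inner_left)
  then have D: "((\<lambda>h. g (x + h *\<^sub>R dir_s k) \<bullet> dir_s k) has_real_derivative H (dir_s k) \<bullet> dir_s k) (at 0)"
    by (rule has_derivative_imp_has_field_derivative) (simp only: H.scaleR inner_scaleR_left mult.commute)
  have "((\<lambda>h. x + h *\<^sub>R dir_s k) \<longlongrightarrow> x + 0 *\<^sub>R dir_s k) (nhds 0)"
    by (intro tendsto_intros filterlim_ident)
  from topological_tendstoD[OF this S(1)] S(2)
  have "\<forall>\<^sub>F h in nhds 0. x + h *\<^sub>R dir_s k \<in> S"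
    by (simp only: scaleR_zero_left add_0_right)
  then have ev: "\<forall>\<^sub>F h in nhds 0. g (x + h *\<^sub>R dir_s k) \<bullet> dir_s k = partial_s k \<phi> (x + h *\<^sub>R dir_s k)"
    by eventually_elim (use partials_eq_gradient(2)[OF g] in \<open>auto simp: inner_prod_def inner_axis\<close>)
  have "((\<lambda>h. partial_s k \<phi> (x + h *\<^sub>R dir_s k)) has_real_derivative H (dir_s k) \<bullet> dir_s k) (at 0)"
    using D by (subst DERIV_cong_ev[OF refl eventually_mono[OF ev] refl, symmetric]) auto
  from DERIV_imp_deriv[OF this] show ?thesis
    unfolding partial_s_def[of k "partial_s k \<phi>"] by (subst x) (simp only: prod.case eq)
qed

lemma axis_in_prob_simplex: "axis k 1 \<in> prob_simplex"
  by (auto simp: prob_simplex_def axis_def)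

text \<open>
  The Hamiltonian is linear in the control, so its supremum over the simplex is the largest
  coefficient. This lemma and the next are the two halves of that statement.
\<close>

lemma prob_simplex_sup_ge:
  fixes c :: "'k::finite \<Rightarrow> real"
  shows "c k \<le> (SUP p\<in>prob_simplex. \<Sum>k\<in>UNIV. c k * p$k)"
proof -
  have "bdd_above ((\<lambda>p :: real^'k. \<Sum>k\<in>UNIV. c k * p$k) ` prob_simplex)"
  proof (rule bdd_aboveI2)
    fix p :: "real^'k" assume "p \<in> prob_simplex"
    then have "c k * p$k \<le> \<bar>c k\<bar>" for k
      using mult_left_mono[of "p$k" 1 "\<bar>c k\<bar>"] mult_right_mono[of "c k" "\<bar>c k\<bar>" "p$k"]
      by (simp add: prob_simplex_def) (metis abs_ge_self abs_ge_zero mult.right_neutral order_trans)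
    then show "(\<Sum>k\<in>UNIV. c k * p$k) \<le> (\<Sum>k\<in>UNIV. \<bar>c k\<bar>)" by (rule sum_mono)
  qed
  then have "(\<Sum>j\<in>UNIV. c j * axis k 1 $ j) \<le> (SUP p\<in>prob_simplex. \<Sum>k\<in>UNIV. c k * p$k)"
    by (rule cSUP_upper[OF axis_in_prob_simplex])
  then show ?thesis by (simp add: axis_def if_distrib cong: if_cong)
qed

lemma prob_simplex_sup_le:
  fixes c :: "'k::finite \<Rightarrow> real"
  assumes "\<And>k. c k \<le> X"
  shows "(SUP p\<in>prob_simplex. \<Sum>k\<in>UNIV. c k * p$k) \<le> X"
proof (rule cSUP_least)
  show "prob_simplex \<noteq> ({} :: (real^'k) set)" using axis_in_prob_simplex by blast
  fix p :: "real^'k" assume p: "p \<in> prob_simplex"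
  then have "(\<Sum>k\<in>UNIV. c k * p$k) \<le> (\<Sum>k\<in>UNIV. X * p$k)"
    by (intro sum_mono mult_right_mono assms) (auto simp: prob_simplex_def)
  also have "\<dots> = X" using p by (simp add: prob_simplex_def flip: sum_distrib_left)
  finally show "(\<Sum>k\<in>UNIV. c k * p$k) \<le> X" .
qed

definition limit_mean :: "real^'k \<Rightarrow> real^'k \<Rightarrow> real^'k \<Rightarrow> real^'k \<Rightarrow> real^'k::finite" where
  "limit_mean ah bh s q = (\<chi> k. hat_mu (s$k) (q$k) (ah$k) (bh$k))"

text \<open>
  The limit in the variables of the HJB equation; \<open>1 - t\<close> is the time to go.
\<close>

definition limit_value :: "real^'k \<Rightarrow> real^'k \<Rightarrow> real \<Rightarrow> 'k::finite point \<Rightarrow> real" where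
  "limit_value ah bh sh = (\<lambda>(t, s, q). value_fun sh (1 - t) (limit_mean ah bh s q) (bh + q))"

text \<open>
  In the coordinates \<open>(m, b)\<close> a displacement acts by translation.
\<close>

lemma limit_value_displacement:
  assumes "pos_vec (bh + q)" "\<forall>k. 0 \<le> dq$k"
  shows "limit_value ah bh sh ((t, s, q) + displacement (bh + q) (limit_mean ah bh s q) u dm dq)
    = value_fun sh (1 - t - u) (limit_mean ah bh s q + dm) (bh + q + dq)"
proof -
  have "limit_mean ah bh (s + (cmult (bh + q) dm + cmult (limit_mean ah bh s q) dq + cmult dq dm)) (q + dq)
    = limit_mean ah bh s q + dm"
  proof -
    have "(ah$k + (s$k + ((bh$k + q$k) * dm$k + (ah$k + s$k) / (bh$k + q$k) * dq$k + dq$k * dm$k))) / (bh$k + (q$k + dq$k))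
      = (ah$k + s$k) / (bh$k + q$k) + dm$k" for k
    proof -
      have "0 < bh$k + q$k" "0 \<le> dq$k" using assms by auto
      then have nz: "bh$k + q$k \<noteq> 0" "bh$k + (q$k + dq$k) \<noteq> 0" by auto
      define \<mu> where "\<mu> = (ah$k + s$k) / (bh$k + q$k)"
      have "ah$k + s$k = \<mu> * (bh$k + q$k)" using nz by (simp add: \<mu>_def)
      then have "ah$k + (s$k + ((bh$k + q$k) * dm$k + \<mu> * dq$k + dq$k * dm$k))
        = (\<mu> + dm$k) * (bh$k + (q$k + dq$k))" by (simp add: algebra_simps)
      then show ?thesis using nz unfolding \<mu>_def[symmetric] by simp
    qed
    then show ?thesis
      by (simp add: limit_mean_def cmult_def hat_mu_def vec_eq_iff)
  qed
  then show ?thesis by (simp add: limit_value_def displacement_def algebra_simps)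
qed

lemma limit_value_growth:
  fixes bh q :: "real^'k::finite"
  assumes "pos_vec (bh + q)" "t \<le> 1"
  obtains K where "\<And>u dm dq. 0 \<le> u \<Longrightarrow> u \<le> 1 - t \<Longrightarrow> \<forall>k. 0 \<le> dq$k \<Longrightarrow>
    \<bar>limit_value ah bh sh ((t, s, q) + displacement (bh + q) (limit_mean ah bh s q) u dm dq)\<bar>
      \<le> K * (1 + (norm dm)\<^sup>2)"
proof
  let ?m = "limit_mean ah bh s q" and ?b = "bh + q"
  define K1 where "K1 = (\<Sum>k\<in>UNIV. 3 + 2 * (?m$k)\<^sup>2 + sh\<^sup>2 / ?b$k)"
  fix u :: real and dm dq :: "real^'k"
  assume u: "0 \<le> u" "u \<le> 1 - t" and dq: "\<forall>k. 0 \<le> dq$k"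
  have pos: "pos_vec (?b + dq)" using assms(1) dq by (simp add: add_pos_nonneg)
  have "growth sh (?m + dm) (?b + dq) \<le> (\<Sum>k\<in>UNIV. (3 + 2 * (?m$k)\<^sup>2 + sh\<^sup>2 / ?b$k) * (1 + (norm dm)\<^sup>2))"
    unfolding growth_def
  proof (rule sum_mono)
    fix k
    define X where "X = 3 + 2 * (?m$k)\<^sup>2 + sh\<^sup>2 / ?b$k"
    have bk: "0 < ?b$k" using assms(1) by blast
    have X: "2 \<le> X" using bk by (simp add: X_def add_nonneg_nonneg)
    have "((?m + dm)$k)\<^sup>2 \<le> 2 * (?m$k)\<^sup>2 + 2 * (dm$k)\<^sup>2"
      using zero_le_power2[of "?m$k - dm$k"] by (simp add: power2_eq_square algebra_simps)
    moreover have "(dm$k)\<^sup>2 \<le> (norm dm)\<^sup>2"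
      using power_mono[OF component_le_norm_cart[of dm k], of 2] by simp
    moreover have "sh\<^sup>2 / (?b + dq)$k \<le> sh\<^sup>2 / ?b$k"
      using bk dq by (intro divide_left_mono) (auto intro: mult_pos_pos add_pos_nonneg)
    ultimately have "1 + ((?m + dm)$k)\<^sup>2 + sh\<^sup>2 / (?b + dq)$k \<le> X + 2 * (norm dm)\<^sup>2"
      unfolding X_def by linarith
    also have "\<dots> \<le> X * (1 + (norm dm)\<^sup>2)"
      using mult_right_mono[OF X, of "(norm dm)\<^sup>2"] by (simp add: distrib_left)
    finally show "1 + ((?m + dm)$k)\<^sup>2 + sh\<^sup>2 / (?b + dq)$k
        \<le> (3 + 2 * (?m$k)\<^sup>2 + sh\<^sup>2 / ?b$k) * (1 + (norm dm)\<^sup>2)" unfolding X_def .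
  qed
  then have G: "growth sh (?m + dm) (?b + dq) \<le> K1 * (1 + (norm dm)\<^sup>2)"
    by (simp add: K1_def sum_distrib_right)
  have "\<bar>value_fun sh (1 - t - u) (?m + dm) (?b + dq)\<bar> \<le> (1 - t - u) * growth sh (?m + dm) (?b + dq)"
    using u by (intro value_fun_growth pos) simp
  also have "\<dots> \<le> (1 - t) * growth sh (?m + dm) (?b + dq)"
    using u growth_nonneg[OF pos] by (intro mult_right_mono) auto
  also have "\<dots> \<le> (1 - t) * (K1 * (1 + (norm dm)\<^sup>2))"
    using assms(2) G by (intro mult_left_mono) auto
  finally show "\<bar>limit_value ah bh sh ((t, s, q) + displacement ?b ?m u dm dq)\<bar> \<le> ((1 - t) * K1) * (1 + (norm dm)\<^sup>2)"
    unfolding limit_value_displacement[OF assms(1) dq] by (simp only: mult.assoc)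
qed

lemma touching_taylor:
  fixes v \<phi> :: "'a::euclidean_space \<Rightarrow> real"
  assumes S: "open S" "x \<in> S"
    and g: "\<And>y. y \<in> S \<Longrightarrow> (\<phi> has_derivative (\<lambda>h. g y \<bullet> h)) (at y)"
    and H: "(g has_derivative H) (at x)" and "0 < e"
    and touch: "\<forall>\<^sub>F y in at x within S. v y - \<phi> y \<le> v x - \<phi> x"
  shows "\<exists>r>0. \<forall>d. norm d < r \<longrightarrow> v (x + d) \<le> v x + g x \<bullet> d + H d \<bullet> d / 2 + e * (norm d)\<^sup>2"
proof -
  obtain r1 where r1: "0 < r1"
    "\<And>d. norm d < r1 \<Longrightarrow> \<bar>\<phi> (x + d) - \<phi> x - g x \<bullet> d - H d \<bullet> d / 2\<bar> \<le> e * (norm d)\<^sup>2"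
    using second_order_taylor[OF S g H \<open>0 < e\<close>] by blast
  have "\<forall>\<^sub>F y in at x. v y - \<phi> y \<le> v x - \<phi> x"
    using touch at_within_open[OF S(2,1)] by simp
  then obtain r2 where r2: "0 < r2" "\<And>y. y \<noteq> x \<Longrightarrow> dist y x < r2 \<Longrightarrow> v y - \<phi> y \<le> v x - \<phi> x"
    unfolding eventually_at by auto
  have "v (x + d) \<le> v x + g x \<bullet> d + H d \<bullet> d / 2 + e * (norm d)\<^sup>2" if "norm d < min r1 r2" for d
  proof -
    have "v (x + d) - \<phi> (x + d) \<le> v x - \<phi> x"
      using r2(2)[of "x + d"] that by (cases "d = 0") (auto simp: dist_norm)
    with r1(2)[of d] that show ?thesis by (simp add: abs_le_iff)
  qed
  then show ?thesis using r1(1) r2(1) by (intro exI[of _ "min r1 r2"]) auto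
qed

lemma weighted_quadratic_form_axis:
  fixes b :: "real^'k::finite" and H :: "'k point \<Rightarrow> 'k point" and \<epsilon> :: real
  assumes "bounded_linear H"
  defines "B \<equiv> \<lambda>dm. H (0, cmult b dm, 0) \<bullet> (0, cmult b dm, 0) / 2 + \<epsilon> * (norm dm)\<^sup>2"
  shows "B (dm + axis k y) = B dm
      + (b$k * (H (0, cmult b dm, 0) \<bullet> dir_s k + H (dir_s k) \<bullet> (0, cmult b dm, 0)) / 2 + 2 * \<epsilon> * dm$k) * y
      + ((b$k)\<^sup>2 * (H (dir_s k) \<bullet> dir_s k) / 2 + \<epsilon>) * y\<^sup>2"
proof -
  interpret H: bounded_linear H by (rule assms)
  have "cmult b (dm + axis k y) = cmult b dm + (b$k * y) *\<^sub>R axis k 1"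
    by (simp add: cmult_def vec_eq_iff axis_def distrib_left)
  then have E: "(0, cmult b (dm + axis k y), 0) = (0, cmult b dm, 0) + (b$k * y) *\<^sub>R dir_s k"
    by simp
  have expand: "H (X + c *\<^sub>R D) \<bullet> (X + c *\<^sub>R D) = H X \<bullet> X + c * (H X \<bullet> D + H D \<bullet> X) + c\<^sup>2 * (H D \<bullet> D)"
    for X D :: "'k point" and c
    by (simp only: H.add H.scaleR inner_add_left inner_add_right inner_scaleR_left inner_scaleR_right)
      (simp add: algebra_simps power2_eq_square)
  show ?thesis
    unfolding B_def E expand norm_power2_axis by algebra
qed

text \<open>
  With \<open>p = b \<cdot> \<partial>\<^sub>s\<phi>\<close>, \<open>r = \<partial>\<^sub>q\<phi> + m \<cdot> \<partial>\<^sub>s\<phi>\<close> and \<open>Bd k = b\<^sub>k\<^sup>2 \<partial>\<^sub>s\<^sup>2\<phi>/2 + \<epsilon>\<close> the rate of arm \<open>k\<close> is its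
  Hamiltonian plus \<open>\<epsilon> \<sigma>\<^sup>2/b\<^sub>k\<^sup>2\<close>. As the good arm may depend on \<open>\<epsilon>\<close>, the limit \<open>\<epsilon> \<longlonglongrightarrow> 0\<close> is taken in
  the maximum over the arms.
\<close>

lemma limit_value_subsolution:
  fixes ah bh :: "real^'k::finite"
  assumes "0 \<le> sh" "\<forall>k. 0 \<le> bh$k"
  shows "hjb_viscosity_subsolution ah bh sh (limit_value ah bh sh)"
  unfolding hjb_viscosity_subsolution_def
proof (intro allI ballI impI)
  fix \<phi> and x :: "'k point"
  let ?v = "limit_value ah bh sh"
  assume x: "x \<in> hjb_domain" and C2: "C2_on hjb_domain \<phi>"
    and touch: "\<forall>\<^sub>F y in at x within hjb_domain. ?v y - \<phi> y \<le> ?v x - \<phi> x"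
  obtain g H where g: "\<And>y. y \<in> hjb_domain \<Longrightarrow> (\<phi> has_derivative (\<lambda>h. g y \<bullet> h)) (at y)"
    and H: "(g has_derivative blinfun_apply (H x)) (at x)"
    using C2 x unfolding C2_on_def by blast
  obtain t s q where xe: "x = (t, s, q)" by (cases x) auto
  obtain a gs gq where gx: "g x = (a, gs, gq)" by (cases "g x") auto
  let ?b = "bh + q" and ?m = "limit_mean ah bh s q"
  have t: "0 < t" "t < 1" and q: "\<forall>k. 0 < q$k" using x by (auto simp: hjb_domain_def xe)
  have b: "pos_vec ?b" using q assms(2) by (simp add: add_nonneg_pos)
  obtain K where K: "\<And>u dm dq. 0 \<le> u \<Longrightarrow> u \<le> 1 - t \<Longrightarrow> \<forall>k. 0 \<le> dq$k \<Longrightarrow>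
      \<bar>?v (x + displacement ?b ?m u dm dq)\<bar> \<le> K * (1 + (norm dm)\<^sup>2)"
    using limit_value_growth[OF b, of t] t unfolding xe by (metis less_imp_le)
  let ?h = "\<lambda>k. H x (dir_s k) \<bullet> dir_s k"
  let ?c = "\<lambda>k. gq$k + ?m$k * gs$k + 1/2 * sh\<^sup>2 * ?h k + ?m$k"
  have lin: "bounded_linear (blinfun_apply (H x))" by (rule blinfun.bounded_linear_right)
  have t0: "0 < 1 - t" using t by simp
  have eps: "0 \<le> (MAX k. a + ?c k + \<epsilon> * (sh\<^sup>2 / (?b$k)\<^sup>2))" if e0: "0 < \<epsilon>" for \<epsilon>
  proof -
    have T: "\<exists>r>0. \<forall>d. norm d < r \<longrightarrow>
        ?v (x + d) \<le> ?v x + (a, gs, gq) \<bullet> d + H x d \<bullet> d / 2 + e * (norm d)\<^sup>2" if "0 < e" for e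
      using touching_taylor[OF open_hjb_domain x g H that touch] by (simp only: gx)
    have G: "?v (x + displacement ?b ?m u dm dq) \<le> K * (1 + (norm dm)\<^sup>2)"
      if "0 \<le> u" "u \<le> 1 - t" "\<forall>k. 0 \<le> dq$k" "(\<Sum>k\<in>UNIV. dq$k) = u" for u dm dq
      using K[OF that(1-3), of dm] by simp
    obtain C \<rho> where jet: "0 < C" "0 < \<rho>" "\<rho> \<le> 1 - t"
      "\<And>u dm dq. 0 \<le> u \<Longrightarrow> u \<le> \<rho> \<Longrightarrow> \<forall>k. 0 \<le> dq$k \<Longrightarrow> (\<Sum>k\<in>UNIV. dq$k) = u \<Longrightarrow>
        ?v (x + displacement ?b ?m u dm dq) \<le> ?v x + a * u + (gq + cmult ?m gs) \<bullet> dq + cmult ?b gs \<bullet> dm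
        + (H x (0, cmult ?b dm, 0) \<bullet> (0, cmult ?b dm, 0) / 2 + \<epsilon> * (norm dm)\<^sup>2) + C * u\<^sup>2 + C * norm dm ^ 4"
      using parabolic_jet[OF T lin e0 t0 G] by blast
    have vx: "?v (t, s, q) = value_fun sh (1 - t) ?m ?b" by (simp add: limit_value_def)
    have "\<exists>k. 0 \<le> a + (gq + cmult ?m gs)$k + ?m$k + sh\<^sup>2 / (?b$k)\<^sup>2 * ((?b$k)\<^sup>2 * ?h k / 2 + \<epsilon>)"
    proof (rule value_fun_subsolution[OF assms(1) b jet(2,3,1)])
      show "value_fun sh (1 - t - u) (?m + dm) (?b + dq)
          \<le> value_fun sh (1 - t) ?m ?b + a * u + (gq + cmult ?m gs) \<bullet> dq + cmult ?b gs \<bullet> dm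
            + (H x (0, cmult ?b dm, 0) \<bullet> (0, cmult ?b dm, 0) / 2 + \<epsilon> * (norm dm)\<^sup>2) + C * u\<^sup>2 + C * norm dm ^ 4"
        if "0 \<le> u" "u \<le> \<rho>" "\<forall>k. 0 \<le> dq$k" "(\<Sum>k\<in>UNIV. dq$k) = u" for u dm dq
        using jet(4)[OF that, of dm] limit_value_displacement[OF b that(3), of ah sh t s u dm]
        unfolding xe vx by simp
      show "H x (0, cmult ?b 0, 0) \<bullet> (0, cmult ?b 0, 0) / 2 + \<epsilon> * (norm (0 :: real^'k))\<^sup>2 = 0"
        by (simp add: cmult_def zero_vec_def[symmetric] flip: zero_prod_def)
    qed (rule weighted_quadratic_form_axis[OF blinfun.bounded_linear_right])
    then obtain k where "0 \<le> a + (gq + cmult ?m gs)$k + ?m$k + sh\<^sup>2 / (?b$k)\<^sup>2 * ((?b$k)\<^sup>2 * ?h k / 2 + \<epsilon>)" ..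
    moreover have "?b$k \<noteq> 0" using b by (metis less_irrefl)
    then have "sh\<^sup>2 / (?b$k)\<^sup>2 * ((?b$k)\<^sup>2 * ?h k / 2 + \<epsilon>) = 1/2 * sh\<^sup>2 * ?h k + \<epsilon> * (sh\<^sup>2 / (?b$k)\<^sup>2)"
      by (simp add: field_simps)
    moreover have "(gq + cmult ?m gs)$k = gq$k + ?m$k * gs$k" by (simp add: cmult_def)
    ultimately have "0 \<le> a + ?c k + \<epsilon> * (sh\<^sup>2 / (?b$k)\<^sup>2)" by linarith
    also have "\<dots> \<le> (MAX k. a + ?c k + \<epsilon> * (sh\<^sup>2 / (?b$k)\<^sup>2))" by (rule Max_ge) auto
    finally show ?thesis .
  qed
  have "((\<lambda>\<epsilon>. MAX k. a + ?c k + \<epsilon> * (sh\<^sup>2 / (?b$k)\<^sup>2)) \<longlongrightarrow> (MAX k. a + ?c k + 0 * (sh\<^sup>2 / (?b$k)\<^sup>2))) (at_right 0)"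
    by (intro tendsto_MAX tendsto_intros)
  then have ge: "0 \<le> (MAX k. a + ?c k + 0 * (sh\<^sup>2 / (?b$k)\<^sup>2))"
    by (rule tendsto_lowerbound) (use eps in \<open>auto simp: eventually_at_filter intro!: always_eventually\<close>)
  have "(MAX k. a + ?c k + 0 * (sh\<^sup>2 / (?b$k)\<^sup>2)) \<in> range (\<lambda>k. a + ?c k + 0 * (sh\<^sup>2 / (?b$k)\<^sup>2))"
    by (rule Max_in) auto
  then obtain k where "(MAX k. a + ?c k + 0 * (sh\<^sup>2 / (?b$k)\<^sup>2)) = a + ?c k + 0 * (sh\<^sup>2 / (?b$k)\<^sup>2)"
    by (rule rangeE)
  with ge have "0 \<le> a + ?c k" by (simp only: mult_zero_left add_0_right)
  also have "\<dots> \<le> a + (SUP p\<in>prob_simplex. \<Sum>k\<in>UNIV. ?c k * p$k)"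
    by (intro add_left_mono prob_simplex_sup_ge)
  also have "\<dots> = hjb_lhs ah bh sh \<phi> x"
    using partials_eq_gradient[OF g[OF x]] second_partial_eq_hessian[OF open_hjb_domain x g H]
    by (simp add: hjb_lhs_def xe gx[unfolded xe] limit_mean_def)
  finally show "0 \<le> hjb_lhs ah bh sh \<phi> x" .
qed

text \<open>
  The jet lemma is applied to the negatives of the value function and of the test function.
\<close>

lemma limit_value_supersolution:
  fixes ah bh :: "real^'k::finite"
  assumes "0 \<le> sh" "\<forall>k. 0 \<le> bh$k"
  shows "hjb_viscosity_supersolution ah bh sh (limit_value ah bh sh)"
  unfolding hjb_viscosity_supersolution_def
proof (intro allI ballI impI)
  fix \<phi> and x :: "'k point"
  let ?v = "limit_value ah bh sh"
  assume x: "x \<in> hjb_domain" and C2: "C2_on hjb_domain \<phi>"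
    and touch: "\<forall>\<^sub>F y in at x within hjb_domain. ?v y - \<phi> y \<ge> ?v x - \<phi> x"
  obtain g H where g: "\<And>y. y \<in> hjb_domain \<Longrightarrow> (\<phi> has_derivative (\<lambda>h. g y \<bullet> h)) (at y)"
    and H: "(g has_derivative blinfun_apply (H x)) (at x)"
    using C2 x unfolding C2_on_def by blast
  obtain t s q where xe: "x = (t, s, q)" by (cases x) auto
  obtain a gs gq where gx: "g x = (a, gs, gq)" by (cases "g x") auto
  let ?b = "bh + q" and ?m = "limit_mean ah bh s q"
  have t: "0 < t" "t < 1" and q: "\<forall>k. 0 < q$k" using x by (auto simp: hjb_domain_def xe)
  have b: "pos_vec ?b" using q assms(2) by (simp add: add_nonneg_pos)
  obtain K where K: "\<And>u dm dq. 0 \<le> u \<Longrightarrow> u \<le> 1 - t \<Longrightarrow> \<forall>k. 0 \<le> dq$k \<Longrightarrow>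
      \<bar>?v (x + displacement ?b ?m u dm dq)\<bar> \<le> K * (1 + (norm dm)\<^sup>2)"
    using limit_value_growth[OF b, of t] t unfolding xe by (metis less_imp_le)
  let ?h = "\<lambda>k. H x (dir_s k) \<bullet> dir_s k"
  let ?c = "\<lambda>k. gq$k + ?m$k * gs$k + 1/2 * sh\<^sup>2 * ?h k + ?m$k"
  have lin: "bounded_linear (\<lambda>d. - blinfun_apply (H x) d)"
    by (intro bounded_linear_minus blinfun.bounded_linear_right)
  have ng: "((\<lambda>y. - \<phi> y) has_derivative (\<lambda>h. (- g y) \<bullet> h)) (at y)" if "y \<in> hjb_domain" for y
    using has_derivative_minus[OF g[OF that]] by simp
  have nH: "((\<lambda>y. - g y) has_derivative (\<lambda>d. - blinfun_apply (H x) d)) (at x)"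
    by (rule has_derivative_minus[OF H])
  have ntouch: "\<forall>\<^sub>F y in at x within hjb_domain. - ?v y - - \<phi> y \<le> - ?v x - - \<phi> x"
    using touch by (rule eventually_mono) simp
  have t0: "0 < 1 - t" using t by simp
  have eps: "a + ?c k \<le> \<epsilon> * (sh\<^sup>2 / (?b$k)\<^sup>2)" if e0: "0 < \<epsilon>" for \<epsilon> k
  proof -
    have T: "\<exists>r>0. \<forall>d. norm d < r \<longrightarrow>
        - ?v (x + d) \<le> - ?v x + (- a, - gs, - gq) \<bullet> d + (- H x d) \<bullet> d / 2 + e * (norm d)\<^sup>2" if "0 < e" for e
      using touching_taylor[OF open_hjb_domain x ng nH that ntouch] by (simp only: gx uminus_Pair)
    have G: "- ?v (x + displacement ?b ?m u dm dq) \<le> K * (1 + (norm dm)\<^sup>2)"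
      if "0 \<le> u" "u \<le> 1 - t" "\<forall>k. 0 \<le> dq$k" "(\<Sum>k\<in>UNIV. dq$k) = u" for u dm dq
      using K[OF that(1-3), of dm] by simp
    obtain C \<rho> where jet: "0 < C" "0 < \<rho>" "\<rho> \<le> 1 - t"
      "\<And>u dm dq. 0 \<le> u \<Longrightarrow> u \<le> \<rho> \<Longrightarrow> \<forall>k. 0 \<le> dq$k \<Longrightarrow> (\<Sum>k\<in>UNIV. dq$k) = u \<Longrightarrow>
        - ?v (x + displacement ?b ?m u dm dq) \<le> - ?v x + (- a) * u + (- gq + cmult ?m (- gs)) \<bullet> dq + cmult ?b (- gs) \<bullet> dm
        + ((- H x (0, cmult ?b dm, 0)) \<bullet> (0, cmult ?b dm, 0) / 2 + \<epsilon> * (norm dm)\<^sup>2) + C * u\<^sup>2 + C * norm dm ^ 4"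
      using parabolic_jet[OF T lin e0 t0 G] by blast
    have vx: "?v (t, s, q) = value_fun sh (1 - t) ?m ?b" by (simp add: limit_value_def)
    have "?m$k \<le> - a + (- gq + cmult ?m (- gs))$k
        + sh\<^sup>2 / (?b$k)\<^sup>2 * ((?b$k)\<^sup>2 * ((- H x (dir_s k)) \<bullet> dir_s k) / 2 + \<epsilon>)"
    proof (rule value_fun_supersolution[OF assms(1) b jet(2,3)])
      show "- value_fun sh (1 - t - u) (?m + dm) (?b + dq)
          \<le> - value_fun sh (1 - t) ?m ?b + (- a) * u + (- gq + cmult ?m (- gs)) \<bullet> dq + cmult ?b (- gs) \<bullet> dm
            + ((- H x (0, cmult ?b dm, 0)) \<bullet> (0, cmult ?b dm, 0) / 2 + \<epsilon> * (norm dm)\<^sup>2) + C * u\<^sup>2 + C * norm dm ^ 4"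
        if "0 \<le> u" "u \<le> \<rho>" "\<forall>k. 0 \<le> dq$k" "(\<Sum>k\<in>UNIV. dq$k) = u" for u dm dq
        using jet(4)[OF that, of dm] limit_value_displacement[OF b that(3), of ah sh t s u dm]
        unfolding xe vx by simp
      show "(- H x (0, cmult ?b 0, 0)) \<bullet> (0, cmult ?b 0, 0) / 2 + \<epsilon> * (norm (0 :: real^'k))\<^sup>2 = 0"
        by (simp add: cmult_def zero_vec_def[symmetric] flip: zero_prod_def)
    qed (rule weighted_quadratic_form_axis[OF lin])
    moreover have "?b$k \<noteq> 0" using b by (metis less_irrefl)
    then have "sh\<^sup>2 / (?b$k)\<^sup>2 * ((?b$k)\<^sup>2 * ((- H x (dir_s k)) \<bullet> dir_s k) / 2 + \<epsilon>)
        = - (1/2 * sh\<^sup>2 * ?h k) + \<epsilon> * (sh\<^sup>2 / (?b$k)\<^sup>2)"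
      by (simp add: field_simps)
    moreover have "(- gq + cmult ?m (- gs))$k = - (gq$k) - ?m$k * gs$k" by (simp add: cmult_def)
    ultimately show ?thesis by linarith
  qed
  have c: "a + ?c k \<le> 0" for k
  proof -
    have "((\<lambda>\<epsilon>. \<epsilon> * (sh\<^sup>2 / (?b$k)\<^sup>2)) \<longlongrightarrow> 0 * (sh\<^sup>2 / (?b$k)\<^sup>2)) (at_right 0)"
      by (intro tendsto_intros)
    then have "a + ?c k \<le> 0 * (sh\<^sup>2 / (?b$k)\<^sup>2)"
      by (rule tendsto_lowerbound) (use eps in \<open>auto simp: eventually_at_filter intro!: always_eventually\<close>)
    then show ?thesis by simp
  qed
  have "?c k \<le> - a" for k using c[of k] by linarith
  then have "a + (SUP p\<in>prob_simplex. \<Sum>k\<in>UNIV. ?c k * p$k) \<le> a + - a"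
    by (intro add_left_mono prob_simplex_sup_le)
  moreover have "a + (SUP p\<in>prob_simplex. \<Sum>k\<in>UNIV. ?c k * p$k) = hjb_lhs ah bh sh \<phi> x"
    using partials_eq_gradient[OF g[OF x]] second_partial_eq_hessian[OF open_hjb_domain x g H]
    by (simp add: hjb_lhs_def xe gx[unfolded xe] limit_mean_def)
  ultimately show "hjb_lhs ah bh sh \<phi> x \<le> 0" by simp
qed

lemma limit_value_continuous:
  fixes ah bh :: "real^'k::finite"
  assumes "0 \<le> sh" "\<forall>k. 0 \<le> bh$k"
  shows "continuous_on hjb_domain (limit_value ah bh sh)"
  unfolding continuous_on_def
proof
  fix x :: "'k point" assume x: "x \<in> hjb_domain"
  let ?F = "at x within hjb_domain"
  obtain t s q where xe: "x = (t, s, q)" by (cases x) auto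
  have t: "0 < t" "t < 1" and q: "\<forall>k. 0 < q$k" using x by (auto simp: hjb_domain_def xe)
  have b: "pos_vec (bh + q)" using q assms(2) by (simp add: add_nonneg_pos)
  have id: "((\<lambda>y. y) \<longlongrightarrow> x) ?F" by (rule tendsto_ident_at)
  have ft: "(fst \<longlongrightarrow> t) ?F" and fs: "((\<lambda>y. fst (snd y)) \<longlongrightarrow> s) ?F" and fq: "((\<lambda>y. snd (snd y)) \<longlongrightarrow> q) ?F"
    using tendsto_fst[OF id] tendsto_fst[OF tendsto_snd[OF id]] tendsto_snd[OF tendsto_snd[OF id]]
    by (simp_all add: xe)
  have "((\<lambda>y. value_fun sh (1 - fst y) (limit_mean ah bh (fst (snd y)) (snd (snd y))) (bh + snd (snd y)))
      \<longlongrightarrow> value_fun sh (1 - t) (limit_mean ah bh s q) (bh + q)) ?F"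
  proof (rule value_fun_tendsto[OF assms(1) _ _ _ b])
    show "((\<lambda>y. limit_mean ah bh (fst (snd y)) (snd (snd y))) \<longlongrightarrow> limit_mean ah bh s q) ?F"
      unfolding limit_mean_def hat_mu_def
    proof (rule vec_tendstoI)
      fix k
      show "((\<lambda>y. (\<chi> k. (ah$k + fst (snd y)$k) / (bh$k + snd (snd y)$k)) $ k)
          \<longlongrightarrow> (\<chi> k. (ah$k + s$k) / (bh$k + q$k)) $ k) ?F"
        using b[rule_format, of k] unfolding vec_lambda_beta
        by (intro tendsto_intros tendsto_vec_nth fs fq) auto
    qed
    show "\<forall>\<^sub>F y in ?F. 0 \<le> 1 - fst y"
      by (rule eventually_at_topological[THEN iffD2, OF exI[of _ UNIV]]) (auto simp: hjb_domain_def)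
  qed (use ft fq t in \<open>auto intro!: tendsto_intros\<close>)
  then show "(limit_value ah bh sh \<longlongrightarrow> limit_value ah bh sh x) ?F"
    by (simp add: limit_value_def xe case_prod_unfold)
qed

section \<open>Convergence of the rescaled bandit\<close>

theorem lemma4:
  fixes \<sigma> f :: "nat \<Rightarrow> real"
    and \<alpha> \<beta> :: "nat \<Rightarrow> real^'k::finite"
    and \<alpha>h \<beta>h :: "real^'k" and \<sigma>h :: real
  assumes "\<And>n. n \<ge> 1 \<Longrightarrow> \<sigma> n > 0"
    and "\<And>n k. n \<ge> 1 \<Longrightarrow> \<beta> n $ k > 0"
    and "\<And>n. n \<ge> 1 \<Longrightarrow> f n > 0"
    and "\<And>k. (\<lambda>n. (\<sigma> n)\<^sup>2 * \<alpha> n $ k / (f n * (\<beta> n $ k)\<^sup>2)) \<longlonglongrightarrow> \<alpha>h $ k"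
    and "\<And>k. (\<lambda>n. (\<sigma> n)\<^sup>2 / ((\<beta> n $ k)\<^sup>2 * real n)) \<longlonglongrightarrow> \<beta>h $ k"
    and "(\<lambda>n. sqrt (real n) / f n * \<sigma> n) \<longlonglongrightarrow> \<sigma>h"
  shows "converges_to_hjb f (\<lambda>n. opt_reward (\<sigma> n) (\<alpha> n) (\<beta> n) n) \<alpha>h \<beta>h \<sigma>h"
proof -
  \<comment> \<open>as limits of nonnegative numbers; \<open>\<sigma>h = 0\<close> and \<open>\<beta>h $ k = 0\<close> are possible\<close>
  have \<sigma>h: "0 \<le> \<sigma>h"
  proof (rule tendsto_lowerbound[OF assms(6)])
    show "\<forall>\<^sub>F n in sequentially. 0 \<le> sqrt (real n) / f n * \<sigma> n"
      using eventually_ge_at_top[of 1] by eventually_elim (use assms(1,3) in \<open>simp add: less_imp_le\<close>)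
  qed simp
  have \<beta>h: "\<forall>k. 0 \<le> \<beta>h$k"
  proof
    fix k show "0 \<le> \<beta>h$k" by (rule tendsto_lowerbound[OF assms(5)]) auto
  qed
  show ?thesis
    unfolding converges_to_hjb_def
  proof (intro exI[of _ "limit_value \<alpha>h \<beta>h \<sigma>h"] conjI allI ballI impI)
    show "hjb_viscosity_solution \<alpha>h \<beta>h \<sigma>h (limit_value \<alpha>h \<beta>h \<sigma>h)"
      unfolding hjb_viscosity_solution_def
      using limit_value_continuous limit_value_subsolution limit_value_supersolution \<sigma>h \<beta>h by blast
    show "limit_value \<alpha>h \<beta>h \<sigma>h (1, s, q) = 0" if "q \<in> Q_set \<beta>h" for s q
      using that by (simp add: limit_value_def Q_set_def value_fun_zero)
  next
    fix t s q i S N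
    assume t: "t \<in> {0..1::real}" and q: "q \<in> Q_set \<beta>h"
      and adm: "\<forall>n\<ge>1. i n \<in> {1..n + 1} \<and> admissible (i n) (S n) (N n)"
      and lim_t: "(\<lambda>n. (real (i n) - 1) / real n) \<longlonglongrightarrow> t"
      and lim_s: "(\<lambda>n. (1 / f n) *\<^sub>R S n) \<longlonglongrightarrow> s"
      and lim_q: "(\<lambda>n. \<chi> k. real (N n $ k) / real n) \<longlonglongrightarrow> q"
    have b: "pos_vec (\<beta>h + q)" using q by (simp add: Q_set_def)
    let ?J = "\<lambda>n. n + 1 - i n"
    let ?m = "\<lambda>n. scaled_mean (\<sigma> n) (f n) (\<alpha> n) (\<beta> n) n (S n) (N n)"
    let ?b = "\<lambda>n. scaled_precision (\<sigma> n) (\<beta> n) n (N n)"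
    have ev1: "\<forall>\<^sub>F n in sequentially. 1 \<le> (n::nat)" by (rule eventually_ge_at_top)
    have sk: "(\<lambda>n. S n $ k / f n) \<longlonglongrightarrow> s$k" for k
      using tendsto_vec_nth[OF lim_s, of k] by simp
    have qk: "(\<lambda>n. real (N n $ k) / real n) \<longlonglongrightarrow> q$k" for k
      using tendsto_vec_nth[OF lim_q, of k] by simp
    have "(\<lambda>n. 1 - (real (i n) - 1) / real n) \<longlonglongrightarrow> 1 - t"
      by (intro tendsto_intros lim_t)
    then have J: "(\<lambda>n. real (?J n) * (1 / real n)) \<longlonglongrightarrow> 1 - t"
    proof (rule Lim_transform_eventually)
      show "\<forall>\<^sub>F n in sequentially. 1 - (real (i n) - 1) / real n = real (?J n) * (1 / real n)"
        using ev1
      proof eventually_elim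
        case (elim n)
        then have "i n \<le> n + 1" using adm by auto
        then show ?case using elim by (simp add: field_simps of_nat_diff)
      qed
    qed
    have bn: "?b \<longlonglongrightarrow> \<beta>h + q"
    proof (rule vec_tendstoI)
      fix k show "(\<lambda>n. ?b n $ k) \<longlonglongrightarrow> (\<beta>h + q) $ k"
        unfolding scaled_precision_def vec_lambda_beta vector_add_component
        by (intro tendsto_add assms(5) qk)
    qed
    have mn: "?m \<longlonglongrightarrow> limit_mean \<alpha>h \<beta>h s q"
    proof (rule vec_tendstoI)
      fix k
      have "\<beta>h$k + q$k \<noteq> 0" using b[rule_format, of k] by simp
      then show "(\<lambda>n. ?m n $ k) \<longlonglongrightarrow> limit_mean \<alpha>h \<beta>h s q $ k"
        unfolding scaled_mean_def limit_mean_def hat_mu_def vec_lambda_beta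
        by (intro tendsto_divide tendsto_add assms(4,5) qk sk)
    qed
    have "(\<lambda>n. sched_value (sqrt (real n) / f n * \<sigma> n) (replicate (?J n) (1 / real n)) (?m n) (?b n))
        \<longlonglongrightarrow> value_fun \<sigma>h (1 - t) (limit_mean \<alpha>h \<beta>h s q) (\<beta>h + q)"
      by (rule sched_value_convergence[OF \<sigma>h b _ J assms(6) mn bn]) (use t in simp)
    then have "(\<lambda>n. sched_value (sqrt (real n) / f n * \<sigma> n) (replicate (?J n) (1 / real n)) (?m n) (?b n))
        \<longlonglongrightarrow> limit_value \<alpha>h \<beta>h \<sigma>h (t, s, q)"
      by (simp add: limit_value_def)
    then show "(\<lambda>n. 1 / f n * opt_reward (\<sigma> n) (\<alpha> n) (\<beta> n) n (i n) (S n) (N n))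
        \<longlonglongrightarrow> limit_value \<alpha>h \<beta>h \<sigma>h (t, s, q)"
    proof (rule Lim_transform_eventually)
      show "\<forall>\<^sub>F n in sequentially.
          sched_value (sqrt (real n) / f n * \<sigma> n) (replicate (?J n) (1 / real n)) (?m n) (?b n)
          = 1 / f n * opt_reward (\<sigma> n) (\<alpha> n) (\<beta> n) n (i n) (S n) (N n)"
        using ev1
      proof eventually_elim
        case (elim n)
        then show ?case
          using opt_reward_eq_sched_value[of "\<sigma> n" "\<beta> n" n "f n" "\<alpha> n" "i n" "S n" "N n"]
            assms(1)[of n] assms(2)[of n] assms(3)[of n] by simp
      qed
    qed
  qed
qed

end
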